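(* Let $A$ be the adjacency matrix of the Chung-Lu random graph $\mathcal{G}_n(\vec d_n)$, where the degree sequences $\vec d_n$ satisfy, as $n\to\infty$: (D1) there exists $\xi>2$ such that $(\log n)^{2\xi}\ll m_\infty\ll n^{1/2}$; and (D2) $m_0\asymp m_\infty$. Let $\lambda_1$ be the largest eigenvalue of $A$, let $v_1$ be the corresponding eigenvector, normalized so that $\|v_1\|_2=1$ and with sign chosen so that $\langle v_1,\tilde e\rangle\ge 0$, where $\tilde e=\frac{1}{\sqrt{m_2}}(d_1,\dots,d_n)^t$ is the $\ell^2$-normalized degree vector. Let $v_1(i)$ denote the $i$-th coordinate of $v_1$. Then the following hold. (I) $\langle v_1,\tilde e\rangle=1+o(1)$ as $n\to\infty$, whp. (II) $\displaystyle \|v_1-\tilde e\|_\infty\le O\left(\frac{(\log n)^{\xi}}{\sqrt{n\,m_\infty}}\right)$ as $n\to\infty$, whp. (III) For all $i\in[n]$, $\displaystyle \mathbb{E}[v_1(i)]=\frac{d_i}{\sqrt{m_2}}+O\left(\frac{(\log n)^{2\xi}}{\sqrt{m_2}}\right)$ as $n\to\infty$. Moreover, if the lower bound in (D1) is strengthened to $(\log n)^{4\xi}\ll m_\infty$, then for all $i\in[n]$: (IV) $$\frac{m_2^{3/2}}{m_1}\left(\frac{v_1(i)-d_i/\sqrt{m_2}}{s_1(i)}\right)\longrightarrow\mathcal{N}(0,1)\quad\text{in distribution as } n\to\infty,$$ where $$s_1^2(i)=\sum_{j=1}^n d_j^2\,p_{ij}(1-p_{ij})\sim d_i\,\frac{m_3}{m_1},\qquad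 n\to\infty.$$
   Context: For each $n$, $\vec d_n=(d_i)_{i\in[n]}$ is a sequence of positive integers (depending on $n$; the dependence on $n$ is suppressed in all quantities), $[n]=\{1,\dots,n\}$. Put $m_k=\sum_{i\in[n]}d_i^k$ for $k=1,2,3,\ldots$, $m_\infty=\max_{i\in[n]}d_i$ and $m_0=\min_{i\in[n]}d_i$ (so $m_0$ denotes the minimum, not the sum of zeroth powers). The Chung-Lu random graph $\mathcal{G}_n(\vec d_n)$ has vertex set $[n]$; for each unordered pair of vertices $i,j$ (not necessarily distinct, so self-loops are allowed) an edge is present independently with probability $p_{ij}=d_id_j/m_1$. Its adjacency matrix $A$ is thus the symmetric $n\times n$ matrix whose entries $A(i,j)$, $i\le j$, are independent Bernoulli random variables with parameters $p_{ij}$. Under (D1)-(D2), $p_{ij}\le 1$ for all $i,j$ once $n$ is large, so the model is well defined for all large $n$. "With high probability" (whp) has a specific quantitative meaning: events $\mathcal{E}=\mathcal{E}_n$ hold whp if there exist constants $\xi'>2$ and $\nu>0$ such that $\mathbb{P}(\mathcal{E}_n^c)\le e^{-\nu(\log n)^{\xi'}}$ for all sufficiently large $n$. A statement "$X_n=O(a_n)$ whp" (or "$X_n\le O(a_n)$ whp") means that for some deterministic constant $C$ the event $|X_n|\le Ca_n$ holds whp; "$X_n=1+o(1)$ whp" means that for some deterministic sequence $\epsilon_n\to0$ the event $|X_n-1|\le\epsilon_n$ holds whp. The $\xi$ appearing in the error bounds is the one from (D1). Notation as $n\to\infty$: $a_n\ll b_n$ means $a_n/b_n\to0$; $a_n\asymp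 b_n$ means that $a_n/b_n$ is bounded above and bounded away from zero; $a_n\sim b_n$ means $a_n/b_n\to1$. Statements for $i\in[n]$ are understood for any choice of index $i=i_n\in[n]$. $\mathcal{N}(0,1)$ is the standard Gaussian law. Whenever the eigenvector is not uniquely determined (an event of negligible probability), any measurable choice is made. *)

theory Defs
  imports
    "HOL-Probability.Probability"
    "HOL-Library.Landau_Symbols"
    "Jordan_Normal_Form.Spectral_Radius"
begin

unbundle no vec_syntax
unbundle no inner_syntax

text \<open>
  The vertex set is \<open>{..<n}\<close>, matching the 0-based vectors and matrices of the Jordan normal form
  library. A degree sequence of length \<open>n\<close> is a function \<open>\<delta> :: nat \<Rightarrow> nat\<close> of which only the values
  on \<open>{..<n}\<close> matter.
\<close>

definition deg_moment :: "nat \<Rightarrow> nat \<Rightarrow> (nat \<Rightarrow> nat) \<Rightarrow> real" where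
  "deg_moment k n \<delta> = (\<Sum>i<n. real (\<delta> i) ^ k)"

definition max_deg :: "nat \<Rightarrow> (nat \<Rightarrow> nat) \<Rightarrow> real" where
  "max_deg n \<delta> = real (Max (\<delta> ` {..<n}))"

definition min_deg :: "nat \<Rightarrow> (nat \<Rightarrow> nat) \<Rightarrow> real" where
  "min_deg n \<delta> = real (Min (\<delta> ` {..<n}))"

definition edge_prob :: "nat \<Rightarrow> (nat \<Rightarrow> nat) \<Rightarrow> nat \<Rightarrow> nat \<Rightarrow> real" where
  "edge_prob n \<delta> i j = real (\<delta> i) * real (\<delta> j) / deg_moment 1 n \<delta>"

text \<open>Unordered pairs of vertices; the singletons \<open>{i}\<close> are the self-loops.\<close>

definition vertex_pairs :: "nat \<Rightarrow> nat set set" where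
  "vertex_pairs n = {{i, j} | i j. i < n \<and> j < n}"

text \<open>
  \<open>E\<close> is the random edge set of a Chung--Lu graph, on an arbitrary probability space \<open>M\<close>.
  Measurability of the events that a given edge is present is part of \<^const>\<open>prob_space.indep_events\<close>.
\<close>

definition chung_lu_graph :: "'a measure \<Rightarrow> nat \<Rightarrow> (nat \<Rightarrow> nat) \<Rightarrow> ('a \<Rightarrow> nat set set) \<Rightarrow> bool" where
  "chung_lu_graph M n \<delta> E \<longleftrightarrow>
     prob_space M \<and>
     (\<forall>\<omega>\<in>space M. E \<omega> \<subseteq> vertex_pairs n) \<and>
     prob_space.indep_events M (\<lambda>e. {\<omega> \<in> space M. e \<in> E \<omega>}) (vertex_pairs n) \<and>
     (\<forall>i<n. \<forall>j<n. measure M {\<omega> \<in> space M. {i, j} \<in> E \<omega>} = edge_prob n \<delta> i j)"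

definition adjacency_matrix :: "nat \<Rightarrow> nat set set \<Rightarrow> real mat" where
  "adjacency_matrix n F = Matrix.mat n n (\<lambda>(i, j). if {i, j} \<in> F then 1 else 0)"

text \<open>
  For real symmetric matrices of positive dimension the spectrum over the reals is finite, nonempty
  and contains all eigenvalues, so that the maximum is meaningful.
\<close>

definition largest_eigenvalue :: "real mat \<Rightarrow> real" where
  "largest_eigenvalue B = Max (spectrum B)"

definition degree_vec :: "nat \<Rightarrow> (nat \<Rightarrow> nat) \<Rightarrow> real Matrix.vec" where
  "degree_vec n \<delta> = Matrix.vec n (\<lambda>i. real (\<delta> i) / sqrt (deg_moment 2 n \<delta>))"

definition l2_norm_vec :: "real Matrix.vec \<Rightarrow> real" where
  "l2_norm_vec x = sqrt (x \<bullet> x)"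

definition linf_norm_vec :: "real Matrix.vec \<Rightarrow> real" where
  "linf_norm_vec x = Max ((\<lambda>i. \<bar>x $ i\<bar>) ` {..<dim_vec x})"

definition leading_eigenvector :: "nat \<Rightarrow> (nat \<Rightarrow> nat) \<Rightarrow> real mat \<Rightarrow> real Matrix.vec \<Rightarrow> bool" where
  "leading_eigenvector n \<delta> B x \<longleftrightarrow>
     eigenvector B x (largest_eigenvalue B) \<and> l2_norm_vec x = 1 \<and> x \<bullet> degree_vec n \<delta> \<ge> 0"

text \<open>
  \<open>V\<close> is a measurable choice of leading eigenvector of the adjacency matrix. It may use randomness
  beyond that of the graph when the eigenvector is not unique.
\<close>

definition leading_eigenvector_choice ::
  "'a measure \<Rightarrow> nat \<Rightarrow> (nat \<Rightarrow> nat) \<Rightarrow> ('a \<Rightarrow> nat set set) \<Rightarrow> ('a \<Rightarrow> real Matrix.vec) \<Rightarrow> bool" where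
  "leading_eigenvector_choice M n \<delta> E V \<longleftrightarrow>
     (\<forall>\<omega>\<in>space M. leading_eigenvector n \<delta> (adjacency_matrix n (E \<omega>)) (V \<omega>)) \<and>
     (\<forall>i<n. (\<lambda>\<omega>. V \<omega> $ i) \<in> borel_measurable M)"

text \<open>
  Since \<^const>\<open>measure\<close> is 0 on non-measurable sets, measurability of the events has to be demanded.
\<close>

definition whp :: "(nat \<Rightarrow> 'a measure) \<Rightarrow> (nat \<Rightarrow> 'a \<Rightarrow> bool) \<Rightarrow> bool" where
  "whp M P \<longleftrightarrow>
     (\<exists>\<xi>' \<nu>. \<xi>' > 2 \<and> \<nu> > 0 \<and>
       (\<forall>\<^sub>F n in sequentially.
          {\<omega> \<in> space (M n). P n \<omega>} \<in> sets (M n) \<and>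
          measure (M n) {\<omega> \<in> space (M n). \<not> P n \<omega>} \<le> exp (- \<nu> * ln (real n) powr \<xi>')))"

definition s1_sq :: "nat \<Rightarrow> (nat \<Rightarrow> nat) \<Rightarrow> nat \<Rightarrow> real" where
  "s1_sq n \<delta> i = (\<Sum>j<n. real (\<delta> j) ^ 2 * edge_prob n \<delta> i j * (1 - edge_prob n \<delta> i j))"

end

theory Submission
  imports Defs "HOL-Real_Asymp.Real_Asymp"
begin

text \<open>
  Write \<open>A = \<lambda> e e\<^sup>T + H\<close> with \<open>e\<close> the normalized degree vector, \<open>\<lambda> = m\<^sub>2 / m\<^sub>1\<close> and \<open>H\<close> centered. The leading
  eigenpair satisfies \<open>\<mu> v = \<lambda> \<langle>v, e\<rangle> e + H v\<close>; iterating this gives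
  \<open>v = \<alpha> (\<Sum>k<K. H\<^sup>k e / \<mu>\<^sup>k) + H\<^sup>K v / \<mu>\<^sup>K\<close> with \<open>\<alpha> = \<lambda> \<langle>v, e\<rangle> / \<mu>\<close>, so that \<open>v - e - H e / \<lambda>\<close> is of second
  order as soon as the operator norm of \<open>H\<close>, the entries of \<open>H\<^sup>k e\<close> for \<open>k \<le> log n\<close>, and \<open>\<langle>e, H e\<rangle>\<close> are
  controlled. The last one is Hoeffding's inequality. The entries of \<open>H\<^sup>k x\<close>, for \<open>x\<close> bounded by 1, have
  \<open>p\<close>-th moment at most \<open>(h + 1)\<^bsup>2h+1\<^esup> (C m\<^sub>\<infinity>)\<^sup>h\<close> with \<open>k p = 2h\<close>, by counting the vertex sequences in which
  every edge occurs twice; taking \<open>h\<close> of order \<open>(log n)\<^sup>\<xi>\<close> costs only a factor \<open>(log n)\<^sup>\<xi>\<close> per power of \<open>H\<close>,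
  and this is affordable because \<open>m\<^sub>\<infinity>\<close> dominates \<open>(log n)\<^bsup>2\<xi>\<^esup>\<close>. With \<open>x\<close> a unit vector and \<open>k\<close> large, the
  same bound controls the operator norm. Parts (I)-(III) follow from the expansion, and part (IV) from
  the characteristic function of the linear term \<open>H e / \<lambda>\<close>, whose entries are sums of independent variables.
\<close>

section \<open>Perturbation of a rank one matrix\<close>

text \<open>An operator norm bound on \<open>H\<close> alone controls the Euclidean error of v, not
  its entries, which are of size 1 / sqrt n. Hence the entries of \<open>H^k e\<close> are bounded
  one at a time, by (N sqrt m_inf)^k / sqrt n up to constants, where N = (log n)^xi. Only the
  remainder \<open>H^K v\<close>, where nothing entrywise is known about v, is left to the operator
  norm; K of order log n pushes it below 1 / n. The form <e, H e> needs its own bound because it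
  shifts the eigenvalue to first order. Estimated by the operator norm it would allow an error N /
  sqrt m_inf in \<alpha>, as large as the bound on the linear term; Hoeffding gives N / m_inf, which
  the second order N^2 / m_inf absorbs. The total error per entry is thus N^2 / (m_inf sqrt n),
  while the linear term fluctuates on the scale 1 / sqrt (n m_inf). Their ratio is N^2 / sqrt m_inf,
  and it vanishes exactly under the strengthened lower bound on m_inf. All exceptional events
  together have probability at most exp (- N / 2), which fits the quantitative meaning of whp with
  exponent xi > 2.\<close>

definition ip :: "nat \<Rightarrow> (nat \<Rightarrow> real) \<Rightarrow> (nat \<Rightarrow> real) \<Rightarrow> real" where
  "ip n x y = (\<Sum>i<n. x i * y i)"

definition mv :: "nat \<Rightarrow> (nat \<Rightarrow> nat \<Rightarrow> real) \<Rightarrow> (nat \<Rightarrow> real) \<Rightarrow> nat \<Rightarrow> real" where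
  "mv n H x = (\<lambda>i. \<Sum>j<n. H i j * x j)"

abbreviation unit_fun :: "nat \<Rightarrow> nat \<Rightarrow> real" where
  "unit_fun j \<equiv> (\<lambda>i. if i = j then 1 else 0)"

lemma ip_commute: "ip n x y = ip n y x"
  by (simp add: ip_def mult.commute)

lemma ip_nonneg [simp]: "ip n x x \<ge> 0"
  by (simp add: ip_def sum_nonneg)

lemma ip_add_right: "ip n x (\<lambda>i. y i + z i) = ip n x y + ip n x z"
  and ip_diff_right: "ip n x (\<lambda>i. y i - z i) = ip n x y - ip n x z"
  and ip_scale_right: "ip n x (\<lambda>i. c * y i) = c * ip n x y"
  by (simp_all add: ip_def sum.distrib sum_subtractf sum_distrib_left algebra_simps)

lemma ip_add_left: "ip n (\<lambda>i. y i + z i) x = ip n y x + ip n z x"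
  and ip_diff_left: "ip n (\<lambda>i. y i - z i) x = ip n y x - ip n z x"
  and ip_scale_left: "ip n (\<lambda>i. c * y i) x = c * ip n y x"
  by (simp_all add: ip_def sum.distrib sum_subtractf sum_distrib_left algebra_simps)

lemmas ip_linear = ip_add_right ip_diff_right ip_scale_right ip_add_left ip_diff_left ip_scale_left

lemma ip_cong: "(\<And>i. i < n \<Longrightarrow> x i = x' i) \<Longrightarrow> (\<And>i. i < n \<Longrightarrow> y i = y' i) \<Longrightarrow> ip n x y = ip n x' y'"
  by (simp add: ip_def)

lemma ip_Cauchy_Schwarz: "(ip n x y)\<^sup>2 \<le> ip n x x * ip n y y"
  using Cauchy_Schwarz_ineq_sum[of x y "{..<n}"] by (simp add: ip_def power2_eq_square)

lemma abs_ip_le: "\<bar>ip n x y\<bar> \<le> sqrt (ip n x x) * sqrt (ip n y y)"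
  using ip_Cauchy_Schwarz[of n x y]
  by (metis real_sqrt_abs real_sqrt_le_mono real_sqrt_mult)

lemma coord_le_sqrt_ip: "i < n \<Longrightarrow> \<bar>x i\<bar> \<le> sqrt (ip n x x)"
proof -
  assume "i < n"
  then have "x i * x i \<le> ip n x x"
    unfolding ip_def by (intro member_le_sum) auto
  then show ?thesis by (metis power2_eq_square real_sqrt_abs real_sqrt_le_mono)
qed

lemma ip_self_eq_0_iff: "ip n x x = 0 \<longleftrightarrow> (\<forall>i<n. x i = 0)"
  by (auto simp: ip_def sum_nonneg_eq_0_iff)

lemma mv_add: "mv n H (\<lambda>i. x i + y i) = (\<lambda>i. mv n H x i + mv n H y i)"
  and mv_scale: "mv n H (\<lambda>i. c * x i) = (\<lambda>i. c * mv n H x i)"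
  by (auto simp: mv_def sum.distrib sum_distrib_left algebra_simps)

lemma mv_cong: "(\<And>i. i < n \<Longrightarrow> x i = y i) \<Longrightarrow> mv n H x = mv n H y"
  by (simp add: mv_def)

text \<open>For positive \<open>k\<close> the innermost product reads only entries below
  \<open>n\<close>; the condition on \<open>i\<close> is for \<open>k = 0\<close>, where the value
  at \<open>i\<close> is \<open>x i\<close> itself.\<close>

lemma mv_pow_cong:
  assumes "\<And>i. i < n \<Longrightarrow> x i = y i" "i < n"
  shows "(mv n H ^^ k) x i = (mv n H ^^ k) y i"
  using assms by (cases k) (simp_all del: funpow.simps add: funpow_Suc_right mv_cong[of n x y])

lemma mv_pow_scale: "(mv n H ^^ k) (\<lambda>i. c * x i) = (\<lambda>i. c * (mv n H ^^ k) x i)"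
  by (induction k) (simp_all add: mv_scale)

lemma mv_pow_add: "(mv n H ^^ k) (\<lambda>i. x i + y i) = (\<lambda>i. (mv n H ^^ k) x i + (mv n H ^^ k) y i)"
  by (induction k) (simp_all add: mv_add)

text \<open>The number \<open>(mv n H ^^ k) (unit_fun j) i\<close> is the matrix entry (H^k)(i, j),
  so powers of matrices never have to be formed.\<close>

lemma mv_pow_expand:
  assumes "i < n"
  shows "(mv n H ^^ k) x i = (\<Sum>j<n. x j * (mv n H ^^ k) (unit_fun j) i)"
  using assms
proof (induction k arbitrary: i)
  case 0
  have "(\<Sum>j<n. x j * unit_fun j i) = (\<Sum>j<n. if j = i then x j else 0)"
    by (intro sum.cong) auto
  with 0 show ?case by simp
next
  case (Suc k)
  have "(mv n H ^^ Suc k) x i = (\<Sum>l<n. H i l * (\<Sum>j<n. x j * (mv n H ^^ k) (unit_fun j) l))"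
    using Suc.IH by (simp add: mv_def[of n H "(mv n H ^^ k) x"])
  also have "\<dots> = (\<Sum>j<n. \<Sum>l<n. H i l * (x j * (mv n H ^^ k) (unit_fun j) l))"
    unfolding sum_distrib_left by (rule sum.swap)
  also have "\<dots> = (\<Sum>j<n. x j * (mv n H ^^ Suc k) (unit_fun j) i)"
    unfolding funpow.simps(2) o_apply mv_def[of n H "(mv n H ^^ k) _"]
    by (simp add: sum_distrib_left mult_ac)
  finally show ?case .
qed

lemma ip_mv_symmetric:
  assumes "\<And>i j. i < n \<Longrightarrow> j < n \<Longrightarrow> H i j = H j i"
  shows "ip n (mv n H x) y = ip n x (mv n H y)"
proof -
  have "ip n (mv n H x) y = (\<Sum>i<n. \<Sum>j<n. H i j * x j * y i)"
    by (simp add: ip_def mv_def sum_distrib_right)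
  also have "\<dots> = (\<Sum>j<n. \<Sum>i<n. H i j * x j * y i)" by (rule sum.swap)
  also have "\<dots> = ip n x (mv n H y)"
    unfolding ip_def mv_def sum_distrib_left
    by (intro sum.cong refl) (use assms in auto)
  finally show ?thesis .
qed

section \<open>Operator norm bounds from entries of powers\<close>

text \<open>Convexity makes the ratios of consecutive terms nondecreasing, so that each is at least
  the first one. The products avoid division, since terms may vanish.\<close>

lemma log_convex_growth:
  fixes a :: "nat \<Rightarrow> real"
  assumes nonneg: "\<And>m. a m \<ge> 0" and convex: "\<And>m. (a (Suc m))\<^sup>2 \<le> a m * a (Suc (Suc m))"
  shows "a 1 ^ m * a 0 \<le> a 0 ^ m * a m"
proof -
  have step: "a 1 * a m \<le> a 0 * a (Suc m)" for m
  proof (induction m)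
    case (Suc m)
    show ?case
    proof (cases "a m = 0")
      case True
      then have "a (Suc m) = 0" using convex[of m] by simp
      then show ?thesis using nonneg by simp
    next
      case False
      then have "a m > 0" using nonneg[of m] by linarith
      have "a m * (a 1 * a (Suc m)) \<le> a (Suc m) * (a 0 * a (Suc m))"
        using mult_right_mono[OF Suc nonneg[of "Suc m"]] by (simp add: mult_ac)
      also have "\<dots> \<le> a m * (a 0 * a (Suc (Suc m)))"
        using mult_left_mono[OF convex[of m] nonneg[of 0]] by (simp add: power2_eq_square mult_ac)
      finally show ?thesis using \<open>a m > 0\<close> by simp
    qed
  qed simp
  show ?thesis
  proof (induction m)
    case (Suc m)
    have "a 1 ^ Suc m * a 0 \<le> a 1 * (a 0 ^ m * a m)"
      using mult_left_mono[OF Suc nonneg[of 1]] by (simp add: mult_ac)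
    also have "\<dots> \<le> a 0 ^ m * (a 0 * a (Suc m))"
      using mult_left_mono[OF step[of m], of "a 0 ^ m"] nonneg by (simp add: mult_ac)
    finally show ?case by (simp add: mult_ac)
  qed simp
qed

text \<open>Since \<open>\<parallel>H\<^sup>m x\<parallel>\<close> is log-convex in \<open>m\<close>, a crude entrywise bound on a power of order at
  least \<open>log\<^sub>2 n\<close> controls the operator norm of \<open>H\<close> up to a factor 2.\<close>

lemma opnorm_from_power_entries:
  assumes sym: "\<And>i j. i < n \<Longrightarrow> j < n \<Longrightarrow> H i j = H j i"
    and T: "T \<ge> 0" and k: "k > 0" "real n \<le> 2 ^ k"
    and entries: "\<And>i j. i < n \<Longrightarrow> j < n \<Longrightarrow> \<bar>(mv n H ^^ k) (unit_fun j) i\<bar> \<le> T ^ k"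
  shows "ip n (mv n H x) (mv n H x) \<le> (2 * T)\<^sup>2 * ip n x x"
proof (cases "ip n x x = 0")
  case True
  then have "mv n H x = (\<lambda>_. 0)" by (auto simp: mv_def ip_self_eq_0_iff)
  then have "ip n (mv n H x) (mv n H x) = 0" by (simp add: ip_def)
  with True show ?thesis by simp
next
  case False
  define a where "a m = ip n ((mv n H ^^ m) x) ((mv n H ^^ m) x)" for m
  have a0: "a 0 > 0" using False ip_nonneg[of n x] by (simp add: a_def less_le del: ip_nonneg)
  have growth: "a 1 ^ k * a 0 \<le> a 0 ^ k * a k"
  proof (rule log_convex_growth)
    show "(a (Suc m))\<^sup>2 \<le> a m * a (Suc (Suc m))" for m
    proof -
      \<comment> \<open>Symmetry moves one factor \<open>H\<close> across the inner product;
        Cauchy-Schwarz then gives the convexity of the squared norms.\<close>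
      have "a (Suc m) = ip n ((mv n H ^^ m) x) ((mv n H ^^ Suc (Suc m)) x)"
        by (simp add: a_def ip_mv_symmetric[OF sym])
      then show ?thesis unfolding a_def using ip_Cauchy_Schwarz by metis
    qed
  qed (simp add: a_def)
  have coord: "((mv n H ^^ k) x i)\<^sup>2 \<le> real n * (T ^ k)\<^sup>2 * a 0" if "i < n" for i
  proof -
    have "((mv n H ^^ k) x i)\<^sup>2 = (ip n x (\<lambda>j. (mv n H ^^ k) (unit_fun j) i))\<^sup>2"
      using mv_pow_expand[OF that, where H=H and k=k and x=x] by (simp add: ip_def)
    also have "\<dots> \<le> ip n x x * (\<Sum>j<n. ((mv n H ^^ k) (unit_fun j) i)\<^sup>2)"
      using ip_Cauchy_Schwarz[of n x "\<lambda>j. (mv n H ^^ k) (unit_fun j) i"]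
      by (simp add: ip_def power2_eq_square)
    also have "\<dots> \<le> ip n x x * (\<Sum>j<n. (T ^ k)\<^sup>2)"
      by (intro mult_left_mono sum_mono)
         (simp_all, metis entries that abs_ge_zero power_mono power2_abs)
    finally show ?thesis by (simp add: a_def mult_ac)
  qed
  \<comment> \<open>The crude entrywise estimate loses a factor n^2, at most 4^k by the choice of
    \<open>k\<close>. After the k-th root this is the factor 4 in
    \<open>(2 * T)\<^sup>2\<close>.\<close>
  have "a k \<le> (\<Sum>i<n. real n * (T ^ k)\<^sup>2 * a 0)"
    unfolding a_def[of k] ip_def
    by (intro sum_mono) (use coord in \<open>auto simp: power2_eq_square\<close>)
  also have "\<dots> = (real n)\<^sup>2 * (T ^ k)\<^sup>2 * a 0" by (simp add: power2_eq_square)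
  also have "\<dots> \<le> (2 ^ k)\<^sup>2 * (T ^ k)\<^sup>2 * a 0"
    using k a0 by (intro mult_right_mono power_mono) auto
  also have "\<dots> = ((2 * T)\<^sup>2) ^ k * a 0"
    by (simp only: power_mult_distrib power_mult[symmetric] mult.commute[of 2 k])
  finally have "a 0 ^ k * a k \<le> a 0 ^ k * (((2 * T)\<^sup>2) ^ k * a 0)"
    using a0 by (intro mult_left_mono) auto
  with growth have "a 1 ^ k * a 0 \<le> ((2 * T)\<^sup>2 * a 0) ^ k * a 0"
    by (simp only: power_mult_distrib mult_ac)
  then have "a 1 ^ k \<le> ((2 * T)\<^sup>2 * a 0) ^ k" using a0 by simp
  then have "a 1 \<le> (2 * T)\<^sup>2 * a 0"
    using k a0 by (subst (asm) power_mono_iff) (auto simp: a_def)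
  then show ?thesis by (simp add: a_def)
qed

section \<open>The variational principle for symmetric matrices\<close>

text \<open>Vectors are functions on all of \<open>nat\<close>, so the unit sphere is made compact
  by forcing the entries from \<open>n\<close> on to be 0: it is then a closed subset of a product
  of intervals and singletons, compact by Tychonoff. Homogeneity extends the bound from the sphere
  to every \<open>x\<close>.\<close>

lemma ex_maximizer_quadratic_form:
  assumes "n > 0"
  shows "\<exists>w. ip n w w = 1 \<and> (\<forall>x. ip n x (mv n A x) \<le> ip n w (mv n A w) * ip n x x)"
proof -
  define S where "S = {x. (\<forall>i. i \<ge> n \<longrightarrow> x i = 0) \<and> ip n x x = 1}"
  define K where "K = (\<Pi>\<^sub>E i\<in>UNIV. if i < n then {-1..1} else {0 :: real})"
  have "compactin (product_topology (\<lambda>i. euclidean) UNIV) K"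
    unfolding K_def by (subst compactin_PiE) auto
  then have "compact K" by (simp add: euclidean_product_topology)
  have cont: "continuous_on UNIV (\<lambda>x. ip n x (mv n B x))" for B :: "nat \<Rightarrow> nat \<Rightarrow> real"
    unfolding ip_def mv_def by (intro continuous_intros) auto
  have cont': "continuous_on UNIV (\<lambda>x. ip n x x)"
    unfolding ip_def by (intro continuous_intros) auto
  have "closed {x :: nat \<Rightarrow> real. ip n x x = 1}"
    using continuous_closed_preimage_constant[OF cont' closed_UNIV, of 1] by simp
  moreover have "S = K \<inter> {x. ip n x x = 1}"
  proof (rule Set.set_eqI, rule iffI)
    fix x assume x: "x \<in> S"
    then have "\<bar>x i\<bar> \<le> 1" if "i < n" for i
      using coord_le_sqrt_ip[OF that, of x] by (simp add: S_def)
    with x show "x \<in> K \<inter> {x. ip n x x = 1}"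
      by (fastforce simp: S_def K_def PiE_def abs_le_iff)
  next
    fix x assume "x \<in> K \<inter> {x. ip n x x = 1}"
    then have x: "\<And>i. x i \<in> (if i < n then {-1..1} else {0 :: real})" "ip n x x = 1"
      by (auto simp: K_def PiE_def Pi_def)
    have "x i = 0" if "i \<ge> n" for i using x(1)[of i] that by simp
    with x(2) show "x \<in> S" by (simp add: S_def)
  qed
  ultimately have "compact S" using \<open>compact K\<close> compact_Int_closed by metis
  moreover have "unit_fun 0 \<in> S"
  proof -
    have "ip n (unit_fun 0) (unit_fun 0) = (\<Sum>i<n. if i = 0 then 1 else 0)"
      unfolding ip_def by (intro sum.cong) auto
    with assms show ?thesis by (simp add: S_def)
  qed
  ultimately obtain w where w: "w \<in> S" "\<And>y. y \<in> S \<Longrightarrow> ip n y (mv n A y) \<le> ip n w (mv n A w)"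
    using continuous_attains_sup[of S "\<lambda>x. ip n x (mv n A x)"] continuous_on_subset[OF cont] by blast
  have "ip n x (mv n A x) \<le> ip n w (mv n A w) * ip n x x" for x
  proof (cases "ip n x x = 0")
    case True
    then have "ip n x (mv n A x) = 0" by (subst (asm) ip_self_eq_0_iff) (simp add: ip_def)
    with True show ?thesis by simp
  next
    case False
    then have pos: "ip n x x > 0" using ip_nonneg[of n x] by linarith
    define c where "c = 1 / sqrt (ip n x x)"
    have c2: "c * c = 1 / ip n x x" using pos by (simp add: c_def)
    define y where "y = (\<lambda>i. if i < n then c * x i else 0)"
    have y: "y i = c * x i" if "i < n" for i using that by (simp add: y_def)
    have "ip n y y = c * (c * ip n x x)"
      by (subst ip_cong[of n y "\<lambda>i. c * x i" y "\<lambda>i. c * x i"]) (simp_all add: y ip_linear)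
    then have "y \<in> S" using c2 pos by (simp add: S_def y_def mult.assoc[symmetric])
    then have "ip n y (mv n A y) \<le> ip n w (mv n A w)" by (rule w)
    also have "ip n y (mv n A y) = c * (c * ip n x (mv n A x))"
      by (subst ip_cong[of n y "\<lambda>i. c * x i" "mv n A y" "\<lambda>i. c * mv n A x i"])
         (simp_all add: y ip_linear mv_cong[OF y] mv_scale)
    finally show ?thesis using pos by (simp add: mult.assoc[symmetric] c2 field_simps)
  qed
  with w show ?thesis by (auto simp: S_def)
qed

lemma nonneg_quadratic_imp_linear_coeff_zero:
  fixes b c :: real
  assumes "\<And>t. 2 * t * b + t\<^sup>2 * c \<ge> 0"
  shows "b = 0"
proof (rule ccontr)
  assume "b \<noteq> 0"
  define s where "s = \<bar>c\<bar> + 1"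
  have "s > 0" "c < 2 * s" by (auto simp: s_def)
  have "2 * (- b / s) * b + (- b / s)\<^sup>2 * c = (b\<^sup>2 / s\<^sup>2) * (c - 2 * s)"
    using \<open>s > 0\<close> by (simp add: field_simps power2_eq_square)
  also have "\<dots> < 0" using \<open>b \<noteq> 0\<close> \<open>s > 0\<close> \<open>c < 2 * s\<close> by (intro mult_pos_neg) auto
  finally show False using assms[of "- b / s"] by linarith
qed

text \<open>The maximizer \<open>w\<close> is perturbed in the direction of its own residual
  \<open>y\<close>. The first variation of the quadratic form is then <y, y>, and it must vanish at
  a maximum.\<close>

lemma ex_max_eigenpair:
  assumes n: "n > 0" and sym: "\<And>i j. i < n \<Longrightarrow> j < n \<Longrightarrow> A i j = A j i"
  shows "\<exists>\<mu> w. ip n w w = 1 \<and> (\<forall>i<n. mv n A w i = \<mu> * w i) \<and> (\<forall>x. ip n x (mv n A x) \<le> \<mu> * ip n x x)"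
proof -
  obtain w where w: "ip n w w = 1" and max: "\<And>x. ip n x (mv n A x) \<le> ip n w (mv n A w) * ip n x x"
    using ex_maximizer_quadratic_form[OF n, of A] by blast
  define \<mu> where "\<mu> = ip n w (mv n A w)"
  define y where "y = (\<lambda>i. \<mu> * w i - mv n A w i)"
  have "2 * t * ip n y y + t\<^sup>2 * (\<mu> * ip n y y - ip n y (mv n A y)) \<ge> 0" for t
  proof -
    have A: "ip n w (mv n A y) = ip n y (mv n A w)"
      using ip_mv_symmetric[OF sym, where x=w and y=y] by (simp add: ip_commute)
    \<comment> \<open>Only one of the two copies of \<open>y\<close> is expanded, which exhibits <y,
      y> as the linear coefficient of the quadratic in \<open>t\<close>.\<close>
    have yy: "ip n y y = \<mu> * ip n y w - ip n y (mv n A w)"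
      by (subst (2) y_def) (simp add: ip_linear)
    have "0 \<le> \<mu> * ip n (\<lambda>i. w i + t * y i) (\<lambda>i. w i + t * y i)
        - ip n (\<lambda>i. w i + t * y i) (mv n A (\<lambda>i. w i + t * y i))"
      using max[of "\<lambda>i. w i + t * y i"] by (simp add: \<mu>_def)
    also have "\<dots> = 2 * t * (\<mu> * ip n y w - ip n y (mv n A w)) + t\<^sup>2 * (\<mu> * ip n y y - ip n y (mv n A y))"
      by (simp add: mv_add mv_scale ip_linear w A ip_commute[of n w y] \<mu>_def[symmetric]
          algebra_simps power2_eq_square)
    finally show ?thesis by (simp add: yy)
  qed
  then have "ip n y y = 0" by (rule nonneg_quadratic_imp_linear_coeff_zero)
  then have "\<forall>i<n. mv n A w i = \<mu> * w i" by (auto simp: ip_self_eq_0_iff y_def)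
  with w max show ?thesis by (auto simp: \<mu>_def)
qed


lemma abs_ip_mv_le:
  assumes h: "h \<ge> 0" "\<And>x. ip n (mv n H x) (mv n H x) \<le> h\<^sup>2 * ip n x x"
  shows "\<bar>ip n x (mv n H y)\<bar> \<le> h * sqrt (ip n x x) * sqrt (ip n y y)"
proof -
  have "sqrt (ip n (mv n H y) (mv n H y)) \<le> sqrt (h\<^sup>2 * ip n y y)"
    by (intro real_sqrt_le_mono h)
  also have "\<dots> = h * sqrt (ip n y y)" using h(1) by (simp add: real_sqrt_mult)
  finally have "sqrt (ip n x x) * sqrt (ip n (mv n H y) (mv n H y)) \<le> sqrt (ip n x x) * (h * sqrt (ip n y y))"
    by (intro mult_left_mono) auto
  with abs_ip_le[of n x "mv n H y"] show ?thesis by (simp add: mult_ac)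
qed

lemma ip_mv_pow_le:
  assumes "\<And>x. ip n (mv n H x) (mv n H x) \<le> h\<^sup>2 * ip n x x"
  shows "ip n ((mv n H ^^ k) x) ((mv n H ^^ k) x) \<le> (h ^ k)\<^sup>2 * ip n x x"
proof (induction k)
  case (Suc k)
  have "ip n ((mv n H ^^ Suc k) x) ((mv n H ^^ Suc k) x) \<le> h\<^sup>2 * ip n ((mv n H ^^ k) x) ((mv n H ^^ k) x)"
    using assms by simp
  also have "\<dots> \<le> h\<^sup>2 * ((h ^ k)\<^sup>2 * ip n x x)" using Suc by (intro mult_left_mono) auto
  finally show ?case by (simp add: power_mult_distrib mult_ac)
qed simp

section \<open>The leading eigenpair of a perturbed rank one matrix\<close>

text \<open>A deterministic setting for one outcome. \<open>top\<close> is what remains of the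
  maximality of \<mu>: the Rayleigh quotient of the test vector \<open>e\<close>. The bound
  \<open>g\<close> on the quadratic form is kept apart from the operator norm bound \<open>h\<close>
  because it will be much smaller.\<close>

locale perturbed_rank_one =
  fixes n :: nat and H :: "nat \<Rightarrow> nat \<Rightarrow> real" and e v :: "nat \<Rightarrow> real" and lam \<mu> h g :: real
  assumes sym: "\<And>i j. i < n \<Longrightarrow> j < n \<Longrightarrow> H i j = H j i"
    and unit_e: "ip n e e = 1" and unit_v: "ip n v v = 1"
    and orient: "ip n v e \<ge> 0"
    and eigen: "\<And>i. i < n \<Longrightarrow> \<mu> * v i = lam * ip n v e * e i + mv n H v i"
    and top: "\<mu> \<ge> lam + ip n e (mv n H e)"
    and h: "h \<ge> 0" "\<And>x. ip n (mv n H x) (mv n H x) \<le> h\<^sup>2 * ip n x x"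
    and g: "\<bar>ip n e (mv n H e)\<bar> \<le> g"
    and gap: "lam > 0" "8 * h \<le> lam"
begin

definition w :: "nat \<Rightarrow> real" where "w = (\<lambda>i. v i - ip n v e * e i)"

lemma ip_e_mv_e: "\<bar>ip n e (mv n H e)\<bar> \<le> h"
  and ip_v_mv_v: "\<bar>ip n v (mv n H v)\<bar> \<le> h"
  using abs_ip_mv_le[OF h, of e e] abs_ip_mv_le[OF h, of v v] by (simp_all add: unit_e unit_v)

lemma eigenvalue_ge: "\<mu> \<ge> 7 / 8 * lam"
  using top ip_e_mv_e gap by linarith

lemma eigenvalue_pos: "\<mu> > 0"
  using eigenvalue_ge gap by linarith

lemma overlap_le_1: "ip n v e \<le> 1"
  using abs_ip_le[of n v e] by (simp add: unit_e unit_v)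

lemma ip_eigen: "\<mu> * ip n y v = lam * ip n v e * ip n y e + ip n y (mv n H v)"
proof -
  have "\<mu> * ip n y v = ip n y (\<lambda>i. \<mu> * v i)" by (simp add: ip_linear)
  also have "\<dots> = ip n y (\<lambda>i. lam * ip n v e * e i + mv n H v i)"
    by (intro ip_cong) (use eigen in auto)
  finally show ?thesis by (simp add: ip_linear)
qed

text \<open>Pairing the eigenvalue equation with \<open>v\<close> gives \<mu> = lam c^2 + <v, H v>
  for the overlap c, while \<open>top\<close> gives \<mu> \<ge> lam - h. This a priori bound is what
  later allows division by c.\<close>

lemma overlap_ge_half: "ip n v e \<ge> 1 / 2"
proof -
  have "lam * (ip n v e)\<^sup>2 \<ge> lam - 2 * h"
    using ip_eigen[of v] ip_v_mv_v ip_e_mv_e top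
    by (simp add: unit_v power2_eq_square)
  then have "lam * (1 / 4) \<le> lam * (ip n v e)\<^sup>2" using gap by linarith
  then have "1 / 4 \<le> (ip n v e)\<^sup>2" by (simp only: mult_le_cancel_left_pos gap)
  then have "(1 / 2)\<^sup>2 \<le> (ip n v e)\<^sup>2" by (simp add: power2_eq_square)
  then show ?thesis using orient power2_le_imp_le by blast
qed

lemma w_orth: "ip n w e = 0"
  by (simp add: w_def ip_linear unit_e)

lemma ip_w_w: "ip n w w = 1 - (ip n v e)\<^sup>2"
  by (simp add: w_def ip_linear unit_e unit_v ip_commute[of n e v] power2_eq_square)

text \<open>Pairing the eigenvalue equation with \<open>w\<close> removes the rank one part and
  leaves \<mu> |w|^2 = <w, H v> \<le> h |w|. The constant 8 / 7 comes from
  \<open>eigenvalue_ge\<close>, and its square is below 2.\<close>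

lemma ip_w_w_le: "ip n w w \<le> 2 * (h / lam)\<^sup>2"
proof -
  define s where "s = sqrt (ip n w w)"
  have s: "s \<ge> 0" "s\<^sup>2 = ip n w w" by (auto simp: s_def)
  have "ip n w v = ip n w w"
    using w_orth by (simp add: w_def ip_linear)
  then have "\<mu> * s\<^sup>2 = ip n w (mv n H v)"
    using ip_eigen[of w] by (simp add: w_orth s)
  also have "\<dots> \<le> h * s" using abs_ip_mv_le[OF h, of w v] by (simp add: s_def unit_v)
  finally have "s * (\<mu> * s) \<le> s * h" by (simp add: power2_eq_square mult_ac)
  then have "s = 0 \<or> \<mu> * s \<le> h" using s by (auto simp: mult_le_cancel_left)
  moreover have "7 / 8 * lam * s \<le> \<mu> * s" using eigenvalue_ge s by (intro mult_right_mono) auto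
  ultimately have "7 / 8 * lam * s \<le> h" using h by auto
  then have "s \<le> 8 / 7 * (h / lam)" using gap by (simp add: field_simps)
  then have "s\<^sup>2 \<le> (8 / 7 * (h / lam))\<^sup>2" using s by (intro power_mono) auto
  also have "\<dots> = (8 / 7)\<^sup>2 * (h / lam)\<^sup>2" by (simp only: power_mult_distrib)
  also have "\<dots> \<le> 2 * (h / lam)\<^sup>2" by (intro mult_right_mono) (auto simp: power2_eq_square)
  finally show ?thesis by (simp add: s)
qed

text \<open>For an overlap c in [0, 1], 1 - c \<le> 1 - c^2 = |w|^2, so the error is quadratic in
  \<open>h / lam\<close>.\<close>

lemma overlap_bound: "\<bar>ip n v e - 1\<bar> \<le> 2 * (h / lam)\<^sup>2"
proof -
  have "ip n v e * ip n v e \<le> ip n v e * 1" using overlap_le_1 orient by (intro mult_left_mono) auto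
  then show ?thesis using ip_w_w_le ip_w_w overlap_le_1 by (simp add: power2_eq_square)
qed

text \<open>Pairing with \<open>e\<close> gives c (\<mu> - lam - <e, H e>) = <e, H w> for the
  overlap c. As \<open>w\<close> has norm of order h / lam, the right side is of second order, and
  the only first-order shift is the one that \<open>g\<close> bounds.\<close>

lemma eigenvalue_bound: "\<bar>\<mu> - lam\<bar> \<le> g + 4 * h * (h / lam)"
proof -
  define c where "c = ip n v e"
  have c: "c \<ge> 1 / 2" using overlap_ge_half by (simp add: c_def)
  have v: "mv n H v = (\<lambda>i. c * mv n H e i + mv n H w i)"
    using mv_add[of n H "\<lambda>i. c * e i" w] by (simp add: mv_scale w_def c_def)
  have "\<mu> * c = lam * c + c * ip n e (mv n H e) + ip n e (mv n H w)"
    using ip_eigen[of e] by (simp add: v ip_linear unit_e ip_commute[of n e v] c_def[symmetric])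
  then have eq: "c * (\<mu> - lam - ip n e (mv n H e)) = ip n e (mv n H w)"
    by (simp add: algebra_simps)
  have "\<bar>ip n e (mv n H w)\<bar> \<le> h * sqrt (ip n w w)"
    using abs_ip_mv_le[OF h, of e w] by (simp add: unit_e)
  also have "\<dots> \<le> h * (2 * (h / lam))"
  proof (intro mult_left_mono h real_le_lsqrt)
    have "2 * (h / lam)\<^sup>2 \<le> (2 * (h / lam))\<^sup>2" unfolding power_mult_distrib by simp
    with ip_w_w_le show "ip n w w \<le> (2 * (h / lam))\<^sup>2" by linarith
  qed (use h gap in auto)
  finally have "c * \<bar>\<mu> - lam - ip n e (mv n H e)\<bar> \<le> h * (2 * (h / lam))"
    using c by (simp add: eq[symmetric] abs_mult)
  moreover have "1 / 2 * \<bar>\<mu> - lam - ip n e (mv n H e)\<bar> \<le> c * \<bar>\<mu> - lam - ip n e (mv n H e)\<bar>"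
    using c by (intro mult_right_mono) auto
  ultimately have "1 / 2 * \<bar>\<mu> - lam - ip n e (mv n H e)\<bar> \<le> h * (2 * (h / lam))"
    by (rule order_trans[rotated])
  then have close: "\<bar>\<mu> - lam - ip n e (mv n H e)\<bar> \<le> 4 * h * (h / lam)" by simp
  have "\<bar>\<mu> - lam\<bar> \<le> \<bar>ip n e (mv n H e)\<bar> + \<bar>\<mu> - lam - ip n e (mv n H e)\<bar>"
    using abs_triangle_ineq[of "ip n e (mv n H e)" "\<mu> - lam - ip n e (mv n H e)"] by simp
  also have "\<dots> \<le> g + 4 * h * (h / lam)" by (intro add_mono g close)
  finally show ?thesis .
qed

definition \<alpha> :: real where "\<alpha> = lam * ip n v e / \<mu>"

lemma eigenvector_expansion:
  assumes "i < n"
  shows "v i = \<alpha> * (\<Sum>k<K. (mv n H ^^ k) e i / \<mu> ^ k) + (mv n H ^^ K) v i / \<mu> ^ K"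
proof (induction K)
  case (Suc K)
  have "\<mu> * (mv n H ^^ K) v i = (mv n H ^^ K) (\<lambda>i. \<mu> * v i) i"
    by (simp add: mv_pow_scale)
  also have "\<dots> = (mv n H ^^ K) (\<lambda>i. lam * ip n v e * e i + mv n H v i) i"
    by (intro mv_pow_cong assms) (use eigen in auto)
  also have "\<dots> = lam * ip n v e * (mv n H ^^ K) e i + (mv n H ^^ Suc K) v i"
    by (simp add: mv_pow_add mv_pow_scale funpow_swap1)
  finally have "(mv n H ^^ K) v i = \<alpha> * (mv n H ^^ K) e i + (mv n H ^^ Suc K) v i / \<mu>"
    using eigenvalue_pos by (simp add: \<alpha>_def field_simps)
  then have "(mv n H ^^ K) v i / \<mu> ^ K = \<alpha> * ((mv n H ^^ K) e i / \<mu> ^ K) + (mv n H ^^ Suc K) v i / \<mu> ^ Suc K"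
    by (simp add: add_divide_distrib)
  with Suc show ?case by (simp add: algebra_simps)
qed simp

text \<open>\<alpha> multiplies \<open>e\<close> in the expansion and \<alpha> / \<mu> multiplies
  \<open>H e\<close>. Both deviations contain the factor lam / \<mu> \<le> 8 / 7 times a sum of
  relative errors of the overlap and of the eigenvalue.\<close>

lemma alpha_bounds:
  shows alpha_bound: "\<bar>\<alpha> - 1\<bar> \<le> 8 * (h / lam)\<^sup>2 + 2 * (g / lam)"
    and alpha_bound': "\<bar>\<alpha> / \<mu> - 1 / lam\<bar> \<le> (16 * (h / lam)\<^sup>2 + 4 * (g / lam)) / lam"
    and alpha_le: "\<bar>\<alpha>\<bar> \<le> 2"
proof -
  define c where "c = ip n v e"
  have pos: "\<mu> > 0" "lam > 0" using eigenvalue_pos gap by auto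
  have r: "lam / \<mu> \<le> 8 / 7" using eigenvalue_ge pos by (simp add: field_simps)
  have r0: "lam / \<mu> \<ge> 0" using pos by simp
  have d: "\<bar>\<mu> - lam\<bar> / lam \<le> g / lam + 4 * (h / lam)\<^sup>2"
    using divide_right_mono[OF eigenvalue_bound, of lam] pos
    by (simp add: power2_eq_square add_divide_distrib)
  have g0: "g / lam \<ge> 0" using g pos by simp
  have "\<alpha> - 1 = lam / \<mu> * ((c - 1) + (lam - \<mu>) / lam)"
    using pos by (simp add: \<alpha>_def c_def field_simps)
  then have "\<bar>\<alpha> - 1\<bar> = lam / \<mu> * \<bar>(c - 1) + (lam - \<mu>) / lam\<bar>"
    using r0 by (simp only: abs_mult abs_of_nonneg)
  also have "\<dots> \<le> 8 / 7 * (2 * (h / lam)\<^sup>2 + (g / lam + 4 * (h / lam)\<^sup>2))"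
  proof (intro mult_mono r)
    have "\<bar>(lam - \<mu>) / lam\<bar> = \<bar>\<mu> - lam\<bar> / lam" using pos by (simp add: abs_minus_commute)
    then show "\<bar>(c - 1) + (lam - \<mu>) / lam\<bar> \<le> 2 * (h / lam)\<^sup>2 + (g / lam + 4 * (h / lam)\<^sup>2)"
      using overlap_bound d abs_triangle_ineq[of "c - 1" "(lam - \<mu>) / lam"] unfolding c_def by linarith
  qed auto
  also have "\<dots> \<le> 8 * (h / lam)\<^sup>2 + 2 * (g / lam)"
    using g0 zero_le_power2[of "h / lam"] unfolding distrib_left by linarith
  finally show 1: "\<bar>\<alpha> - 1\<bar> \<le> 8 * (h / lam)\<^sup>2 + 2 * (g / lam)" .
  have "\<alpha> / \<mu> - 1 / lam = lam / \<mu> * ((\<alpha> - 1) + (lam - \<mu>) / lam) / lam"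
    using pos by (simp add: field_simps)
  then have "\<bar>\<alpha> / \<mu> - 1 / lam\<bar> = lam / \<mu> * \<bar>(\<alpha> - 1) + (lam - \<mu>) / lam\<bar> / lam"
    using r0 pos by (simp only: abs_mult abs_divide abs_of_nonneg abs_of_pos)
  also have "\<dots> \<le> 8 / 7 * ((8 * (h / lam)\<^sup>2 + 2 * (g / lam)) + (g / lam + 4 * (h / lam)\<^sup>2)) / lam"
  proof (intro divide_right_mono mult_mono r)
    have "\<bar>(lam - \<mu>) / lam\<bar> = \<bar>\<mu> - lam\<bar> / lam" using pos by (simp add: abs_minus_commute)
    then show "\<bar>(\<alpha> - 1) + (lam - \<mu>) / lam\<bar> \<le> (8 * (h / lam)\<^sup>2 + 2 * (g / lam)) + (g / lam + 4 * (h / lam)\<^sup>2)"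
      using 1 d abs_triangle_ineq[of "\<alpha> - 1" "(lam - \<mu>) / lam"] by linarith
  qed (use pos in auto)
  also have "\<dots> \<le> (16 * (h / lam)\<^sup>2 + 4 * (g / lam)) / lam"
    using g0 zero_le_power2[of "h / lam"] pos unfolding distrib_left
    by (intro divide_right_mono) linarith+
  finally show "\<bar>\<alpha> / \<mu> - 1 / lam\<bar> \<le> (16 * (h / lam)\<^sup>2 + 4 * (g / lam)) / lam" .
  have "\<bar>\<alpha>\<bar> = lam / \<mu> * c" using pos orient by (simp add: \<alpha>_def c_def abs_mult)
  also have "\<dots> \<le> 8 / 7 * 1" using r overlap_le_1 orient by (intro mult_mono) (auto simp: c_def)
  finally show "\<bar>\<alpha>\<bar> \<le> 2" by simp
qed

text \<open>The terms k = 0 and k = 1 of the expansion give \<open>e i\<close> and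
  \<open>H e\<close> up to the errors of their coefficients. The terms from k = 2 on form a
  geometric series of ratio T / \<mu>, below 1 / 2, and the remainder uses the operator norm because
  no entrywise bound on \<open>v\<close> is available.\<close>

lemma eigenvector_first_order:
  assumes i: "i < n" and K: "K \<ge> 2" and T: "0 \<le> T" "T \<le> h" and a: "a \<ge> 0"
    and entries: "\<And>k. k < K \<Longrightarrow> \<bar>(mv n H ^^ k) e i\<bar> \<le> a * T ^ k"
  shows "\<bar>v i - e i - mv n H e i / lam\<bar> \<le> a * (20 * (h / lam)\<^sup>2 + 4 * (g / lam)) + (2 * h / lam) ^ K"
proof -
  have pos: "\<mu> > 0" "lam > 0" using eigenvalue_pos gap by auto
  obtain m where m: "K = Suc (Suc m)" using le_Suc_ex[OF K] by auto
  define R where "R = (\<Sum>k<m. (mv n H ^^ (k + 2)) e i / \<mu> ^ (k + 2))"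
  have T\<mu>: "T / \<mu> \<le> 8 / 7 * (h / lam)"
    using mult_mono[OF T(2) eigenvalue_ge] T pos h by (simp add: field_simps)
  have hl: "h / lam \<le> 1 / 8" "h / lam \<ge> 0" using gap h by (auto simp: field_simps)
  have T0: "T / \<mu> \<ge> 0" using T pos by simp
  have sum_eq: "(\<Sum>k<K. (mv n H ^^ k) e i / \<mu> ^ k) = e i + mv n H e i / \<mu> + R"
    unfolding m R_def by (subst sum.lessThan_Suc_shift, subst sum.lessThan_Suc_shift) simp
  have "\<bar>R\<bar> \<le> (\<Sum>k<m. \<bar>(mv n H ^^ (k + 2)) e i / \<mu> ^ (k + 2)\<bar>)"
    unfolding R_def by (rule sum_abs)
  also have "\<dots> \<le> (\<Sum>k<m. a * (T / \<mu>)\<^sup>2 * (1 / 2) ^ k)"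
  proof (intro sum_mono)
    fix k assume "k \<in> {..<m}"
    then have "\<bar>(mv n H ^^ (k + 2)) e i\<bar> / \<mu> ^ (k + 2) \<le> a * T ^ (k + 2) / \<mu> ^ (k + 2)"
      using pos m by (intro divide_right_mono entries) auto
    also have "\<dots> = a * (T / \<mu>)\<^sup>2 * (T / \<mu>) ^ k"
      by (simp only: power_add power_divide times_divide_eq_right times_divide_eq_left mult_ac divide_divide_eq_left)
    also have "\<dots> \<le> a * (T / \<mu>)\<^sup>2 * (1 / 2) ^ k"
      using a T0 T\<mu> hl by (intro mult_left_mono power_mono) auto
    finally show "\<bar>(mv n H ^^ (k + 2)) e i / \<mu> ^ (k + 2)\<bar> \<le> a * (T / \<mu>)\<^sup>2 * (1 / 2) ^ k"
      using pos by (simp add: abs_mult)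
  qed
  also have "\<dots> = a * (T / \<mu>)\<^sup>2 * (\<Sum>k<m. (1 / 2) ^ k)" by (simp add: sum_distrib_left)
  also have "\<dots> \<le> a * (T / \<mu>)\<^sup>2 * 2"
    using a by (intro mult_left_mono) (simp_all add: geometric_sum)
  also have "\<dots> \<le> a * (8 / 7 * (h / lam))\<^sup>2 * 2"
    using a T0 T\<mu> by (intro mult_right_mono mult_left_mono power_mono) auto
  also have "\<dots> = a * (h / lam)\<^sup>2 * (128 / 49)" unfolding power_mult_distrib by (simp add: power2_eq_square)
  finally have R: "\<bar>R\<bar> \<le> a * (h / lam)\<^sup>2 * (128 / 49)" .
  have "\<bar>\<alpha> * R\<bar> \<le> 2 * (a * (h / lam)\<^sup>2 * (128 / 49))"
    unfolding abs_mult using alpha_le R by (intro mult_mono) auto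
  also have "\<dots> \<le> a * (6 * (h / lam)\<^sup>2)" using a by simp
  finally have 1: "\<bar>\<alpha> * R\<bar> \<le> a * (6 * (h / lam)\<^sup>2)" .
  have "\<bar>(\<alpha> - 1) * e i\<bar> \<le> (8 * (h / lam)\<^sup>2 + 2 * (g / lam)) * a"
    unfolding abs_mult using alpha_bound entries[of 0] K by (intro mult_mono) auto
  then have 2: "\<bar>(\<alpha> - 1) * e i\<bar> \<le> a * (8 * (h / lam)\<^sup>2 + 2 * (g / lam))" by (simp add: mult.commute)
  have "\<bar>(\<alpha> / \<mu> - 1 / lam) * mv n H e i\<bar> \<le> (16 * (h / lam)\<^sup>2 + 4 * (g / lam)) / lam * (a * h)"
    unfolding abs_mult
  proof (intro mult_mono alpha_bound')
    show "\<bar>mv n H e i\<bar> \<le> a * h" using entries[of 1] K mult_left_mono[OF T(2) a] by simp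
  qed (use g pos in auto)
  also have "\<dots> = a * ((16 * (h / lam)\<^sup>2 + 4 * (g / lam)) * (h / lam))" by (simp add: mult_ac)
  also have "\<dots> \<le> a * ((16 * (h / lam)\<^sup>2 + 4 * (g / lam)) * (1 / 8))"
    using a hl g pos by (intro mult_left_mono) auto
  finally have 3: "\<bar>(\<alpha> / \<mu> - 1 / lam) * mv n H e i\<bar> \<le> a * (2 * (h / lam)\<^sup>2 + g / lam / 2)"
    by (simp add: algebra_simps)
  have "\<bar>(mv n H ^^ K) v i\<bar> \<le> sqrt ((h ^ K)\<^sup>2 * ip n v v)"
    by (rule order_trans[OF coord_le_sqrt_ip[OF i]]) (intro real_sqrt_le_mono ip_mv_pow_le h)
  also have "\<dots> = h ^ K" using h by (simp add: unit_v)
  finally have "\<bar>(mv n H ^^ K) v i / \<mu> ^ K\<bar> \<le> (h / \<mu>) ^ K"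
    using pos by (simp add: abs_mult power_divide divide_right_mono)
  also have "\<dots> \<le> (2 * h / lam) ^ K"
  proof (intro power_mono)
    have "lam * h \<le> (2 * \<mu>) * h" using eigenvalue_ge pos h by (intro mult_right_mono) auto
    then show "h / \<mu> \<le> 2 * h / lam" using pos by (simp add: field_simps)
  qed (use h pos in auto)
  finally have 4: "\<bar>(mv n H ^^ K) v i / \<mu> ^ K\<bar> \<le> (2 * h / lam) ^ K" .
  have eq: "v i - e i - mv n H e i / lam =
      (\<alpha> - 1) * e i + (\<alpha> / \<mu> - 1 / lam) * mv n H e i + \<alpha> * R + (mv n H ^^ K) v i / \<mu> ^ K"
    using eigenvector_expansion[OF i, of K] unfolding sum_eq by (simp add: algebra_simps)
  \<comment> \<open>The series, the coefficient of \<open>e\<close> and the coefficient of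
    \<open>H e\<close> contribute in this order; the constants 20 and 4 are rounded up.\<close>
  have "6 * x + (8 * x + 2 * y) + (2 * x + y / 2) \<le> 20 * x + 4 * y" if "x \<ge> 0" "y \<ge> 0" for x y :: real
    using that by linarith
  from this[of "(h / lam)\<^sup>2" "g / lam"]
  have "a * (6 * (h / lam)\<^sup>2) + a * (8 * (h / lam)\<^sup>2 + 2 * (g / lam)) + a * (2 * (h / lam)\<^sup>2 + g / lam / 2)
      \<le> a * (20 * (h / lam)\<^sup>2 + 4 * (g / lam))"
    unfolding distrib_left[symmetric] using a g pos by (intro mult_left_mono) auto
  moreover have "\<bar>b + c + d + f\<bar> \<le> b' + c' + d' + f'"
    if "\<bar>b\<bar> \<le> b'" "\<bar>c\<bar> \<le> c'" "\<bar>d\<bar> \<le> d'" "\<bar>f\<bar> \<le> f'" for b c d f b' c' d' f' :: real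
    using that by linarith
  from this[OF 2 3 1 4] have "\<bar>v i - e i - mv n H e i / lam\<bar> \<le>
      a * (8 * (h / lam)\<^sup>2 + 2 * (g / lam)) + a * (2 * (h / lam)\<^sup>2 + g / lam / 2) + a * (6 * (h / lam)\<^sup>2) + (2 * h / lam) ^ K"
    unfolding eq .
  ultimately show ?thesis by linarith
qed

end

section \<open>Moments of powers of a random symmetric matrix\<close>

definition words :: "nat \<Rightarrow> nat \<Rightarrow> nat list set" where
  "words n k = {w. set w \<subseteq> {..<n} \<and> length w = k}"

lemma finite_words [simp]: "finite (words n k)"
  using finite_lists_length_eq[of "{..<n}" k] by (simp add: words_def conj_commute)

lemma words_0 [simp]: "words n 0 = {[]}"
  by (auto simp: words_def)

lemma sum_words_Suc: "(\<Sum>w\<in>words n (Suc k). f w) = (\<Sum>j<n. \<Sum>w\<in>words n k. f (j # w))"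
proof -
  have eq: "words n (Suc k) = (\<lambda>(j, w). j # w) ` ({..<n} \<times> words n k)"
    by (auto simp: words_def image_def length_Suc_conv)
  have "inj_on (\<lambda>(j, w). j # w) ({..<n} \<times> words n k)" by (auto simp: inj_on_def)
  then show ?thesis
    unfolding eq by (subst sum.reindex) (simp_all add: sum.cartesian_product case_prod_unfold)
qed

text \<open>The start \<open>i\<close> is not part of the list, so a walk has as many edges as
  listed vertices, and lengths add when walks from the same start are concatenated.\<close>

fun walk_edges :: "nat \<Rightarrow> nat list \<Rightarrow> nat set list" where
  "walk_edges i [] = []"
| "walk_edges i (j # w) = {i, j} # walk_edges j w"

lemma length_walk_edges [simp]: "length (walk_edges i w) = length w"
  by (induction w arbitrary: i) auto

lemma walk_edges_subset:
  "i < n \<Longrightarrow> set w \<subseteq> {..<n} \<Longrightarrow> set (walk_edges i w) \<subseteq> vertex_pairs n"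
  by (induction w arbitrary: i) (auto simp: vertex_pairs_def)

lemma mv_pow_walks:
  "(mv n (\<lambda>i j. X {i, j}) ^^ k) x i =
     (\<Sum>w\<in>words n k. prod_list (map X (walk_edges i w)) * x (last (i # w)))"
proof (induction k arbitrary: i)
  case (Suc k)
  show ?case
    unfolding funpow.simps(2) o_apply mv_def[of n _ "(mv n _ ^^ k) x"] Suc sum_words_Suc sum_distrib_left
    by (intro sum.cong refl) (auto simp: mult_ac)
qed simp

lemma sum_power_lists:
  fixes f :: "'b \<Rightarrow> 'c :: comm_semiring_1"
  assumes "finite W"
  shows "(\<Sum>w\<in>W. f w) ^ p = (\<Sum>ws\<in>{ws. set ws \<subseteq> W \<and> length ws = p}. prod_list (map f ws))"
proof (induction p)
  case 0
  have "{ws. set ws \<subseteq> W \<and> ws = []} = {[]}" by auto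
  then show ?case by simp
next
  case (Suc p)
  let ?L = "\<lambda>p. {ws. set ws \<subseteq> W \<and> length ws = p}"
  have eq: "?L (Suc p) = (\<lambda>(j, w). j # w) ` (W \<times> ?L p)"
    by (auto simp: image_def length_Suc_conv)
  have "inj_on (\<lambda>(j, w). j # w) (W \<times> ?L p)" by (auto simp: inj_on_def)
  then have "(\<Sum>ws\<in>?L (Suc p). prod_list (map f ws)) = (\<Sum>w\<in>W. \<Sum>ws\<in>?L p. f w * prod_list (map f ws))"
    unfolding eq by (subst sum.reindex) (simp_all add: sum.cartesian_product case_prod_unfold)
  also have "\<dots> = (\<Sum>w\<in>W. f w) * (\<Sum>ws\<in>?L p. prod_list (map f ws))"
    by (simp add: sum_distrib_left sum_distrib_right) (rule sum.swap)
  finally show ?case by (simp add: Suc)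
qed

section \<open>Counting edges, vertices and words\<close>

text \<open>Along a walk every new vertex is reached by a new edge.\<close>

lemma card_walk_edges_ge:
  assumes "finite V" "finite F" "\<Union>F \<subseteq> V" "i \<in> V" "card V \<le> Suc (card F)"
  shows "card (V \<union> set w) \<le> Suc (card (F \<union> set (walk_edges i w)))"
  using assms
proof (induction w arbitrary: i V F)
  case (Cons j w)
  have "card (insert j V) \<le> Suc (card (insert {i, j} F))"
  proof (cases "j \<in> V")
    case True
    then show ?thesis using Cons.prems card_insert_le[of F "{i, j}"] by (simp add: insert_absorb)
  next
    case False
    \<comment> \<open>An old edge has both endpoints in \<open>V\<close>, so an edge to a new vertex
      is itself new.\<close>
    then have "{i, j} \<notin> F" using Cons.prems by auto
    then show ?thesis using Cons.prems False by simp
  qed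
  then have "card (insert j V \<union> set w) \<le> Suc (card (insert {i, j} F \<union> set (walk_edges j w)))"
    using Cons.prems by (intro Cons.IH) auto
  then show ?case by simp
qed simp

text \<open>Every walk restarts at \<open>i\<close>, which is already visited. The union of the
  walks therefore stays connected, and a connected graph has at least as many edges as vertices
  other than the root.\<close>

lemma card_concat_walk_edges_ge:
  assumes "finite V" "finite F" "\<Union>F \<subseteq> V" "i \<in> V" "card V \<le> Suc (card F)"
  shows "card (V \<union> set (concat ws)) \<le> Suc (card (F \<union> set (concat (map (walk_edges i) ws))))"
  using assms
proof (induction ws arbitrary: V F)
  case (Cons w ws)
  have sub: "\<Union>(set (walk_edges k w)) \<subseteq> insert k (set w)" for k
    by (induction w arbitrary: k) auto
  have "card ((V \<union> set w) \<union> set (concat ws)) \<le>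
      Suc (card ((F \<union> set (walk_edges i w)) \<union> set (concat (map (walk_edges i) ws))))"
    using Cons.prems sub[of i] by (intro Cons.IH card_walk_edges_ge) auto
  then show ?case by (simp add: Un_assoc)
qed simp

lemma card_vertices_le_card_edges:
  "card (set (concat ws) - {i}) \<le> card (set (concat (map (walk_edges i) ws)))"
proof -
  have "{i} \<union> set (concat ws) = insert i (set (concat ws) - {i})" by auto
  then have "card ({i} \<union> set (concat ws)) = Suc (card (set (concat ws) - {i}))"
    by (metis Diff_iff List.finite_set card_insert_disjoint finite_Diff singletonI)
  then show ?thesis using card_concat_walk_edges_ge[of "{i}" "{}" i ws] by simp
qed

text \<open>Choose the set of letters other than \<open>i\<close>, then each letter from that set
  and \<open>i\<close>. No finer combinatorial structure of the walks is used, at the price of the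
  factor \<open>Suc h ^ r\<close>, whose root becomes the logarithmic loss per power of
  \<open>H\<close>.\<close>

lemma card_words_support:
  assumes "s \<le> h"
  shows "card {w \<in> words n r. card (set w - {i}) = s} \<le> n ^ s * Suc h ^ r"
proof -
  let ?\<S> = "{S. S \<subseteq> {..<n} \<and> card S = s}"
  let ?L = "\<lambda>S. {w. set w \<subseteq> insert i S \<and> length w = r}"
  have fin: "finite S" if "S \<in> ?\<S>" for S using that finite_subset[of S "{..<n}"] by simp
  have "{w \<in> words n r. card (set w - {i}) = s} \<subseteq> (\<Union>S\<in>?\<S>. ?L S)"
  proof
    fix w assume "w \<in> {w \<in> words n r. card (set w - {i}) = s}"
    then have "set w - {i} \<in> ?\<S>" "w \<in> ?L (set w - {i})" by (auto simp: words_def)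
    then show "w \<in> (\<Union>S\<in>?\<S>. ?L S)" by (rule UN_I)
  qed
  moreover have "finite (\<Union>S\<in>?\<S>. ?L S)"
  proof (rule finite_UN_I)
    show "finite ?\<S>" by (rule finite_subset[of _ "Pow {..<n}"]) auto
    show "finite (?L S)" if "S \<in> ?\<S>" for S
      by (intro finite_lists_length_eq finite.insertI fin that)
  qed
  ultimately have "card {w \<in> words n r. card (set w - {i}) = s} \<le> card (\<Union>S\<in>?\<S>. ?L S)"
    by (intro card_mono)
  also have "\<dots> \<le> (\<Sum>S\<in>?\<S>. card (?L S))"
    by (intro card_UN_le finite_subset[of ?\<S> "Pow {..<n}"]) auto
  also have "\<dots> \<le> (\<Sum>S\<in>?\<S>. Suc h ^ r)"
  proof (intro sum_mono)
    fix S assume S: "S \<in> ?\<S>"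
    have "card (?L S) = card (insert i S) ^ r"
      using fin[OF S] by (intro card_lists_length_eq) simp
    also have "\<dots> \<le> Suc h ^ r"
      using S fin[OF S] assms by (intro power_mono) (auto simp: card_insert_if)
    finally show "card (?L S) \<le> Suc h ^ r" .
  qed
  also have "\<dots> = (n choose s) * Suc h ^ r" by (simp add: n_subsets)
  also have "\<dots> \<le> n ^ s * Suc h ^ r"
  proof (cases "s \<le> n")
    case True
    then show ?thesis by (intro mult_right_mono binomial_le_pow) auto
  qed (simp add: binomial_eq_0)
  finally show ?thesis .
qed

text \<open>Words are sorted by their number \<open>s\<close> of letters other than
  \<open>i\<close>. As n q \<ge> 1, the case s = h dominates, and the \<open>h + 1\<close> values of
  \<open>s\<close> produce the extra factor \<open>Suc h\<close>.\<close>

lemma sum_words_support_le: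
  fixes q :: real
  assumes q: "q \<ge> 0" "real n * q \<ge> 1"
  shows "(\<Sum>w\<in>words n (2 * h). if card (set w - {i}) \<le> h then q ^ card (set w - {i}) else 0)
           \<le> real (Suc h) ^ (2 * h + 1) * (real n * q) ^ h"
proof -
  let ?c = "\<lambda>w. card (set w - {i})"
  have "(\<Sum>w\<in>words n (2 * h). if ?c w \<le> h then q ^ ?c w else 0) =
      (\<Sum>w\<in>words n (2 * h). \<Sum>s\<le>h. if ?c w = s then q ^ s else 0)"
    by (intro sum.cong refl) simp
  also have "\<dots> = (\<Sum>s\<le>h. \<Sum>w\<in>words n (2 * h). if ?c w = s then q ^ s else 0)"
    by (rule sum.swap)
  also have "\<dots> = (\<Sum>s\<le>h. real (card {w \<in> words n (2 * h). ?c w = s}) * q ^ s)"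
    by (intro sum.cong refl) (simp add: sum.inter_filter[symmetric])
  also have "\<dots> \<le> (\<Sum>s\<le>h. real (Suc h) ^ (2 * h) * (real n * q) ^ h)"
  proof (intro sum_mono)
    fix s assume "s \<in> {..h}"
    then have s: "s \<le> h" by simp
    have "real (card {w \<in> words n (2 * h). ?c w = s}) * q ^ s \<le> real (n ^ s * Suc h ^ (2 * h)) * q ^ s"
      using q by (intro mult_right_mono of_nat_mono card_words_support[OF s]) auto
    also have "\<dots> = real (Suc h) ^ (2 * h) * (real n * q) ^ s"
      by (simp add: power_mult_distrib mult_ac)
    also have "\<dots> \<le> real (Suc h) ^ (2 * h) * (real n * q) ^ h"
      using q s by (intro mult_left_mono power_increasing) auto
    finally show "real (card {w \<in> words n (2 * h). ?c w = s}) * q ^ s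
        \<le> real (Suc h) ^ (2 * h) * (real n * q) ^ h" .
  qed
  also have "\<dots> = real (Suc h) ^ (2 * h + 1) * (real n * q) ^ h" by simp
  finally show ?thesis .
qed

section \<open>Moments of products of independent centered variables\<close>

lemma prod_list_map_eq_prod_count:
  fixes f :: "'b \<Rightarrow> 'c :: comm_monoid_mult"
  shows "prod_list (map f xs) = (\<Prod>x\<in>set xs. f x ^ count_list xs x)"
proof (induction xs)
  case (Cons x xs)
  have "(\<Prod>y\<in>set (x # xs). f y ^ count_list (x # xs) y) =
      f x ^ count_list (x # xs) x * (\<Prod>y\<in>set xs - {x}. f y ^ count_list (x # xs) y)"
    by (simp add: prod.insert_remove del: count_list.simps)
  also have "(\<Prod>y\<in>set xs - {x}. f y ^ count_list (x # xs) y) = (\<Prod>y\<in>set xs - {x}. f y ^ count_list xs y)"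
    by (intro prod.cong) auto
  also have "f x ^ count_list (x # xs) x * \<dots> = f x * (f x ^ count_list xs x * (\<Prod>y\<in>set xs - {x}. f y ^ count_list xs y))"
    by (simp add: mult_ac)
  also have "f x ^ count_list xs x * (\<Prod>y\<in>set xs - {x}. f y ^ count_list xs y) = (\<Prod>y\<in>set xs. f y ^ count_list xs y)"
    by (cases "x \<in> set xs") (simp_all add: prod.remove)
  finally show ?case using Cons by simp
qed simp

context prob_space
begin

lemma bounded_integrable:
  fixes f :: "'a \<Rightarrow> real"
  assumes "random_variable borel f" "\<And>\<omega>. \<omega> \<in> space M \<Longrightarrow> \<bar>f \<omega>\<bar> \<le> B"
  shows "integrable M f"
  using assms by (intro integrable_const_bound[of _ B]) auto

text \<open>A preimage under an indicator is the empty set, the event, its complement or the whole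
  space, hence already in the sigma algebra that the event generates.\<close>

lemma indep_vars_indicator:
  assumes "indep_events A I"
  shows "indep_vars (\<lambda>_. borel) (\<lambda>i. indicator (A i) :: 'a \<Rightarrow> real) I"
proof -
  have meas: "A i \<in> sets M" if "i \<in> I" for i using assms that by (auto simp: indep_events_def)
  have "indep_sets (\<lambda>i. sigma_sets (space M) {A i}) I"
    using assms by (intro indep_sets_sigma) (auto simp: indep_events_def_alt Int_stable_def)
  then have "indep_sets (\<lambda>i. {(indicator (A i) :: 'a \<Rightarrow> real) -` B \<inter> space M |B. B \<in> sets borel}) I"
  proof (rule indep_sets_mono_sets)
    fix i assume i: "i \<in> I"
    show "{(indicator (A i) :: 'a \<Rightarrow> real) -` B \<inter> space M |B. B \<in> sets borel} \<subseteq> sigma_sets (space M) {A i}"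
    proof safe
      fix B :: "real set"
      have sub: "A i \<subseteq> space M" using sets.sets_into_space[OF meas[OF i]] .
      have A: "A i \<in> sigma_sets (space M) {A i}" by auto
      have "(indicator (A i) :: 'a \<Rightarrow> real) -` B \<inter> space M =
          (if 1 \<in> B then A i else {}) \<union> (if 0 \<in> B then space M - A i else {})"
        using sub by (auto simp: indicator_def of_bool_def split: if_splits)
      moreover have "A i \<union> (space M - A i) = space M" using sub by auto
      ultimately show "(indicator (A i) :: 'a \<Rightarrow> real) -` B \<inter> space M \<in> sigma_sets (space M) {A i}"
        using A sigma_sets_top sigma_sets.Empty sigma_sets.Compl[OF A] by auto
    qed
  qed
  then show ?thesis using meas by (auto simp: indep_vars_def2)
qed

text \<open>Repeated edges are collected into powers, so that the expectation factorizes over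
  distinct edges. An edge used exactly once contributes its mean 0; otherwise every edge occurs at
  least twice, and the bound by 1 reduces each power to the second moment.\<close>

lemma expectation_prod_list_centered:
  fixes X :: "'b \<Rightarrow> 'a \<Rightarrow> real"
  assumes indep: "indep_vars (\<lambda>_. borel) X P" and es: "set es \<subseteq> P"
    and bound: "\<And>e \<omega>. e \<in> P \<Longrightarrow> \<omega> \<in> space M \<Longrightarrow> \<bar>X e \<omega>\<bar> \<le> 1"
    and mean: "\<And>e. e \<in> P \<Longrightarrow> expectation (X e) = 0"
    and var: "\<And>e. e \<in> P \<Longrightarrow> expectation (\<lambda>\<omega>. (X e \<omega>)\<^sup>2) \<le> q" and q: "q \<ge> 0"
  shows "\<bar>expectation (\<lambda>\<omega>. prod_list (map (\<lambda>e. X e \<omega>) es))\<bar> \<le>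
           (if 2 * card (set es) \<le> length es then q ^ card (set es) else 0)"
    and "integrable M (\<lambda>\<omega>. prod_list (map (\<lambda>e. X e \<omega>) es))"
proof -
  let ?c = "count_list es"
  have meas: "X e \<in> borel_measurable M" if "e \<in> P" for e
    using indep that by (auto simp: indep_vars_def2)
  have le1: "\<bar>X e \<omega> ^ m\<bar> \<le> 1" if "e \<in> P" "\<omega> \<in> space M" for e \<omega> m
    using bound[OF that] by (simp add: power_abs power_le_one)
  have int: "integrable M (\<lambda>\<omega>. X e \<omega> ^ m)" if "e \<in> P" for e m
    using meas[OF that] le1[OF that] by (intro bounded_integrable[of _ 1]) auto
  have "indep_vars (\<lambda>_. borel) (\<lambda>e \<omega>. X e \<omega> ^ ?c e) (set es)"
    by (rule indep_vars_compose2[OF indep_vars_subset[OF indep es], where Y = "\<lambda>e x. x ^ ?c e"]) auto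
  then have eq: "expectation (\<lambda>\<omega>. \<Prod>e\<in>set es. X e \<omega> ^ ?c e) = (\<Prod>e\<in>set es. expectation (\<lambda>\<omega>. X e \<omega> ^ ?c e))"
    and integr: "integrable M (\<lambda>\<omega>. \<Prod>e\<in>set es. X e \<omega> ^ ?c e)"
    using es int by (auto intro!: indep_vars_lebesgue_integral indep_vars_integrable)
  show "integrable M (\<lambda>\<omega>. prod_list (map (\<lambda>e. X e \<omega>) es))"
    unfolding prod_list_map_eq_prod_count by (rule integr)
  have count_pos: "?c e > 0" if "e \<in> set es" for e
    using that count_list_0_iff[of es e] by auto
  show "\<bar>expectation (\<lambda>\<omega>. prod_list (map (\<lambda>e. X e \<omega>) es))\<bar> \<le>
           (if 2 * card (set es) \<le> length es then q ^ card (set es) else 0)"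
  proof (cases "\<exists>e\<in>set es. ?c e = 1")
    case True
    then have zero: "(\<Prod>e\<in>set es. expectation (\<lambda>\<omega>. X e \<omega> ^ ?c e)) = 0"
      using mean es by (intro prod_zero) force+
    show ?thesis unfolding prod_list_map_eq_prod_count eq zero using q by simp
  next
    case False
    then have ge2: "?c e \<ge> 2" if "e \<in> set es" for e
      using count_pos[OF that] that by (metis One_nat_def Suc_1 Suc_leI le_neq_implies_less)
    have "card (set es) * 2 \<le> (\<Sum>e\<in>set es. ?c e)"
      using sum_mono[of "set es" "\<lambda>_. 2" ?c] ge2 by simp
    also have "\<dots> = length es" by (rule sum_count_set) auto
    finally have len: "2 * card (set es) \<le> length es" by simp
    have "\<bar>\<Prod>e\<in>set es. expectation (\<lambda>\<omega>. X e \<omega> ^ ?c e)\<bar> \<le> (\<Prod>e\<in>set es. q)"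
      unfolding abs_prod
    proof (intro prod_mono conjI)
      fix e assume e: "e \<in> set es"
      then have eP: "e \<in> P" using es by auto
      have "\<bar>expectation (\<lambda>\<omega>. X e \<omega> ^ ?c e)\<bar> \<le> expectation (\<lambda>\<omega>. \<bar>X e \<omega> ^ ?c e\<bar>)"
        by (rule integral_abs_bound)
      also have "\<dots> \<le> expectation (\<lambda>\<omega>. (X e \<omega>)\<^sup>2)"
      proof (intro integral_mono integrable_abs int eP)
        fix \<omega> assume "\<omega> \<in> space M"
        then have "\<bar>X e \<omega>\<bar> ^ ?c e \<le> \<bar>X e \<omega>\<bar>\<^sup>2"
          using bound[OF eP] ge2[OF e] by (intro power_decreasing) auto
        then show "\<bar>X e \<omega> ^ ?c e\<bar> \<le> (X e \<omega>)\<^sup>2" by (simp add: power_abs)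
      qed
      also have "\<dots> \<le> q" by (rule var[OF eP])
      finally show "\<bar>expectation (\<lambda>\<omega>. X e \<omega> ^ ?c e)\<bar> \<le> q" .
    qed auto
    with len show ?thesis unfolding prod_list_map_eq_prod_count eq by simp
  qed
qed

text \<open>The p-th power is a sum over p walks from \<open>i\<close>, read as one word of length k
  p = 2 h. A nonzero expectation has every edge at least doubled, hence at most h distinct edges and
  at most h letters other than \<open>i\<close>; this leaves the sum bounded in
  \<open>sum_words_support_le\<close>.\<close>

lemma moment_mv_pow:
  fixes X :: "nat set \<Rightarrow> 'a \<Rightarrow> real"
  assumes indep: "indep_vars (\<lambda>_. borel) X (vertex_pairs n)"
    and bound: "\<And>e \<omega>. e \<in> vertex_pairs n \<Longrightarrow> \<omega> \<in> space M \<Longrightarrow> \<bar>X e \<omega>\<bar> \<le> 1"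
    and mean: "\<And>e. e \<in> vertex_pairs n \<Longrightarrow> expectation (X e) = 0"
    and var: "\<And>e. e \<in> vertex_pairs n \<Longrightarrow> expectation (\<lambda>\<omega>. (X e \<omega>)\<^sup>2) \<le> q"
    and q: "q \<ge> 0" "q \<le> 1" "real n * q \<ge> 1"
    and x: "\<And>j. j < n \<Longrightarrow> \<bar>x j\<bar> \<le> 1" and i: "i < n" and kp: "k * p = 2 * h"
  shows "expectation (\<lambda>\<omega>. ((mv n (\<lambda>i j. X {i, j} \<omega>) ^^ k) x i) ^ p)
           \<le> real (Suc h) ^ (2 * h + 1) * (real n * q) ^ h" (is "expectation ?f \<le> _")
    and "integrable M (\<lambda>\<omega>. ((mv n (\<lambda>i j. X {i, j} \<omega>) ^^ k) x i) ^ p)"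
proof -
  let ?L = "{ws. set ws \<subseteq> words n k \<and> length ws = p}"
  let ?es = "\<lambda>ws. concat (map (walk_edges i) ws)"
  let ?x = "\<lambda>ws. prod_list (map (\<lambda>w. x (last (i # w))) ws)"
  let ?c = "\<lambda>w. card (set w - {i})"
  let ?g = "\<lambda>w. if ?c w \<le> h then q ^ ?c w else 0"
  have finL: "finite ?L" by (rule finite_lists_length_eq) simp
  have f: "?f \<omega> = (\<Sum>ws\<in>?L. ?x ws * prod_list (map (\<lambda>e. X e \<omega>) (?es ws)))" for \<omega>
    unfolding mv_pow_walks[where X = "\<lambda>e. X e \<omega>"] sum_power_lists[OF finite_words]
  proof (intro sum.cong refl)
    fix ws :: "nat list list"
    show "(\<Prod>w\<leftarrow>ws. prod_list (map (\<lambda>e. X e \<omega>) (walk_edges i w)) * x (last (i # w))) =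
      ?x ws * prod_list (map (\<lambda>e. X e \<omega>) (?es ws))"
      by (induction ws) (simp_all add: mult_ac)
  qed
  have es: "set (?es ws) \<subseteq> vertex_pairs n" if "ws \<in> ?L" for ws
  proof
    fix e assume "e \<in> set (?es ws)"
    then obtain w where w: "w \<in> set ws" "e \<in> set (walk_edges i w)" by auto
    then have "set w \<subseteq> {..<n}" using that by (auto simp: words_def)
    then show "e \<in> vertex_pairs n" using w(2) walk_edges_subset[OF i] by blast
  qed
  have x_le: "\<bar>?x ws\<bar> \<le> 1" if "ws \<in> ?L" for ws
  proof -
    have "\<bar>?x ws\<bar> \<le> 1" if "set ws \<subseteq> words n k" for ws
      using that
    proof (induction ws)
      case (Cons w ws)
      have "set (i # w) \<subseteq> {..<n}" using Cons.prems i by (auto simp: words_def)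
      then have "last (i # w) < n" using last_in_set[of "i # w"] by blast
      then have "\<bar>x (last (i # w)) * prod_list (map (\<lambda>w. x (last (i # w))) ws)\<bar> \<le> 1"
        unfolding abs_mult using Cons x by (intro mult_le_one) auto
      then show ?case by simp
    qed simp
    then show ?thesis using that by blast
  qed
  have E1: "\<bar>expectation (\<lambda>\<omega>. prod_list (map (\<lambda>e. X e \<omega>) (?es ws)))\<bar> \<le>
      (if 2 * card (set (?es ws)) \<le> length (?es ws) then q ^ card (set (?es ws)) else 0)"
    and E2: "integrable M (\<lambda>\<omega>. prod_list (map (\<lambda>e. X e \<omega>) (?es ws)))" if "ws \<in> ?L" for ws
    using expectation_prod_list_centered[OF indep es[OF that], of q] bound mean var q(1) by blast+
  show "integrable M ?f"
    unfolding f by (intro Bochner_Integration.integrable_sum integrable_mult_right E2)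
  have len: "length (concat ws) = k * p" if "ws \<in> ?L" for ws
  proof -
    have "sum_list (map length ws) = k * length ws" if "set ws \<subseteq> words n k" for ws
      using that by (induction ws) (auto simp: words_def)
    then show ?thesis using that by (auto simp: length_concat)
  qed
  have len_es: "length (?es ws) = length (concat ws)" for ws
    by (induction ws) auto
  have "expectation ?f = (\<Sum>ws\<in>?L. ?x ws * expectation (\<lambda>\<omega>. prod_list (map (\<lambda>e. X e \<omega>) (?es ws))))"
    unfolding f
    by (subst Bochner_Integration.integral_sum) (simp_all only: integrable_mult_right E2 integral_mult_right_zero)
  also have "\<dots> \<le> (\<Sum>ws\<in>?L. ?g (concat ws))"
  proof (intro sum_mono)
    fix ws assume ws: "ws \<in> ?L"
    let ?e = "expectation (\<lambda>\<omega>. prod_list (map (\<lambda>e. X e \<omega>) (?es ws)))"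
    have "?x ws * ?e \<le> \<bar>?x ws\<bar> * \<bar>?e\<bar>" by (metis abs_ge_self abs_mult)
    also have "\<dots> \<le> 1 * \<bar>?e\<bar>" using x_le[OF ws] by (intro mult_right_mono) auto
    also have "1 * \<bar>?e\<bar> \<le> (if card (set (?es ws)) \<le> h then q ^ card (set (?es ws)) else 0)"
      using E1[OF ws] unfolding len_es len[OF ws] kp by simp
    \<comment> \<open>There are at most as many new vertices as edges, and q \<le> 1, so counting
      vertices instead of edges only increases the power of q.\<close>
    also have "\<dots> \<le> ?g (concat ws)"
      using card_vertices_le_card_edges[of ws i] q by (auto intro!: power_decreasing)
    finally show "?x ws * ?e \<le> ?g (concat ws)" .
  qed
  also have "\<dots> = (\<Sum>w\<in>concat ` ?L. ?g w)"
  proof (subst sum.reindex)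
    \<comment> \<open>The blocks all have length k, so the word determines its division into
      walks.\<close>
    show "inj_on concat ?L"
    proof (rule inj_onI)
      fix us vs assume us: "us \<in> ?L" and vs: "vs \<in> ?L" and eq: "concat us = concat vs"
      have inj: "us = vs" if "set us \<subseteq> words n k" "set vs \<subseteq> words n k" "length us = length vs" "concat us = concat vs"
        for us vs using that(3,1,2,4)
      proof (induction us vs rule: list_induct2)
        case (Cons u us v vs)
        then have "length u = length v" by (simp add: words_def)
        with Cons show ?case by simp
      qed simp
      show "us = vs" by (rule inj) (use us vs eq in simp_all)
    qed
  qed simp
  also have "\<dots> \<le> (\<Sum>w\<in>words n (2 * h). ?g w)"
  proof (intro sum_mono2)
    show "concat ` ?L \<subseteq> words n (2 * h)"
    proof (intro subsetI, elim imageE)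
      fix w ws assume w: "w = concat ws" "ws \<in> ?L"
      then show "w \<in> words n (2 * h)"
        using len[OF w(2)] kp by (auto simp: words_def)
    qed
  qed (use q in auto)
  also have "\<dots> \<le> real (Suc h) ^ (2 * h + 1) * (real n * q) ^ h"
    by (rule sum_words_support_le) (use q in auto)
  finally show "expectation ?f \<le> real (Suc h) ^ (2 * h + 1) * (real n * q) ^ h" .
qed

end

section \<open>Concentration and normal approximation\<close>

context prob_space
begin

section \<open>Tail bounds for powers and for a quadratic form\<close>

lemma prob_UN_le:
  assumes "finite I" "\<And>i. i \<in> I \<Longrightarrow> B i \<in> events" "\<And>i. i \<in> I \<Longrightarrow> prob (B i) \<le> b"
  shows "prob (\<Union>i\<in>I. B i) \<le> real (card I) * b"
proof -
  have "prob (\<Union>i\<in>I. B i) \<le> (\<Sum>i\<in>I. prob (B i))"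
    using assms by (intro finite_measure_subadditive_finite) auto
  also have "\<dots> \<le> real (card I) * b" using assms by (intro sum_bounded_above) auto
  finally show ?thesis .
qed

lemma borel_measurable_mv_pow:
  fixes X :: "nat set \<Rightarrow> 'a \<Rightarrow> real"
  assumes "\<And>e. e \<in> vertex_pairs n \<Longrightarrow> X e \<in> borel_measurable M" "i < n"
  shows "(\<lambda>\<omega>. (mv n (\<lambda>i j. X {i, j} \<omega>) ^^ k) x i) \<in> borel_measurable M"
  using assms(2)
proof (induction k arbitrary: i)
  case (Suc k)
  have X: "(\<lambda>\<omega>. X {i, j} \<omega>) \<in> borel_measurable M" if "j < n" for j
    using that Suc.prems by (intro assms) (auto simp: vertex_pairs_def)
  show ?case
    unfolding funpow.simps(2) o_apply mv_def[of n _ "(mv n _ ^^ k) x"]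
    by (intro borel_measurable_sum borel_measurable_times X Suc.IH) auto
qed simp

text \<open>One threshold \<open>12 * N * sqrt Q\<close> per power of the matrix serves all
  \<open>k\<close> up to \<open>N\<close>, because the order of the moment is adapted to
  \<open>k\<close> so that the total word length stays comparable with \<open>N\<close>.\<close>

lemma prob_mv_pow_gt:
  fixes X :: "nat set \<Rightarrow> 'a \<Rightarrow> real"
  assumes indep: "indep_vars (\<lambda>_. borel) X (vertex_pairs n)"
    and bound: "\<And>e \<omega>. e \<in> vertex_pairs n \<Longrightarrow> \<omega> \<in> space M \<Longrightarrow> \<bar>X e \<omega>\<bar> \<le> 1"
    and mean: "\<And>e. e \<in> vertex_pairs n \<Longrightarrow> expectation (X e) = 0"
    and var: "\<And>e. e \<in> vertex_pairs n \<Longrightarrow> expectation (\<lambda>\<omega>. (X e \<omega>)\<^sup>2) \<le> q"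
    and q: "q \<ge> 0" "q \<le> 1" "real n * q \<ge> 1" "real n * q \<le> Q"
    and x: "\<And>j. j < n \<Longrightarrow> \<bar>x j\<bar> \<le> 1" and i: "i < n"
    and N: "N \<ge> 1" and k: "k > 0" "real k \<le> N"
  shows "prob {\<omega> \<in> space M. \<bar>(mv n (\<lambda>i j. X {i, j} \<omega>) ^^ k) x i\<bar> > (12 * N * sqrt Q) ^ k}
           \<le> 3 * N * exp (- 2 * N)"
proof -
  define Y where "Y \<omega> = (mv n (\<lambda>i j. X {i, j} \<omega>) ^^ k) x i" for \<omega>
  define T where "T = 12 * N * sqrt Q"
  \<comment> \<open>Markov's inequality for the moment of order \<open>2 c\<close>: then \<open>k c\<close> is between \<open>N\<close> and \<open>2 N\<close>\<close>
  define c where "c = nat \<lceil>N / k\<rceil>"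
  define h where "h = k * c"
  have Q: "Q \<ge> 1" using q by linarith
  have T: "T > 0" using N Q by (simp add: T_def)
  have Nk: "N / k \<ge> 0" "real k > 0" using N k by auto
  have c: "N / k \<le> real c" "real c \<le> N / k + 1"
    unfolding c_def using Nk by linarith+
  have hN: "N \<le> real h"
    using c(1) Nk by (simp add: h_def pos_divide_le_eq mult.commute)
  have "real h \<le> real k * (N / k + 1)"
    unfolding h_def of_nat_mult using c(2) Nk by (intro mult_left_mono) auto
  also have "\<dots> = N + k" using Nk by (simp add: field_simps)
  finally have h3: "real (Suc h) \<le> 3 * N" using N k by linarith
  have kp: "k * (2 * c) = 2 * h" by (simp add: h_def)
  note mom = moment_mv_pow[OF indep bound mean var q(1-3) x i kp]
  have int: "integrable M (\<lambda>\<omega>. Y \<omega> ^ (2 * c))"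
    unfolding Y_def by (rule mom(2))
  have meas: "Y \<in> borel_measurable M"
    unfolding Y_def using indep i
    by (intro borel_measurable_mv_pow) (auto simp: indep_vars_def2)
  have "prob {\<omega> \<in> space M. \<bar>Y \<omega>\<bar> > T ^ k} \<le> prob {\<omega> \<in> space M. Y \<omega> ^ (2 * c) \<ge> T ^ (2 * h)}"
  proof (rule finite_measure_mono)
    show "{\<omega> \<in> space M. \<bar>Y \<omega>\<bar> > T ^ k} \<subseteq> {\<omega> \<in> space M. Y \<omega> ^ (2 * c) \<ge> T ^ (2 * h)}"
    proof safe
      fix \<omega> assume "\<bar>Y \<omega>\<bar> > T ^ k"
      then have "(T ^ k) ^ (2 * c) \<le> \<bar>Y \<omega>\<bar> ^ (2 * c)" using T by (intro power_mono) auto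
      then show "T ^ (2 * h) \<le> Y \<omega> ^ (2 * c)" by (simp add: power_mult[symmetric] kp[symmetric] power_even_abs)
    qed
    show "{\<omega> \<in> space M. Y \<omega> ^ (2 * c) \<ge> T ^ (2 * h)} \<in> events" using meas by measurable
  qed
  also have "\<dots> \<le> expectation (\<lambda>\<omega>. Y \<omega> ^ (2 * c)) / T ^ (2 * h)"
  proof -
    have "prob {\<omega> \<in> space M. T ^ (2 * h) \<le> Y \<omega> ^ (2 * c)} \<le> (\<integral>\<omega>. Y \<omega> ^ (2 * c) \<partial>M) / T ^ (2 * h)"
      using int T by (intro integral_Markov_inequality_measure[where A="space M"]) auto
    then show ?thesis .
  qed
  also have "\<dots> \<le> (real (Suc h) ^ (2 * h + 1) * Q ^ h) / T ^ (2 * h)"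
  proof (rule divide_right_mono)
    have "expectation (\<lambda>\<omega>. Y \<omega> ^ (2 * c)) \<le> real (Suc h) ^ (2 * h + 1) * (real n * q) ^ h"
      unfolding Y_def by (rule mom(1))
    also have "\<dots> \<le> real (Suc h) ^ (2 * h + 1) * Q ^ h"
      using q by (intro mult_left_mono power_mono) auto
    finally show "expectation (\<lambda>\<omega>. Y \<omega> ^ (2 * c)) \<le> real (Suc h) ^ (2 * h + 1) * Q ^ h" .
  qed (use T in auto)
  also have "T ^ (2 * h) = (12 * N) ^ (2 * h) * Q ^ h"
    using Q by (simp add: T_def power_mult_distrib power_mult)
  \<comment> \<open>The constant 12 makes the base at most 3 N / (12 N) = 1 / 4; its square 1 / 16
    is below exp (- 2), and h \<ge> N gives the tail.\<close>
  also have "(real (Suc h) ^ (2 * h + 1) * Q ^ h) / ((12 * N) ^ (2 * h) * Q ^ h) =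
      real (Suc h) * (real (Suc h) / (12 * N)) ^ (2 * h)"
    using Q by (simp add: power_divide)
  also have "\<dots> \<le> (3 * N) * (1 / 4) ^ (2 * h)"
    using h3 N by (intro mult_mono power_mono) (auto simp: pos_divide_le_eq)
  also have "(1 / 4 :: real) ^ (2 * h) = (1 / 16) ^ h"
    by (simp add: power_mult power2_eq_square)
  also have "(1 / 16 :: real) ^ h \<le> exp (- 2) ^ h"
  proof (rule power_mono)
    have "exp (2 :: real) = exp 1 * exp 1" by (simp flip: exp_add)
    also have "\<dots> \<le> 3 * 3" by (intro mult_mono exp_le) auto
    finally have "exp (2 :: real) \<le> 16" by simp
    then show "1 / 16 \<le> exp (- 2 :: real)" by (simp add: exp_minus field_simps)
  qed simp
  also have "exp (- 2 :: real) ^ h = exp (- 2 * real h)" by (simp add: exp_of_nat_mult[symmetric])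
  also have "exp (- 2 * real h) \<le> exp (- 2 * N)" using hN by simp
  finally show ?thesis using N unfolding Y_def T_def by simp
qed

text \<open>The form is linear in the independent edge variables. Each coefficient collects at most
  two ordered pairs, hence is at most 2 \<kappa>^2 / n, and there are at most n^2 edges, so
  Hoeffding's variance proxy does not depend on n.\<close>

lemma prob_quadratic_form_ge:
  fixes X :: "nat set \<Rightarrow> 'a \<Rightarrow> real"
  assumes indep: "indep_vars (\<lambda>_. borel) X (vertex_pairs n)"
    and bound: "\<And>e \<omega>. e \<in> vertex_pairs n \<Longrightarrow> \<omega> \<in> space M \<Longrightarrow> \<bar>X e \<omega>\<bar> \<le> 1"
    and mean: "\<And>e. e \<in> vertex_pairs n \<Longrightarrow> expectation (X e) = 0"
    and n: "n > 0" and u: "\<And>i. i < n \<Longrightarrow> \<bar>u i\<bar> \<le> \<kappa> / sqrt n" and \<kappa>: "\<kappa> > 0" and t: "t \<ge> 0"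
  shows "prob {\<omega> \<in> space M. \<bar>ip n u (mv n (\<lambda>i j. X {i, j} \<omega>) u)\<bar> \<ge> t} \<le> 2 * exp (- t\<^sup>2 / (8 * \<kappa> ^ 4))"
proof -
  let ?P = "vertex_pairs n" and ?S = "{..<n} \<times> {..<n}" and ?e = "\<lambda>(i, j). {i, j :: nat}"
  define a where "a f = (\<Sum>p\<in>{p \<in> ?S. ?e p = f}. u (fst p) * u (snd p))" for f
  define B where "B = 2 * \<kappa>\<^sup>2 / n"
  have B: "B > 0" using n \<kappa> by (simp add: B_def)
  have P: "?P = ?e ` ?S" by (auto simp: vertex_pairs_def)
  have finP: "finite ?P" unfolding P by simp
  have cardP: "card ?P \<le> n * n" unfolding P using card_image_le[of ?S ?e] by simp
  have neP: "?P \<noteq> {}" unfolding P using n by auto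
  have aB: "\<bar>a f\<bar> \<le> B" for f
  proof -
    have card2: "card {p \<in> ?S. ?e p = f} \<le> 2"
    proof (cases "{p \<in> ?S. ?e p = f} = {}")
      case False
      then obtain p0 where "p0 \<in> {p \<in> ?S. ?e p = f}" by blast
      then have "f = {fst p0, snd p0}" by (cases p0) auto
      then obtain b c where bc: "f = {b, c}" by blast
      have "{p \<in> ?S. ?e p = f} \<subseteq> {(b, c), (c, b)}"
      proof
        fix p assume "p \<in> {p \<in> ?S. ?e p = f}"
        then show "p \<in> {(b, c), (c, b)}" unfolding bc by (cases p) (simp add: doubleton_eq_iff)
      qed
      then have "card {p \<in> ?S. ?e p = f} \<le> card {(b, c), (c, b)}" by (intro card_mono) auto
      also have "\<dots> \<le> 2" by (cases "b = c") auto
      finally show ?thesis .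
    next
      case True
      show ?thesis unfolding True by simp
    qed
    have "\<bar>a f\<bar> \<le> (\<Sum>p\<in>{p \<in> ?S. ?e p = f}. \<bar>u (fst p) * u (snd p)\<bar>)"
      unfolding a_def by (rule sum_abs)
    also have "\<dots> \<le> (\<Sum>p\<in>{p \<in> ?S. ?e p = f}. \<kappa> / sqrt n * (\<kappa> / sqrt n))"
      unfolding abs_mult using u \<kappa> by (intro sum_mono mult_mono) auto
    also have "\<dots> = real (card {p \<in> ?S. ?e p = f}) * (\<kappa>\<^sup>2 / n)" by (simp add: power2_eq_square)
    also have "\<dots> \<le> 2 * (\<kappa>\<^sup>2 / n)" using card2 \<kappa> by (intro mult_right_mono) auto
    finally show ?thesis by (simp add: B_def)
  qed
  have eq: "ip n u (mv n (\<lambda>i j. X {i, j} \<omega>) u) = (\<Sum>f\<in>?P. a f * X f \<omega>)" for \<omega>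
  proof -
    have "ip n u (mv n (\<lambda>i j. X {i, j} \<omega>) u) = (\<Sum>p\<in>?S. u (fst p) * u (snd p) * X (?e p) \<omega>)"
      by (simp add: ip_def mv_def sum_distrib_left sum.cartesian_product case_prod_unfold mult_ac)
    also have "\<dots> = (\<Sum>f\<in>?P. \<Sum>p\<in>{p \<in> ?S. ?e p = f}. u (fst p) * u (snd p) * X (?e p) \<omega>)"
      unfolding P by (rule sum.image_gen) simp
    also have "\<dots> = (\<Sum>f\<in>?P. a f * X f \<omega>)"
      unfolding a_def sum_distrib_right by (intro sum.cong refl) auto
    finally show ?thesis .
  qed
  have meas: "X f \<in> borel_measurable M" if "f \<in> ?P" for f
    using indep that by (auto simp: indep_vars_def2)
  have abs: "\<bar>a f * X f \<omega>\<bar> \<le> B" if "f \<in> ?P" "\<omega> \<in> space M" for f \<omega>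
    unfolding abs_mult using mult_mono[OF aB bound[OF that], of f] B by simp
  interpret Hoeffding_ineq M ?P "\<lambda>f \<omega>. a f * X f \<omega>" "\<lambda>_. - B" "\<lambda>_. B" "\<Sum>f\<in>?P. expectation (\<lambda>\<omega>. a f * X f \<omega>)"
  proof unfold_locales
    show "finite ?P" by (rule finP)
    show "indep_vars (\<lambda>_. borel) (\<lambda>f \<omega>. a f * X f \<omega>) ?P"
      by (rule indep_vars_compose2[OF indep, where Y = "\<lambda>f x. a f * x"]) auto
    show "AE \<omega> in M. a f * X f \<omega> \<in> {- B..B}" if "f \<in> ?P" for f
    proof (intro AE_I2)
      fix \<omega> assume "\<omega> \<in> space M"
      from abs[OF that this] show "a f * X f \<omega> \<in> {- B..B}" unfolding atLeastAtMost_iff by linarith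
    qed
  qed
  have mean0: "(\<Sum>f\<in>?P. expectation (\<lambda>\<omega>. a f * X f \<omega>)) = 0"
    using mean by (intro sum.neutral) auto
  have width: "(\<Sum>f\<in>?P. (B - - B)\<^sup>2) = real (card ?P) * (4 * B\<^sup>2)" by (simp add: power2_eq_square)
  have pos: "real (card ?P) * (4 * B\<^sup>2) > 0" using finP neP B by (simp add: card_gt_0_iff)
  have "real (card ?P) * (4 * B\<^sup>2) \<le> real (n * n) * (4 * B\<^sup>2)"
    using cardP by (intro mult_right_mono of_nat_mono) auto
  also have "\<dots> = 16 * \<kappa> ^ 4" using n by (simp add: B_def field_simps power2_eq_square power4_eq_xxxx)
  finally have le: "real (card ?P) * (4 * B\<^sup>2) \<le> 16 * \<kappa> ^ 4" .
  have "prob {\<omega> \<in> space M. \<bar>(\<Sum>f\<in>?P. a f * X f \<omega>) - (\<Sum>f\<in>?P. expectation (\<lambda>\<omega>. a f * X f \<omega>))\<bar> \<ge> t}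
      \<le> 2 * exp (- 2 * t\<^sup>2 / (\<Sum>f\<in>?P. (B - - B)\<^sup>2))"
    using t pos by (intro Hoeffding_ineq_abs_ge) (simp_all add: width)
  also have "\<dots> \<le> 2 * exp (- 2 * t\<^sup>2 / (16 * \<kappa> ^ 4))"
    unfolding width using le pos \<kappa> by (simp add: frac_le)
  finally show ?thesis unfolding eq mean0 by simp
qed

section \<open>Characteristic functions close to the normal one\<close>

text \<open>The Gaussian is split into factors with the variances of the summands, and the two
  products are compared factor by factor. Each factor costs at most a multiple of its variance, and
  the variances sum to 1. The explicit bound at fixed n applies to every choice of index
  i_n.\<close>

lemma char_sum_approx_normal:
  fixes Y :: "'b \<Rightarrow> 'a \<Rightarrow> real"
  assumes fin: "finite J" and indep: "indep_vars (\<lambda>_. borel) Y J"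
    and bound: "\<And>j \<omega>. j \<in> J \<Longrightarrow> \<omega> \<in> space M \<Longrightarrow> \<bar>Y j \<omega>\<bar> \<le> \<eta>"
    and mean: "\<And>j. j \<in> J \<Longrightarrow> expectation (Y j) = 0"
    and var: "(\<Sum>j\<in>J. expectation (\<lambda>\<omega>. (Y j \<omega>)\<^sup>2)) = 1" and \<eta>: "\<eta> \<ge> 0"
  shows "cmod (char (distr M borel (\<lambda>\<omega>. \<Sum>j\<in>J. Y j \<omega>)) t - exp (- (t\<^sup>2) / 2)) \<le> \<bar>t\<bar> ^ 3 * \<eta> + t ^ 4 * \<eta>\<^sup>2"
proof -
  define \<sigma> where "\<sigma> j = expectation (\<lambda>\<omega>. (Y j \<omega>)\<^sup>2)" for j
  define \<psi> where "\<psi> j = char (distr M borel (Y j)) t" for j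
  have meas: "Y j \<in> borel_measurable M" if "j \<in> J" for j
    using indep that by (auto simp: indep_vars_def2)
  have sq: "(Y j \<omega>)\<^sup>2 \<le> \<eta>\<^sup>2" if "j \<in> J" "\<omega> \<in> space M" for j \<omega>
    using power_mono[OF bound[OF that], of 2] by simp
  have int1: "integrable M (Y j)" if "j \<in> J" for j
    using bounded_integrable[OF meas[OF that] bound[OF that]] .
  have int2: "integrable M (\<lambda>\<omega>. (Y j \<omega>)\<^sup>2)" if "j \<in> J" for j
    using meas[OF that] sq[OF that] by (intro bounded_integrable[of _ "\<eta>\<^sup>2"]) auto
  have \<sigma>0: "\<sigma> j \<ge> 0" for j by (simp add: \<sigma>_def)
  have \<sigma>_le: "\<sigma> j \<le> \<eta>\<^sup>2" if "j \<in> J" for j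
  proof -
    have "\<sigma> j \<le> expectation (\<lambda>_. \<eta>\<^sup>2)"
      unfolding \<sigma>_def using sq[OF that] by (intro integral_mono int2 that) auto
    then show ?thesis by (simp add: prob_space)
  qed
  have each: "cmod (\<psi> j - exp (- (t\<^sup>2 * \<sigma> j / 2))) \<le> (\<bar>t\<bar> ^ 3 * \<eta> + t ^ 4 * \<eta>\<^sup>2) * \<sigma> j" if j: "j \<in> J" for j
  proof -
    define u where "u = t\<^sup>2 * \<sigma> j / 2"
    have u: "u \<ge> 0" using \<sigma>0 by (simp add: u_def)
    have "cmod (\<psi> j - (1 - t\<^sup>2 * \<sigma> j / 2)) \<le> t\<^sup>2 / 6 * expectation (\<lambda>\<omega>. min (6 * (Y j \<omega>)\<^sup>2) (\<bar>t\<bar> * \<bar>Y j \<omega>\<bar> ^ 3))"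
    proof -
      have v: "variance (Y j) = \<sigma> j" using mean[OF j] by (simp add: \<sigma>_def)
      show ?thesis
        unfolding \<psi>_def by (rule char_approx3'[OF meas[OF j] int1[OF j] int2[OF j] mean[OF j] v refl])
    qed
    also have "\<dots> \<le> t\<^sup>2 / 6 * expectation (\<lambda>\<omega>. \<bar>t\<bar> * \<eta> * (Y j \<omega>)\<^sup>2)"
    proof (intro mult_left_mono integral_mono)
      show "integrable M (\<lambda>\<omega>. min (6 * (Y j \<omega>)\<^sup>2) (\<bar>t\<bar> * \<bar>Y j \<omega>\<bar> ^ 3))"
      proof (rule bounded_integrable[of _ "6 * \<eta>\<^sup>2"])
        show "random_variable borel (\<lambda>\<omega>. min (6 * (Y j \<omega>)\<^sup>2) (\<bar>t\<bar> * \<bar>Y j \<omega>\<bar> ^ 3))"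
          using meas[OF j] by measurable
        fix \<omega> assume \<omega>: "\<omega> \<in> space M"
        have "0 \<le> min (6 * (Y j \<omega>)\<^sup>2) (\<bar>t\<bar> * \<bar>Y j \<omega>\<bar> ^ 3)" by simp
        moreover have "min (6 * (Y j \<omega>)\<^sup>2) (\<bar>t\<bar> * \<bar>Y j \<omega>\<bar> ^ 3) \<le> 6 * (Y j \<omega>)\<^sup>2" by (rule min.cobounded1)
        moreover have "6 * (Y j \<omega>)\<^sup>2 \<le> 6 * \<eta>\<^sup>2" using sq[OF j \<omega>] by simp
        ultimately show "\<bar>min (6 * (Y j \<omega>)\<^sup>2) (\<bar>t\<bar> * \<bar>Y j \<omega>\<bar> ^ 3)\<bar> \<le> 6 * \<eta>\<^sup>2"
          by linarith
      qed
      fix \<omega> assume \<omega>: "\<omega> \<in> space M"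
      have "\<bar>Y j \<omega>\<bar> ^ 3 = \<bar>Y j \<omega>\<bar> * (Y j \<omega>)\<^sup>2" by (simp add: power3_eq_cube power2_eq_square)
      also have "\<dots> \<le> \<eta> * (Y j \<omega>)\<^sup>2" using bound[OF j \<omega>] by (intro mult_right_mono) auto
      finally have "\<bar>t\<bar> * \<bar>Y j \<omega>\<bar> ^ 3 \<le> \<bar>t\<bar> * (\<eta> * (Y j \<omega>)\<^sup>2)" by (intro mult_left_mono) auto
      then show "min (6 * (Y j \<omega>)\<^sup>2) (\<bar>t\<bar> * \<bar>Y j \<omega>\<bar> ^ 3) \<le> \<bar>t\<bar> * \<eta> * (Y j \<omega>)\<^sup>2"
        by (simp add: min_le_iff_disj mult.assoc)
    qed (use int2[OF j] in auto)
    also have "\<dots> = \<bar>t\<bar> ^ 3 * \<eta> * \<sigma> j / 6"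
      by (simp add: \<sigma>_def power3_eq_cube power2_eq_square)
    finally have 1: "cmod (\<psi> j - of_real (1 - u)) \<le> \<bar>t\<bar> ^ 3 * \<eta> * \<sigma> j / 6" by (simp add: u_def)
    \<comment> \<open>Multiplied by 1 + u \<le> exp u, the claim follows from (1 - u + u^2) (1 + u)
      = 1 + u^3.\<close>
    have "exp (- u) \<le> 1 - u + u\<^sup>2"
    proof -
      have "exp (- u) * (1 + u) \<le> exp (- u) * exp u" by (intro mult_left_mono exp_ge_add_one_self) auto
      also have "\<dots> = 1" by (simp flip: exp_add)
      also have "1 \<le> (1 - u + u\<^sup>2) * (1 + u)"
      proof -
        have "(1 - u + u\<^sup>2) * (1 + u) = 1 + u ^ 3" by (simp add: power2_eq_square power3_eq_cube algebra_simps)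
        then show ?thesis using u by simp
      qed
      finally show ?thesis using u by (simp add: mult_le_cancel_right)
    qed
    moreover have "1 - u \<le> exp (- u)" using exp_ge_add_one_self[of "- u"] by simp
    ultimately have "\<bar>(1 - u) - exp (- u)\<bar> \<le> u\<^sup>2" by linarith
    then have 2: "cmod (of_real (1 - u) - of_real (exp (- u))) \<le> u\<^sup>2"
      unfolding of_real_diff[symmetric] norm_of_real by simp
    have "u\<^sup>2 = t ^ 4 * \<sigma> j * \<sigma> j / 4" by (simp add: u_def power2_eq_square power4_eq_xxxx)
    also have "\<dots> \<le> t ^ 4 * \<sigma> j * \<eta>\<^sup>2 / 4"
      using \<sigma>0 \<sigma>_le[OF j] by (intro divide_right_mono mult_left_mono) auto
    also have "\<dots> \<le> t ^ 4 * \<eta>\<^sup>2 * \<sigma> j" using \<sigma>0 by (simp add: mult_ac)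
    finally have 3: "u\<^sup>2 \<le> t ^ 4 * \<eta>\<^sup>2 * \<sigma> j" .
    have 4: "\<bar>t\<bar> ^ 3 * \<eta> * \<sigma> j / 6 \<le> \<bar>t\<bar> ^ 3 * \<eta> * \<sigma> j" using \<eta> \<sigma>0 by simp
    have "cmod (\<psi> j - of_real (exp (- u))) \<le> \<bar>t\<bar> ^ 3 * \<eta> * \<sigma> j / 6 + u\<^sup>2"
      using norm_triangle_mono[OF 1 2] by simp
    also have "\<dots> \<le> (\<bar>t\<bar> ^ 3 * \<eta> + t ^ 4 * \<eta>\<^sup>2) * \<sigma> j" unfolding distrib_right by (rule add_mono[OF 4 3])
    finally show ?thesis by (simp add: u_def exp_of_real)
  qed
  have "- (t\<^sup>2) / 2 = (\<Sum>j\<in>J. - (t\<^sup>2 * \<sigma> j / 2))"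
    using var by (simp add: \<sigma>_def sum_negf flip: sum_divide_distrib sum_distrib_left)
  then have exp_eq: "exp (- (t\<^sup>2) / 2) = (\<Prod>j\<in>J. exp (- (t\<^sup>2 * \<sigma> j / 2)))"
    using fin by (simp add: exp_sum)
  have "cmod (char (distr M borel (\<lambda>\<omega>. \<Sum>j\<in>J. Y j \<omega>)) t - exp (- (t\<^sup>2) / 2))
      = cmod ((\<Prod>j\<in>J. \<psi> j) - (\<Prod>j\<in>J. complex_of_real (exp (- (t\<^sup>2 * \<sigma> j / 2)))))"
    unfolding char_distr_sum[OF indep] \<psi>_def exp_eq by simp
  also have "\<dots> \<le> (\<Sum>j\<in>J. cmod (\<psi> j - complex_of_real (exp (- (t\<^sup>2 * \<sigma> j / 2)))))"
  proof (rule norm_prod_diff)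
    show "cmod (\<psi> j) \<le> 1" if "j \<in> J" for j
      unfolding \<psi>_def using meas[OF that] by (intro real_distribution.cmod_char_le_1 real_distribution_distr)
    show "cmod (complex_of_real (exp (- (t\<^sup>2 * \<sigma> j / 2)))) \<le> 1" for j
      using \<sigma>0 by (simp only: norm_of_real) simp
  qed
  also have "\<dots> \<le> (\<Sum>j\<in>J. (\<bar>t\<bar> ^ 3 * \<eta> + t ^ 4 * \<eta>\<^sup>2) * \<sigma> j)"
    using each by (intro sum_mono) (simp add: exp_of_real)
  also have "\<dots> = \<bar>t\<bar> ^ 3 * \<eta> + t ^ 4 * \<eta>\<^sup>2"
    using var by (simp add: \<sigma>_def flip: sum_distrib_left)
  finally show ?thesis .
qed

text \<open>On \<open>G\<close> the map from x to exp (i t x) is Lipschitz with constant |t|; off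
  \<open>G\<close> two points of the unit circle are at distance at most 2. This carries the normal
  limit from the linear term over to the eigenvector.\<close>

lemma char_perturbation:
  assumes X: "random_variable borel X" and Y: "random_variable borel Y" and G: "G \<in> events"
    and close: "\<And>\<omega>. \<omega> \<in> G \<Longrightarrow> \<bar>X \<omega> - Y \<omega>\<bar> \<le> \<epsilon>" and \<epsilon>: "\<epsilon> \<ge> 0"
  shows "cmod (char (distr M borel X) t - char (distr M borel Y) t) \<le> \<bar>t\<bar> * \<epsilon> + 2 * prob (space M - G)"
proof -
  have intX: "integrable M (\<lambda>\<omega>. iexp (t * X \<omega>))" and intY: "integrable M (\<lambda>\<omega>. iexp (t * Y \<omega>))"
    using X Y by (auto intro!: integrable_iexp)
  have "char (distr M borel X) t - char (distr M borel Y) t = (CLINT \<omega>|M. iexp (t * X \<omega>) - iexp (t * Y \<omega>))"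
    unfolding char_def using X Y intX intY by (simp add: integral_distr)
  also have "cmod \<dots> \<le> (LINT \<omega>|M. cmod (iexp (t * X \<omega>) - iexp (t * Y \<omega>)))"
    by (rule integral_norm_bound)
  also have "\<dots> \<le> (LINT \<omega>|M. \<bar>t\<bar> * \<epsilon> + 2 * indicator (space M - G) \<omega>)"
  proof (intro integral_mono integrable_norm Bochner_Integration.integrable_diff intX intY)
    show "integrable M (\<lambda>\<omega>. \<bar>t\<bar> * \<epsilon> + 2 * indicator (space M - G) \<omega> :: real)"
      using G by (intro Bochner_Integration.integrable_add integrable_mult_right integrable_const integrable_real_indicator)
        (auto simp: emeasure_eq_measure)
    fix \<omega> assume \<omega>: "\<omega> \<in> space M"
    show "cmod (iexp (t * X \<omega>) - iexp (t * Y \<omega>)) \<le> \<bar>t\<bar> * \<epsilon> + 2 * indicator (space M - G) \<omega>"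
    proof (cases "\<omega> \<in> G")
      case True
      have "iexp (t * X \<omega>) - iexp (t * Y \<omega>) = iexp (t * Y \<omega>) * (iexp (t * (X \<omega> - Y \<omega>)) - 1)"
        by (simp add: algebra_simps flip: exp_add)
      then have "cmod (iexp (t * X \<omega>) - iexp (t * Y \<omega>)) = cmod (iexp (t * (X \<omega> - Y \<omega>)) - 1)"
        by (simp add: norm_mult)
      also have "\<dots> \<le> \<bar>t * (X \<omega> - Y \<omega>)\<bar>"
        using iexp_approx1[of "t * (X \<omega> - Y \<omega>)" 0] by simp
      also have "\<dots> \<le> \<bar>t\<bar> * \<epsilon>" unfolding abs_mult using close[OF True] by (intro mult_left_mono) auto
      finally show ?thesis using True by simp
    next
      case False
      have "cmod (iexp (t * X \<omega>) - iexp (t * Y \<omega>)) \<le> cmod (iexp (t * X \<omega>)) + cmod (iexp (t * Y \<omega>))"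
        by (rule norm_triangle_ineq4)
      also have "\<dots> = 2" by simp
      finally show ?thesis using False \<omega> \<epsilon> by (simp add: add_increasing)
    qed
  qed
  also have "\<dots> = \<bar>t\<bar> * \<epsilon> + 2 * prob (space M - G)"
    using G by (subst Bochner_Integration.integral_add)
      (auto simp: prob_space emeasure_eq_measure intro!: integrable_real_indicator integrable_mult_right)
  finally show ?thesis .
qed

end

section \<open>Chung-Lu graphs with balanced degrees\<close>

text \<open>\<open>ex_max_eigenpair\<close> supplies an eigenvalue that dominates the quadratic
  form, and as a member of the finite spectrum it is at most the maximum. With the degree vector as
  \<open>y\<close> this yields \<open>top\<close> of the perturbation locale.\<close>

lemma largest_eigenvalue_ge:
  assumes B: "B \<in> carrier_mat n n" and n: "n > 0"
    and sym: "\<And>i j. i < n \<Longrightarrow> j < n \<Longrightarrow> B $$ (i, j) = B $$ (j, i)" and y: "ip n y y = 1"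
  shows "ip n y (mv n (\<lambda>i j. B $$ (i, j)) y) \<le> largest_eigenvalue B"
proof -
  let ?A = "\<lambda>i j. B $$ (i, j)"
  have "\<exists>\<mu> w. ip n w w = 1 \<and> (\<forall>i<n. mv n ?A w i = \<mu> * w i) \<and> (\<forall>x. ip n x (mv n ?A x) \<le> \<mu> * ip n x x)"
    by (rule ex_max_eigenpair[OF n sym])
  then obtain \<mu> w where w: "ip n w w = 1" "\<And>i. i < n \<Longrightarrow> mv n ?A w i = \<mu> * w i"
    "\<And>x. ip n x (mv n ?A x) \<le> \<mu> * ip n x x" by blast
  define u where "u = Matrix.vec n w"
  have "eigenvector B u \<mu>"
    unfolding eigenvector_def
  proof (intro conjI)
    show "u \<in> carrier_vec (dim_row B)" using B by (simp add: u_def)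
    show "u \<noteq> 0\<^sub>v (dim_row B)"
    proof
      assume "u = 0\<^sub>v (dim_row B)"
      then have "u $ i = 0" if "i < n" for i using that B by simp
      then have "\<forall>i<n. w i = 0" by (simp add: u_def)
      then have "ip n w w = 0" by (simp add: ip_self_eq_0_iff)
      with w(1) show False by simp
    qed
    show "B *\<^sub>v u = \<mu> \<cdot>\<^sub>v u"
    proof (rule eq_vecI)
      fix i assume "i < dim_vec (\<mu> \<cdot>\<^sub>v u)"
      then have i: "i < n" by (simp add: u_def)
      have "(B *\<^sub>v u) $ i = mv n ?A w i"
        using B i by (simp add: u_def mv_def scalar_prod_def atLeast0LessThan)
      then show "(B *\<^sub>v u) $ i = (\<mu> \<cdot>\<^sub>v u) $ i" using w(2)[OF i] i by (simp add: u_def)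
    qed (use B in \<open>simp add: u_def\<close>)
  qed
  then have "\<mu> \<in> spectrum B" by (auto simp: spectrum_def eigenvalue_def)
  then have "\<mu> \<le> largest_eigenvalue B"
    unfolding largest_eigenvalue_def using card_finite_spectrum(1)[OF B] by (rule Max_ge[rotated])
  with w(3)[of y] y show ?thesis by simp
qed

lemma leading_eigenvector_coords:
  assumes "leading_eigenvector n \<delta> B x" and B: "B \<in> carrier_mat n n"
  shows leading_eigenvector_dim: "x \<in> carrier_vec n"
    and leading_eigenvector_unit: "ip n (($) x) (($) x) = 1"
    and leading_eigenvector_eq: "i < n \<Longrightarrow> mv n (\<lambda>i j. B $$ (i, j)) (($) x) i = largest_eigenvalue B * x $ i"
    and leading_eigenvector_orient: "x \<bullet> degree_vec n \<delta> \<ge> 0"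
proof -
  show x: "x \<in> carrier_vec n" and "x \<bullet> degree_vec n \<delta> \<ge> 0"
    using assms by (auto simp: leading_eigenvector_def eigenvector_def)
  have "x \<bullet> x = ip n (($) x) (($) x)"
    using x by (simp add: scalar_prod_def ip_def atLeast0LessThan)
  then show "ip n (($) x) (($) x) = 1"
    using assms by (simp add: leading_eigenvector_def l2_norm_vec_def)
  show "mv n (\<lambda>i j. B $$ (i, j)) (($) x) i = largest_eigenvalue B * x $ i" if i: "i < n"
  proof -
    have "B *\<^sub>v x = largest_eigenvalue B \<cdot>\<^sub>v x"
      using assms by (simp add: leading_eigenvector_def eigenvector_def)
    then have "(B *\<^sub>v x) $ i = (largest_eigenvalue B \<cdot>\<^sub>v x) $ i" by simp
    then show ?thesis using x B i by (simp add: mv_def scalar_prod_def atLeast0LessThan)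
  qed
qed

section \<open>Degree moments at fixed n\<close>

text \<open>\<open>ratio\<close> is (D2) with an explicit constant at a single n.
  \<open>sparse\<close> makes the uniform bound \<open>q\<close> on the edge probabilities at most
  1.\<close>

locale balanced_degrees =
  fixes n :: nat and \<delta> :: "nat \<Rightarrow> nat" and \<kappa> :: real
  assumes n: "n > 0" and pos: "\<And>i. i < n \<Longrightarrow> \<delta> i > 0" and \<kappa>: "\<kappa> \<ge> 1"
    and ratio: "max_deg n \<delta> \<le> \<kappa> * min_deg n \<delta>" and sparse: "\<kappa> * max_deg n \<delta> \<le> real n"
begin

abbreviation D :: real where "D \<equiv> max_deg n \<delta>"
abbreviation m :: "nat \<Rightarrow> real" where "m k \<equiv> deg_moment k n \<delta>"

definition lam :: real where "lam = m 2 / m 1"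
definition e :: "nat \<Rightarrow> real" where "e i = real (\<delta> i) / sqrt (m 2)"
definition q :: real where "q = D\<^sup>2 / m 1"

lemma deg_le: "i < n \<Longrightarrow> real (\<delta> i) \<le> D"
  by (simp add: max_deg_def)

lemma deg_ge: "i < n \<Longrightarrow> D / \<kappa> \<le> real (\<delta> i)"
proof -
  assume i: "i < n"
  then have "min_deg n \<delta> \<le> real (\<delta> i)" by (simp add: min_deg_def)
  then have "\<kappa> * min_deg n \<delta> \<le> \<kappa> * real (\<delta> i)" using \<kappa> by (intro mult_left_mono) auto
  with ratio have "D \<le> \<kappa> * real (\<delta> i)" by linarith
  then show ?thesis using \<kappa> by (simp add: divide_le_eq mult.commute)
qed

lemma D_ge_1: "D \<ge> 1"
  using deg_le[OF n] pos[OF n] by linarith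

lemma moment_ge: "real n * (D / \<kappa>) ^ k \<le> m k"
proof -
  have "(\<Sum>i<n. (D / \<kappa>) ^ k) \<le> (\<Sum>i<n. real (\<delta> i) ^ k)"
    using deg_ge D_ge_1 \<kappa> by (intro sum_mono power_mono) auto
  then show ?thesis by (simp add: deg_moment_def)
qed

lemma moment_le: "m k \<le> real n * D ^ k"
proof -
  have "(\<Sum>i<n. real (\<delta> i) ^ k) \<le> (\<Sum>i<n. D ^ k)"
    using deg_le by (intro sum_mono power_mono) auto
  then show ?thesis by (simp add: deg_moment_def)
qed

lemma moment_pos: "m k > 0"
proof -
  have "0 < real n * (D / \<kappa>) ^ k" using n D_ge_1 \<kappa> by simp
  then show ?thesis using moment_ge[of k] by linarith
qed

lemma moment_Suc_le: "m (Suc k) \<le> D * m k"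
  unfolding deg_moment_def sum_distrib_left
  using deg_le by (intro sum_mono) (simp add: mult_right_mono)

lemma moment_Suc_ge: "D / \<kappa> * m k \<le> m (Suc k)"
  unfolding deg_moment_def sum_distrib_left
  by (intro sum_mono) (simp add: mult_right_mono[OF deg_ge] del: times_divide_eq_left)

lemma lam_le: "lam \<le> D" and lam_ge: "D / \<kappa> \<le> lam"
  using moment_Suc_le[of 1] moment_Suc_ge[of 1] moment_pos[of 1]
  by (simp_all add: lam_def divide_le_eq le_divide_eq numeral_2_eq_2)

lemma lam_pos: "lam > 0"
  using moment_pos by (simp add: lam_def)

lemma e_nonneg: "e i \<ge> 0"
  using moment_pos[of 2] by (simp add: e_def less_imp_le)

lemma e_le: "i < n \<Longrightarrow> e i \<le> \<kappa> / sqrt n"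
proof -
  assume i: "i < n"
  have "sqrt n * (D / \<kappa>) = sqrt (real n * (D / \<kappa>)\<^sup>2)"
    using D_ge_1 \<kappa> by (simp add: real_sqrt_mult)
  also have "\<dots> \<le> sqrt (m 2)" by (intro real_sqrt_le_mono moment_ge)
  finally have le: "sqrt n * (D / \<kappa>) \<le> sqrt (m 2)" .
  have p: "sqrt n * (D / \<kappa>) > 0" using n D_ge_1 \<kappa> by simp
  have "e i \<le> D / (sqrt n * (D / \<kappa>))"
    unfolding e_def using deg_le[OF i] le p D_ge_1 by (intro frac_le) auto
  also have "\<dots> = \<kappa> / sqrt n" using D_ge_1 by simp
  finally show ?thesis .
qed

lemma ip_e_e: "ip n e e = 1"
proof -
  have "ip n e e = (\<Sum>i<n. (real (\<delta> i))\<^sup>2 / m 2)"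
    unfolding ip_def e_def using moment_pos[of 2] by (intro sum.cong) (simp_all add: power2_eq_square)
  also have "\<dots> = m 2 / m 2" by (simp only: deg_moment_def sum_divide_distrib)
  finally show ?thesis using moment_pos[of 2] by simp
qed

text \<open>The self-loops obey the same formula, so the mean of the adjacency matrix has rank one
  exactly, with no correction on the diagonal.\<close>

lemma edge_prob_eq: "edge_prob n \<delta> i j = lam * e i * e j"
proof -
  have "e i * e j = real (\<delta> i) * real (\<delta> j) / m 2"
    using moment_pos[of 2] by (simp add: e_def)
  then have "lam * e i * e j = m 2 / m 1 * (real (\<delta> i) * real (\<delta> j) / m 2)" by (simp add: lam_def mult.assoc)
  then show ?thesis using moment_pos[of 2] by (simp add: edge_prob_def)
qed

lemma nq_bounds: "real n * q \<ge> D" "real n * q \<le> \<kappa> * D" "q \<ge> 0" "q \<le> 1"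
proof -
  have "real n * q = real n * D * D / m 1" by (simp add: q_def power2_eq_square)
  moreover have "D * m 1 \<le> real n * D * D"
    using mult_left_mono[OF moment_le[of 1], of D] D_ge_1 by (simp add: mult_ac)
  moreover have "real n * D * D \<le> \<kappa> * D * m 1"
    using mult_left_mono[OF moment_ge[of 1], of "\<kappa> * D"] D_ge_1 \<kappa> by (simp add: mult_ac)
  ultimately show "real n * q \<ge> D" "real n * q \<le> \<kappa> * D"
    using moment_pos[of 1] by (simp_all add: divide_le_eq le_divide_eq)
  show q0: "q \<ge> 0" using moment_pos[of 1] by (simp add: q_def)
  have "real n * q \<le> real n * 1" using \<open>real n * q \<le> \<kappa> * D\<close> sparse by simp
  then show "q \<le> 1" using n by simp
qed

lemma edge_prob_le: "i < n \<Longrightarrow> j < n \<Longrightarrow> edge_prob n \<delta> i j \<le> q"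
  unfolding edge_prob_def q_def power2_eq_square
  using moment_pos[of 1] deg_le D_ge_1 by (intro divide_right_mono mult_mono) auto

lemma edge_prob_nonneg: "edge_prob n \<delta> i j \<ge> 0"
  using moment_pos[of 1] by (simp add: edge_prob_def)

end

section \<open>The centered adjacency matrix\<close>

locale chung_lu = balanced_degrees +
  fixes M :: "'a measure" and E :: "'a \<Rightarrow> nat set set"
  assumes graph: "chung_lu_graph M n \<delta> E"
begin

sublocale prob_space M
  using graph by (simp add: chung_lu_graph_def)

definition ev :: "nat set \<Rightarrow> 'a set" where "ev f = {\<omega> \<in> space M. f \<in> E \<omega>}"

definition X :: "nat set \<Rightarrow> 'a \<Rightarrow> real" where "X f \<omega> = indicator (ev f) \<omega> - prob (ev f)"

definition H :: "'a \<Rightarrow> nat \<Rightarrow> nat \<Rightarrow> real" where "H \<omega> = (\<lambda>i j. X {i, j} \<omega>)"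

lemma H_sym: "H \<omega> i j = H \<omega> j i"
  by (simp add: H_def insert_commute)

lemma ev_events: "f \<in> vertex_pairs n \<Longrightarrow> ev f \<in> events"
  using graph by (auto simp: chung_lu_graph_def ev_def indep_events_def)

lemma prob_ev: "i < n \<Longrightarrow> j < n \<Longrightarrow> prob (ev {i, j}) = edge_prob n \<delta> i j"
  using graph by (auto simp: chung_lu_graph_def ev_def)

lemma prob_ev_le: "f \<in> vertex_pairs n \<Longrightarrow> prob (ev f) \<le> q"
  using prob_ev edge_prob_le by (auto simp: vertex_pairs_def)

lemma X_measurable: "f \<in> vertex_pairs n \<Longrightarrow> X f \<in> borel_measurable M"
  unfolding X_def using ev_events by (intro borel_measurable_diff borel_measurable_indicator) auto

lemma X_indep: "indep_vars (\<lambda>_. borel) X (vertex_pairs n)"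
proof -
  have "indep_events ev (vertex_pairs n)"
    using graph by (simp add: chung_lu_graph_def ev_def[abs_def])
  from indep_vars_indicator[OF this] show ?thesis
    unfolding X_def[abs_def]
    by (rule indep_vars_compose2[where Y = "\<lambda>f x. x - prob (ev f)"]) auto
qed

lemma X_bound: "\<bar>X f \<omega>\<bar> \<le> 1"
  unfolding X_def using prob_le_1[of "ev f"] measure_nonneg[of M "ev f"]
  by (auto simp: indicator_def simp del: measure_nonneg)

lemma X_mean: "f \<in> vertex_pairs n \<Longrightarrow> expectation (X f) = 0"
  unfolding X_def using ev_events[of f] by (simp add: prob_space emeasure_eq_measure)

lemma X_second_moment: "f \<in> vertex_pairs n \<Longrightarrow> expectation (\<lambda>\<omega>. (X f \<omega>)\<^sup>2) = prob (ev f) * (1 - prob (ev f))"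
proof -
  assume f: "f \<in> vertex_pairs n"
  have "(X f \<omega>)\<^sup>2 = (1 - 2 * prob (ev f)) * indicator (ev f) \<omega> + (prob (ev f))\<^sup>2" for \<omega>
    by (auto simp: X_def indicator_def power2_eq_square algebra_simps)
  then have "expectation (\<lambda>\<omega>. (X f \<omega>)\<^sup>2) = (1 - 2 * prob (ev f)) * prob (ev f) + (prob (ev f))\<^sup>2"
    using ev_events[OF f] by (simp add: prob_space emeasure_eq_measure)
  then show ?thesis by (simp add: power2_eq_square algebra_simps)
qed

lemma X_second_moment_le: "f \<in> vertex_pairs n \<Longrightarrow> expectation (\<lambda>\<omega>. (X f \<omega>)\<^sup>2) \<le> q"
proof -
  assume f: "f \<in> vertex_pairs n"
  have "prob (ev f) * (1 - prob (ev f)) \<le> prob (ev f) * 1" by (intro mult_left_mono) auto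
  then show ?thesis using X_second_moment[OF f] prob_ev_le[OF f] by simp
qed

lemma vertex_pairsI: "i < n \<Longrightarrow> j < n \<Longrightarrow> {i, j} \<in> vertex_pairs n"
  by (auto simp: vertex_pairs_def)

lemma adjacency_decomp:
  assumes "\<omega> \<in> space M" "i < n" "j < n"
  shows "adjacency_matrix n (E \<omega>) $$ (i, j) = lam * e i * e j + H \<omega> i j"
  using assms by (simp add: adjacency_matrix_def H_def X_def ev_def[of "{i, j}"] prob_ev[symmetric]
      edge_prob_eq[symmetric] indicator_def)

lemma adjacency_mv:
  assumes "\<omega> \<in> space M" "i < n"
  shows "mv n (\<lambda>i j. adjacency_matrix n (E \<omega>) $$ (i, j)) x i = lam * ip n x e * e i + mv n (H \<omega>) x i"
proof -
  have "mv n (\<lambda>i j. adjacency_matrix n (E \<omega>) $$ (i, j)) x i = (\<Sum>j<n. (lam * e i * e j + H \<omega> i j) * x j)"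
    unfolding mv_def using assms by (intro sum.cong) (simp_all add: adjacency_decomp)
  also have "\<dots> = lam * ip n x e * e i + mv n (H \<omega>) x i"
    unfolding mv_def ip_def distrib_right sum.distrib sum_distrib_left sum_distrib_right
    by (simp add: mult_ac)
  finally show ?thesis .
qed

lemma adjacency_perturbed_rank_one:
  assumes \<omega>: "\<omega> \<in> space M" and x: "leading_eigenvector n \<delta> (adjacency_matrix n (E \<omega>)) x"
    and h: "h \<ge> 0" "\<And>x. ip n (mv n (H \<omega>) x) (mv n (H \<omega>) x) \<le> h\<^sup>2 * ip n x x"
    and g: "\<bar>ip n e (mv n (H \<omega>) e)\<bar> \<le> g" and gap: "8 * h \<le> lam"
  shows "perturbed_rank_one n (H \<omega>) e (($) x) lam (largest_eigenvalue (adjacency_matrix n (E \<omega>))) h g"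
proof
  let ?B = "adjacency_matrix n (E \<omega>)"
  have B: "?B \<in> carrier_mat n n" by (simp add: adjacency_matrix_def)
  have sym: "?B $$ (i, j) = ?B $$ (j, i)" if "i < n" "j < n" for i j
    using that by (simp add: adjacency_matrix_def insert_commute)
  note x' = leading_eigenvector_coords[OF x B]
  show "H \<omega> i j = H \<omega> j i" for i j by (rule H_sym)
  show "ip n e e = 1" by (rule ip_e_e)
  show "ip n (($) x) (($) x) = 1" by (rule x')
  have "x \<bullet> degree_vec n \<delta> = ip n (($) x) e"
    unfolding scalar_prod_def ip_def degree_vec_def e_def by (intro sum.cong) auto
  with x'(4) show "0 \<le> ip n (($) x) e" by simp
  show "largest_eigenvalue ?B * x $ i = lam * ip n (($) x) e * e i + mv n (H \<omega>) (($) x) i" if "i < n" for i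
    using x'(3)[OF that] adjacency_mv[OF \<omega> that] by simp
  have "ip n e (mv n (\<lambda>i j. ?B $$ (i, j)) e) = ip n e (\<lambda>i. lam * ip n e e * e i + mv n (H \<omega>) e i)"
    using adjacency_mv[OF \<omega>] by (intro ip_cong) auto
  also have "\<dots> = lam + ip n e (mv n (H \<omega>) e)" by (simp add: ip_linear ip_e_e)
  finally show "lam + ip n e (mv n (H \<omega>) e) \<le> largest_eigenvalue ?B"
    using largest_eigenvalue_ge[OF B n sym ip_e_e] by simp
qed (use h g gap lam_pos in auto)

end

section \<open>The good event and its consequences\<close>

context chung_lu
begin

lemma expectation_mv_H: "i < n \<Longrightarrow> expectation (\<lambda>\<omega>. mv n (H \<omega>) x i) = 0"
  and integrable_mv_H: "i < n \<Longrightarrow> integrable M (\<lambda>\<omega>. mv n (H \<omega>) x i)"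
proof -
  assume i: "i < n"
  have int: "integrable M (\<lambda>\<omega>. X {i, j} \<omega>)" if "j < n" for j
    using bounded_integrable[OF X_measurable[OF vertex_pairsI[OF i that]] X_bound] .
  then show "integrable M (\<lambda>\<omega>. mv n (H \<omega>) x i)"
    unfolding mv_def H_def by (intro Bochner_Integration.integrable_sum integrable_mult_left) auto
  have "expectation (\<lambda>\<omega>. mv n (H \<omega>) x i) = (\<Sum>j<n. expectation (\<lambda>\<omega>. X {i, j} \<omega>) * x j)"
    unfolding mv_def H_def
    by (subst Bochner_Integration.integral_sum) (use int in \<open>auto intro!: integrable_mult_left\<close>)
  also have "\<dots> = 0" using X_mean[OF vertex_pairsI[OF i]] by (intro sum.neutral) auto
  finally show "expectation (\<lambda>\<omega>. mv n (H \<omega>) x i) = 0" .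
qed

text \<open>A crude bound valid for every outcome, for use on the bad event, whose probability beats
  any power of n.\<close>

lemma abs_mv_H_le: "\<bar>mv n (H \<omega>) e i\<bar> \<le> real n * \<kappa>"
proof -
  have "\<bar>mv n (H \<omega>) e i\<bar> \<le> (\<Sum>j<n. \<bar>H \<omega> i j * e j\<bar>)" unfolding mv_def by (rule sum_abs)
  also have "\<dots> \<le> (\<Sum>j<n. 1 * \<kappa>)"
    unfolding abs_mult
  proof (intro sum_mono mult_mono)
    fix j assume "j \<in> {..<n}"
    then have "e j \<le> \<kappa> / sqrt n" by (simp add: e_le)
    also have "\<dots> \<le> \<kappa> / 1" using n \<kappa> by (intro divide_left_mono) auto
    finally show "\<bar>e j\<bar> \<le> \<kappa>" using e_nonneg[of j] by simp
    show "\<bar>H \<omega> i j\<bar> \<le> 1" unfolding H_def by (rule X_bound)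
  qed auto
  finally show ?thesis by simp
qed

text \<open>The price of one application of \<open>H\<close>: the natural scale sqrt D of its norm
  times the loss N of the moment method.\<close>

definition T :: "real \<Rightarrow> real" where "T N = 12 * N * sqrt (\<kappa> * D)"

text \<open>The moment bound wants entries at most 1 in absolute value; by linearity the factor 1 /
  sqrt n returns in the bounds for \<open>e\<close>.\<close>

definition e_scaled :: "nat \<Rightarrow> real" where "e_scaled i = sqrt n / \<kappa> * e i"

definition deviant :: "real \<Rightarrow> (nat \<Rightarrow> real) \<Rightarrow> nat \<Rightarrow> nat \<Rightarrow> 'a set" where
  "deviant N x k i = {\<omega> \<in> space M. \<bar>(mv n (H \<omega>) ^^ k) x i\<bar> > T N ^ k}"

text \<open>The first family controls the entries of \<open>H^k e\<close>, the second the entries of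
  a single high power of \<open>H\<close> and with them its operator norm, the third the quadratic
  form of \<open>e\<close>.\<close>

definition good :: "real \<Rightarrow> 'a set" where
  "good N = space M - (\<Union>(k, i)\<in>{1..nat \<lfloor>N\<rfloor>} \<times> {..<n}. deviant N e_scaled k i)
     - (\<Union>(i, j)\<in>{..<n} \<times> {..<n}. deviant N (unit_fun j) (nat \<lfloor>N\<rfloor>) i)
     - {\<omega> \<in> space M. \<bar>ip n e (mv n (H \<omega>) e)\<bar> \<ge> N}"

lemma T_pos: "N > 0 \<Longrightarrow> T N > 0"
  using D_ge_1 \<kappa> by (simp add: T_def)

lemma e_scaled_le: "i < n \<Longrightarrow> \<bar>e_scaled i\<bar> \<le> 1"
proof -
  assume i: "i < n"
  have "sqrt n / \<kappa> * e i \<le> sqrt n / \<kappa> * (\<kappa> / sqrt n)"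
    using e_le[OF i] \<kappa> by (intro mult_left_mono) auto
  also have "\<dots> = 1" using n \<kappa> by simp
  finally show ?thesis using e_nonneg[of i] \<kappa> by (simp add: e_scaled_def)
qed

lemma e_eq_scaled: "e = (\<lambda>i. \<kappa> / sqrt n * e_scaled i)"
  using n \<kappa> by (auto simp: e_scaled_def)

lemma mv_pow_H_measurable: "i < n \<Longrightarrow> (\<lambda>\<omega>. (mv n (H \<omega>) ^^ k) x i) \<in> borel_measurable M"
  unfolding H_def by (rule borel_measurable_mv_pow) (use X_measurable in auto)

lemma deviant_events: "i < n \<Longrightarrow> deviant N x k i \<in> events"
  unfolding deviant_def using mv_pow_H_measurable by measurable

lemma prob_deviant:
  assumes x: "\<And>j. j < n \<Longrightarrow> \<bar>x j\<bar> \<le> 1" and i: "i < n" and N: "N \<ge> 1" and k: "k > 0" "real k \<le> N"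
  shows "prob (deviant N x k i) \<le> 3 * N * exp (- 2 * N)"
  unfolding deviant_def T_def H_def
  by (rule prob_mv_pow_gt[OF X_indep X_bound X_mean X_second_moment_le nq_bounds(3,4) _ nq_bounds(2) x i N k])
     (use nq_bounds(1) D_ge_1 in auto)

lemma quadratic_form_measurable: "(\<lambda>\<omega>. ip n e (mv n (H \<omega>) e)) \<in> borel_measurable M"
  unfolding ip_def using mv_pow_H_measurable[where k = 1] by (intro borel_measurable_sum borel_measurable_times) auto

lemma good_events: "good N \<in> events"
proof -
  have "{\<omega> \<in> space M. \<bar>ip n e (mv n (H \<omega>) e)\<bar> \<ge> N} \<in> events"
    using quadratic_form_measurable by measurable
  then show ?thesis
    unfolding good_def by (intro sets.Diff sets.finite_UN) (auto intro: deviant_events)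
qed

lemma prob_not_good:
  assumes N: "N \<ge> 1"
  shows "prob (space M - good N) \<le> 6 * (real n)\<^sup>2 * N\<^sup>2 * exp (- 2 * N) + 2 * exp (- N\<^sup>2 / (8 * \<kappa> ^ 4))"
proof -
  let ?F = "nat \<lfloor>N\<rfloor>"
  let ?b = "3 * N * exp (- 2 * N)"
  define B1 where "B1 = (\<Union>p\<in>{1..?F} \<times> {..<n}. deviant N e_scaled (fst p) (snd p))"
  define B2 where "B2 = (\<Union>p\<in>{..<n} \<times> {..<n}. deviant N (unit_fun (snd p)) ?F (fst p))"
  define B3 where "B3 = {\<omega> \<in> space M. \<bar>ip n e (mv n (H \<omega>) e)\<bar> \<ge> N}"
  have F: "1 \<le> ?F" "real ?F \<le> N" using N by linarith+
  have ev1: "B1 \<in> events" unfolding B1_def by (intro sets.finite_UN) (auto intro: deviant_events)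
  have ev2: "B2 \<in> events" unfolding B2_def by (intro sets.finite_UN) (auto intro: deviant_events)
  have ev3: "B3 \<in> events" unfolding B3_def using quadratic_form_measurable by measurable
  have "space M - good N \<subseteq> B1 \<union> B2 \<union> B3"
    unfolding good_def B1_def B2_def B3_def by (auto simp: case_prod_unfold)
  then have "prob (space M - good N) \<le> prob (B1 \<union> B2 \<union> B3)"
    using ev1 ev2 ev3 by (intro finite_measure_mono) auto
  also have "\<dots> \<le> prob (B1 \<union> B2) + prob B3" using ev1 ev2 ev3 by (intro measure_Un_le) auto
  also have "prob (B1 \<union> B2) \<le> prob B1 + prob B2" using ev1 ev2 by (intro measure_Un_le) auto
  also have "prob B1 \<le> real (card ({1..?F} \<times> {..<n})) * ?b"
    unfolding B1_def
  proof (rule prob_UN_le)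
    fix p assume p: "p \<in> {1..?F} \<times> {..<n}"
    then have "fst p > 0" "real (fst p) \<le> real ?F" "snd p < n" by auto
    then show "prob (deviant N e_scaled (fst p) (snd p)) \<le> ?b"
      using F by (intro prob_deviant e_scaled_le N) auto
  qed (auto intro: deviant_events)
  also have "prob B2 \<le> real (card ({..<n} \<times> {..<n})) * ?b"
    unfolding B2_def using F
    by (intro prob_UN_le prob_deviant N) (auto intro: deviant_events)
  also have "prob B3 \<le> 2 * exp (- N\<^sup>2 / (8 * \<kappa> ^ 4))"
    unfolding B3_def H_def
  proof (rule prob_quadratic_form_ge[OF X_indep X_bound X_mean n])
    show "\<bar>e i\<bar> \<le> \<kappa> / sqrt n" if "i < n" for i using e_le[OF that] e_nonneg[of i] by simp
  qed (use \<kappa> N in auto)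
  also have "real (card ({1..?F} \<times> {..<n})) * ?b + real (card ({..<n} \<times> {..<n})) * ?b
      = (real ?F * real n + real n * real n) * ?b" by (simp add: distrib_right)
  \<comment> \<open>Both families of deviant events are charged the same count N n^2, to leave a
    bound in which n enters only through n^2.\<close>
  also have "\<dots> \<le> (N * (real n * real n) + N * (real n * real n)) * ?b"
  proof (rule mult_right_mono[OF add_mono])
    show "real ?F * real n \<le> N * (real n * real n)"
      using n N by (intro mult_mono F) auto
    show "real n * real n \<le> N * (real n * real n)" using mult_right_mono[OF N, of "real n * real n"] by simp
  qed (use N in auto)
  also have "\<dots> = 6 * (real n)\<^sup>2 * N\<^sup>2 * exp (- 2 * N)" by (simp add: power2_eq_square)
  finally show ?thesis by simp
qed

lemma good_mv_pow_e:
  assumes \<omega>: "\<omega> \<in> good N" and i: "i < n" and k: "k \<le> nat \<lfloor>N\<rfloor>"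
  shows "\<bar>(mv n (H \<omega>) ^^ k) e i\<bar> \<le> \<kappa> / sqrt n * T N ^ k"
proof -
  have "\<bar>(mv n (H \<omega>) ^^ k) e_scaled i\<bar> \<le> T N ^ k"
  proof (cases "k = 0")
    case True
    then show ?thesis using e_scaled_le[OF i] by simp
  next
    case False
    then have "(k, i) \<in> {1..nat \<lfloor>N\<rfloor>} \<times> {..<n}" using k i by auto
    then have "\<omega> \<notin> deviant N e_scaled k i" "\<omega> \<in> space M" using \<omega> unfolding good_def by auto
    then show ?thesis by (simp add: deviant_def)
  qed
  then have "\<kappa> / sqrt n * \<bar>(mv n (H \<omega>) ^^ k) e_scaled i\<bar> \<le> \<kappa> / sqrt n * T N ^ k"
    using \<kappa> by (intro mult_left_mono) auto
  moreover have "(mv n (H \<omega>) ^^ k) e i = \<kappa> / sqrt n * (mv n (H \<omega>) ^^ k) e_scaled i"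
    by (subst e_eq_scaled) (simp only: mv_pow_scale)
  ultimately show ?thesis using \<kappa> by (simp add: abs_mult)
qed

lemma good_perturbed_rank_one:
  assumes \<omega>: "\<omega> \<in> good N" and x: "leading_eigenvector n \<delta> (adjacency_matrix n (E \<omega>)) x"
    and N: "N \<ge> 1" and n2: "real n \<le> 2 ^ nat \<lfloor>N\<rfloor>" and gap: "16 * T N \<le> lam"
  shows "perturbed_rank_one n (H \<omega>) e (($) x) lam (largest_eigenvalue (adjacency_matrix n (E \<omega>))) (2 * T N) N"
proof (rule adjacency_perturbed_rank_one[OF _ x])
  have F: "nat \<lfloor>N\<rfloor> > 0" using N by linarith
  have T: "T N > 0" using T_pos N by simp
  show "\<omega> \<in> space M" using \<omega> by (simp add: good_def)
  show "\<bar>ip n e (mv n (H \<omega>) e)\<bar> \<le> N" using \<omega> by (auto simp: good_def)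
  show "ip n (mv n (H \<omega>) y) (mv n (H \<omega>) y) \<le> (2 * T N)\<^sup>2 * ip n y y" for y
  proof (rule opnorm_from_power_entries[OF H_sym _ F n2])
    show "\<bar>(mv n (H \<omega>) ^^ nat \<lfloor>N\<rfloor>) (unit_fun j) i\<bar> \<le> T N ^ nat \<lfloor>N\<rfloor>" if "i < n" "j < n" for i j
    proof -
      have "(i, j) \<in> {..<n} \<times> {..<n}" using that by auto
      then have "\<omega> \<notin> deviant N (unit_fun j) (nat \<lfloor>N\<rfloor>) i" "\<omega> \<in> space M"
        using \<omega> unfolding good_def by auto
      then show ?thesis by (simp add: deviant_def)
    qed
  qed (use T in auto)
qed (use gap T_pos[of N] N in auto)

lemma good_estimates:
  assumes \<omega>: "\<omega> \<in> good N" and x: "leading_eigenvector n \<delta> (adjacency_matrix n (E \<omega>)) x"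
    and N: "N \<ge> 1" and n2: "real n \<le> 2 ^ nat \<lfloor>N\<rfloor>" and gap: "16 * T N \<le> lam"
  shows good_overlap: "\<bar>x \<bullet> degree_vec n \<delta> - 1\<bar> \<le> 8 * (T N / lam)\<^sup>2"
    and good_first_order: "\<lbrakk>i < n; K \<ge> 2; K \<le> nat \<lfloor>N\<rfloor>\<rbrakk> \<Longrightarrow> \<bar>x $ i - e i - mv n (H \<omega>) e i / lam\<bar>
        \<le> \<kappa> / sqrt n * (80 * (T N / lam)\<^sup>2 + 4 * (N / lam)) + (4 * T N / lam) ^ K"
    and good_linear: "i < n \<Longrightarrow> \<bar>mv n (H \<omega>) e i\<bar> \<le> \<kappa> / sqrt n * T N"
proof -
  interpret perturbed_rank_one n "H \<omega>" e "($) x" lam "largest_eigenvalue (adjacency_matrix n (E \<omega>))" "2 * T N" N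
    by (rule good_perturbed_rank_one[OF \<omega> x N n2 gap])
  have T: "T N > 0" using T_pos N by simp
  have "x \<bullet> degree_vec n \<delta> = ip n (($) x) e"
    unfolding scalar_prod_def ip_def degree_vec_def e_def by (intro sum.cong) auto
  with overlap_bound show "\<bar>x \<bullet> degree_vec n \<delta> - 1\<bar> \<le> 8 * (T N / lam)\<^sup>2"
    by (simp add: power_divide power_mult_distrib)
  show "\<bar>mv n (H \<omega>) e i\<bar> \<le> \<kappa> / sqrt n * T N" if "i < n"
    using good_mv_pow_e[OF \<omega> that, of 1] N by (simp add: le_nat_floor)
  show "\<bar>x $ i - e i - mv n (H \<omega>) e i / lam\<bar>
        \<le> \<kappa> / sqrt n * (80 * (T N / lam)\<^sup>2 + 4 * (N / lam)) + (4 * T N / lam) ^ K"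
    if "i < n" "K \<ge> 2" "K \<le> nat \<lfloor>N\<rfloor>"
  proof -
    have "\<bar>x $ i - e i - mv n (H \<omega>) e i / lam\<bar>
        \<le> \<kappa> / sqrt n * (20 * (2 * T N / lam)\<^sup>2 + 4 * (N / lam)) + (2 * (2 * T N) / lam) ^ K"
      using T \<kappa> that by (intro eigenvector_first_order[where T = "T N"] good_mv_pow_e \<omega>) auto
    then show ?thesis by (simp add: power_divide power_mult_distrib)
  qed
qed

lemma s1_sq_eq: "i < n \<Longrightarrow> s1_sq n \<delta> i = (\<Sum>j<n. (real (\<delta> j))\<^sup>2 * expectation (\<lambda>\<omega>. (X {i, j} \<omega>)\<^sup>2))"
  unfolding s1_sq_def by (intro sum.cong refl) (simp add: X_second_moment vertex_pairsI prob_ev)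

text \<open>The linear term \<open>(H e)\<^sub>i / \<lambda>\<close>, normalised as in part (IV), is a sum of independent variables with
  total variance 1.\<close>

lemma char_linear_term:
  assumes i: "i < n" and s: "s1_sq n \<delta> i > 0"
  defines "\<eta> \<equiv> D / sqrt (s1_sq n \<delta> i)"
  shows "cmod (char (distr M borel (\<lambda>\<omega>. m 2 powr (3 / 2) / m 1 * (mv n (H \<omega>) e i / lam / sqrt (s1_sq n \<delta> i)))) t
      - exp (- (t\<^sup>2) / 2)) \<le> \<bar>t\<bar> ^ 3 * \<eta> + t ^ 4 * \<eta>\<^sup>2"
proof -
  let ?s = "sqrt (s1_sq n \<delta> i)"
  let ?h = "\<lambda>j. {i, j}"
  let ?J = "?h ` {..<n}"
  \<comment> \<open>Independence is indexed by edges, so the sum over j is moved to the edges at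
    \<open>i\<close>; \<open>partner\<close> recovers j from {i, j}, and gives \<open>i\<close> for
    the loop.\<close>
  define partner where "partner = the_inv_into {..<n} ?h"
  define a where "a f = real (\<delta> (partner f)) / ?s" for f
  have inj: "inj_on ?h {..<n}" by (auto simp: inj_on_def doubleton_eq_iff)
  have a: "a {i, j} = real (\<delta> j) / ?s" if "j < n" for j
    using the_inv_into_f_f[OF inj, of j] that by (simp add: a_def partner_def)
  have J: "?J \<subseteq> vertex_pairs n" using vertex_pairsI[OF i] by auto
  have s': "?s > 0" using s by simp
  have sum_eq: "m 2 powr (3 / 2) / m 1 * (mv n (H \<omega>) e i / lam / ?s) = (\<Sum>f\<in>?J. a f * X f \<omega>)" for \<omega>
  proof -
    have "m 2 powr (3 / 2) = m 2 * sqrt (m 2)"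
      using moment_pos[of 2] powr_add[of "m 2" 1 "1 / 2"] by (simp add: powr_half_sqrt)
    \<comment> \<open>The prefactor over lam leaves exactly the sqrt (m 2) in the denominator of
      \<open>e j\<close>, so the weights become d_j / s_1(i).\<close>
    then have c: "m 2 powr (3 / 2) / m 1 / lam = sqrt (m 2)"
      using moment_pos[of 1] moment_pos[of 2] by (simp add: lam_def)
    have "m 2 powr (3 / 2) / m 1 * (mv n (H \<omega>) e i / lam / ?s) = (m 2 powr (3 / 2) / m 1 / lam) * mv n (H \<omega>) e i / ?s"
      by simp
    also have "\<dots> = (\<Sum>j<n. sqrt (m 2) * (X {i, j} \<omega> * e j) / ?s)"
      unfolding c by (simp add: mv_def H_def sum_distrib_left sum_divide_distrib)
    also have "\<dots> = (\<Sum>j<n. a {i, j} * X {i, j} \<omega>)"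
      using moment_pos[of 2] by (intro sum.cong refl) (simp add: a e_def)
    also have "\<dots> = (\<Sum>f\<in>?J. a f * X f \<omega>)" by (subst sum.reindex[OF inj]) simp
    finally show ?thesis .
  qed
  have "cmod (char (distr M borel (\<lambda>\<omega>. \<Sum>f\<in>?J. a f * X f \<omega>)) t - exp (- (t\<^sup>2) / 2)) \<le> \<bar>t\<bar> ^ 3 * \<eta> + t ^ 4 * \<eta>\<^sup>2"
  proof (rule char_sum_approx_normal)
    show "indep_vars (\<lambda>_. borel) (\<lambda>f \<omega>. a f * X f \<omega>) ?J"
      by (rule indep_vars_compose2[OF indep_vars_subset[OF X_indep J], where Y = "\<lambda>f x. a f * x"]) auto
    show "expectation (\<lambda>\<omega>. a f * X f \<omega>) = 0" if "f \<in> ?J" for f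
      using that J X_mean[of f] by auto
    show "\<bar>a f * X f \<omega>\<bar> \<le> \<eta>" if f: "f \<in> ?J" for f \<omega>
    proof -
      from f obtain j where j: "j < n" "f = {i, j}" by auto
      have "\<bar>a f\<bar> * \<bar>X f \<omega>\<bar> \<le> \<bar>a f\<bar> * 1" using X_bound by (intro mult_left_mono) auto
      also have "\<bar>a f\<bar> * 1 \<le> \<eta>"
        using s' deg_le[OF j(1)] unfolding \<eta>_def j(2) a[OF j(1)] by (simp add: divide_right_mono)
      finally show ?thesis by (simp add: abs_mult)
    qed
    show "\<eta> \<ge> 0" using D_ge_1 s' by (simp add: \<eta>_def)
    have "(\<Sum>f\<in>?J. expectation (\<lambda>\<omega>. (a f * X f \<omega>)\<^sup>2)) = (\<Sum>j<n. expectation (\<lambda>\<omega>. (a {i, j} * X {i, j} \<omega>)\<^sup>2))"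
      by (subst sum.reindex[OF inj]) simp
    also have "\<dots> = (\<Sum>j<n. (real (\<delta> j))\<^sup>2 * expectation (\<lambda>\<omega>. (X {i, j} \<omega>)\<^sup>2) / s1_sq n \<delta> i)"
      using s by (intro sum.cong refl) (simp add: a power_mult_distrib power_divide)
    also have "\<dots> = 1" using s by (simp add: sum_divide_distrib[symmetric] s1_sq_eq[OF i, symmetric])
    finally show "(\<Sum>f\<in>?J. expectation (\<lambda>\<omega>. (a f * X f \<omega>)\<^sup>2)) = 1" .
  qed simp
  then show ?thesis by (simp only: sum_eq)
qed

end

section \<open>Estimates in terms of N, the maximal degree and n\<close>

context chung_lu
begin

definition lin :: "nat \<Rightarrow> 'a \<Rightarrow> real" where "lin i \<omega> = mv n (H \<omega>) e i / lam"

text \<open>The largest demand is 80 * 144 \<kappa>^4 + 4 \<kappa>^2 + 1, from the first-order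
  expansion.\<close>

definition err_const :: real where "err_const = 12000 * \<kappa> ^ 4"

lemma q_le: "q \<le> \<kappa> * (D / real n)"
  using nq_bounds(2) n by (simp add: field_simps)

text \<open>Size conditions that hold for all large n. In \<open>small\<close>, 144 is the square of
  the 12 in \<open>T\<close> and 256 that of 16, so that \<open>16 * T N \<le> lam\<close>; this is
  the spectral gap condition with h = 2 T.\<close>

context
  fixes N :: real
  assumes L4: "ln (real n) \<ge> 4" and NL: "N \<ge> (ln (real n))\<^sup>2"
    and small: "256 * 144 * \<kappa> ^ 3 * N\<^sup>2 \<le> D" and D_sqrt: "D \<le> sqrt n"
begin

lemma N_ge: "N \<ge> 4 * ln (real n)" "N \<ge> 16"
proof -
  have "4 * ln (real n) \<le> ln (real n) * ln (real n)" using L4 by (intro mult_right_mono) auto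
  then show "N \<ge> 4 * ln (real n)" using NL by (simp add: power2_eq_square)
  then show "N \<ge> 16" using L4 by linarith
qed

lemma T_lam_sq: "(T N / lam)\<^sup>2 \<le> 144 * \<kappa> ^ 3 * (N\<^sup>2 / D)"
proof -
  have "(T N / lam)\<^sup>2 = 144 * N\<^sup>2 * (\<kappa> * D) / lam\<^sup>2"
    using D_ge_1 \<kappa> by (simp add: T_def power_divide power_mult_distrib)
  also have "\<dots> \<le> 144 * N\<^sup>2 * (\<kappa> * D) / (D / \<kappa>)\<^sup>2"
    using lam_ge lam_pos D_ge_1 \<kappa> by (intro divide_left_mono power_mono) auto
  also have "\<dots> = 144 * \<kappa> ^ 3 * (N\<^sup>2 / D)"
    using D_ge_1 \<kappa> by (simp add: field_simps power2_eq_square power3_eq_cube)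
  finally show ?thesis .
qed

lemma T_lam: "T N / lam \<le> 1 / 16"
proof -
  have "144 * \<kappa> ^ 3 * (N\<^sup>2 / D) \<le> 1 / 256"
    using small D_ge_1 by (simp add: field_simps)
  with T_lam_sq have "(T N / lam)\<^sup>2 \<le> 1 / 256" by linarith
  also have "1 / 256 = (1 / 16 :: real)\<^sup>2" by (simp add: power2_eq_square)
  finally have "(T N / lam)\<^sup>2 \<le> (1 / 16)\<^sup>2" .
  then show ?thesis by (rule power2_le_imp_le) simp
qed

lemma ratio_le_1: "N\<^sup>2 / D \<le> 1"
proof -
  have "1 \<le> 256 * 144 * \<kappa> ^ 3" using one_le_power[OF \<kappa>, of 3] by linarith
  then have "1 * N\<^sup>2 \<le> 256 * 144 * \<kappa> ^ 3 * N\<^sup>2" by (intro mult_right_mono) auto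
  with small have "N\<^sup>2 \<le> D" by linarith
  then show ?thesis using D_ge_1 by simp
qed

text \<open>Since D \<le> sqrt n, anything of order 1 / n is absorbed in the second-order error N^2
  / (D sqrt n). This serves both the remainder of the expansion and the bad event.\<close>

lemma inverse_n_le: "1 / real n \<le> N\<^sup>2 / D / sqrt n"
proof -
  have "1 * 1 \<le> N * N" using N_ge by (intro mult_mono) auto
  then have N2: "1 \<le> N\<^sup>2" by (simp add: power2_eq_square)
  have "1 / real n = 1 / sqrt n / sqrt n" using n by (simp add: real_div_sqrt divide_divide_eq_left)
  also have "\<dots> \<le> N\<^sup>2 / D / sqrt n"
    using N2 D_sqrt D_ge_1 by (intro divide_right_mono frac_le) auto
  finally show ?thesis .
qed

lemma n_le_pow: "real n \<le> 2 ^ nat \<lfloor>N\<rfloor>"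
proof -
  have F: "real (nat \<lfloor>N\<rfloor>) \<ge> 2 * ln (real n)" using N_ge L4 by linarith
  have ln2: "ln 2 \<ge> (1 / 2 :: real)" using ln_le_minus_one[of "1 / 2"] by (simp add: ln_div)
  have "ln (real n) \<le> real (nat \<lfloor>N\<rfloor>) * (1 / 2)" using F by simp
  also have "\<dots> \<le> real (nat \<lfloor>N\<rfloor>) * ln 2" using ln2 by (intro mult_left_mono) auto
  also have "\<dots> = ln (2 ^ nat \<lfloor>N\<rfloor>)" by (simp add: ln_realpow)
  finally show ?thesis using n by (subst (asm) ln_le_cancel_iff) auto
qed

text \<open>The remainder decays at rate 2 h / lam = 4 T / lam \<le> 1 / 4 < exp (- 1) per step, so
  log n steps bring it to 1 / n. \<open>K\<close> must not exceed N, up to where the good event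
  controls the powers.\<close>

lemma K_props:
  defines "K \<equiv> nat \<lceil>ln (real n)\<rceil>"
  shows "K \<ge> 2" "K \<le> nat \<lfloor>N\<rfloor>" "(4 * T N / lam) ^ K \<le> N\<^sup>2 / D / sqrt n"
proof -
  show "K \<ge> 2" unfolding K_def using L4 by linarith
  show "K \<le> nat \<lfloor>N\<rfloor>" unfolding K_def using N_ge L4 by linarith
  have "exp 1 \<le> (4 :: real)" using exp_le by linarith
  then have e4: "1 / 4 \<le> exp (- 1 :: real)" by (simp add: exp_minus field_simps)
  have "(4 * T N / lam) ^ K \<le> exp (- 1) ^ K"
  proof (rule power_mono)
    have "4 * T N / lam = 4 * (T N / lam)" by simp
    also have "\<dots> \<le> exp (- 1)" using T_lam e4 by linarith
    finally show "4 * T N / lam \<le> exp (- 1)" .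
    show "0 \<le> 4 * T N / lam" using T_pos[of N] N_ge lam_pos by simp
  qed
  also have "\<dots> = exp (- real K)" by (simp add: exp_of_nat_mult[symmetric])
  also have "\<dots> \<le> exp (- ln (real n))" unfolding K_def by simp linarith
  also have "\<dots> = 1 / real n" using n by (simp add: exp_minus field_simps)
  also note inverse_n_le
  finally show "(4 * T N / lam) ^ K \<le> N\<^sup>2 / D / sqrt n" .
qed

lemma summary:
  assumes \<omega>: "\<omega> \<in> good N" and x: "leading_eigenvector n \<delta> (adjacency_matrix n (E \<omega>)) x"
  shows summary_overlap: "\<bar>x \<bullet> degree_vec n \<delta> - 1\<bar> \<le> err_const * (N\<^sup>2 / D)"
    and summary_first_order: "i < n \<Longrightarrow> \<bar>x $ i - e i - lin i \<omega>\<bar> \<le> err_const * (N\<^sup>2 / D / sqrt n)"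
    and summary_linear: "i < n \<Longrightarrow> \<bar>lin i \<omega>\<bar> \<le> err_const * (N / sqrt (real n * D))"
proof -
  define r where "r = N\<^sup>2 / D"
  have r: "r \<ge> 0" using D_ge_1 by (simp add: r_def)
  have N1: "N \<ge> 1" using N_ge by simp
  have gap: "16 * T N \<le> lam" using T_lam lam_pos by (simp add: field_simps)
  note est = good_estimates[OF \<omega> x N1 n_le_pow gap]
  have Tr: "(T N / lam)\<^sup>2 \<le> 144 * \<kappa> ^ 3 * r" using T_lam_sq by (simp add: r_def)
  have k34: "\<kappa> ^ 3 \<le> \<kappa> ^ 4" "\<kappa>\<^sup>2 \<le> \<kappa> ^ 4" "1 \<le> \<kappa> ^ 4" "\<kappa> ^ 3 \<ge> 0"
    using \<kappa> by (auto intro: power_increasing one_le_power)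
  have "8 * (T N / lam)\<^sup>2 \<le> 1152 * \<kappa> ^ 3 * r" using Tr by linarith
  also have "\<dots> \<le> err_const * r" unfolding err_const_def using k34 r by (intro mult_right_mono) linarith+
  finally show "\<bar>x \<bullet> degree_vec n \<delta> - 1\<bar> \<le> err_const * (N\<^sup>2 / D)"
    using est(1) by (simp add: r_def)
  \<comment> \<open>The contribution of the quadratic form, N / D up to \<kappa>, is absorbed in N^2
    / D.\<close>
  have Nlam: "N / lam \<le> \<kappa> * r"
  proof -
    have "N / lam \<le> N / (D / \<kappa>)" using lam_ge lam_pos D_ge_1 \<kappa> N1 by (intro divide_left_mono) auto
    also have "\<dots> = \<kappa> * (N / D)" by simp
    also have "\<dots> \<le> \<kappa> * r"
    proof -
      have "N * 1 \<le> N * N" using N1 by (intro mult_left_mono) auto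
      then show ?thesis unfolding r_def power2_eq_square using \<kappa> D_ge_1 by (intro mult_left_mono divide_right_mono) auto
    qed
    finally show ?thesis .
  qed
  show "\<bar>x $ i - e i - lin i \<omega>\<bar> \<le> err_const * (N\<^sup>2 / D / sqrt n)" if i: "i < n"
  proof -
    have "\<bar>x $ i - e i - lin i \<omega>\<bar> \<le> \<kappa> / sqrt n * (80 * (T N / lam)\<^sup>2 + 4 * (N / lam)) + (4 * T N / lam) ^ nat \<lceil>ln (real n)\<rceil>"
      using est(2)[OF i K_props(1,2)] by (simp add: lin_def)
    also have "\<dots> \<le> \<kappa> / sqrt n * (80 * (144 * \<kappa> ^ 3 * r) + 4 * (\<kappa> * r)) + r / sqrt n"
      using Tr Nlam K_props(3) \<kappa> unfolding r_def[symmetric] by (intro add_mono mult_left_mono) auto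
    also have "\<dots> = (11520 * \<kappa> ^ 4 + 4 * \<kappa>\<^sup>2 + 1) * (r / sqrt n)"
      by (simp add: divide_inverse algebra_simps power2_eq_square power3_eq_cube power4_eq_xxxx)
    also have "\<dots> \<le> err_const * (r / sqrt n)"
      unfolding err_const_def using k34 r by (intro mult_right_mono) auto
    finally show ?thesis by (simp add: r_def)
  qed
  show "\<bar>lin i \<omega>\<bar> \<le> err_const * (N / sqrt (real n * D))" if i: "i < n"
  proof -
    have "(T N / lam)\<^sup>2 \<le> (12 * \<kappa>\<^sup>2 * (N / sqrt D))\<^sup>2"
    proof -
      have "144 * \<kappa> ^ 3 * r \<le> 144 * \<kappa> ^ 4 * r" using k34 r by (intro mult_right_mono) auto
      also have "\<dots> = (12 * \<kappa>\<^sup>2 * (N / sqrt D))\<^sup>2"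
        using D_ge_1 by (simp add: r_def power_mult_distrib power_divide)
      finally show ?thesis using Tr by linarith
    qed
    then have T1: "T N / lam \<le> 12 * \<kappa>\<^sup>2 * (N / sqrt D)"
      by (rule power2_le_imp_le) (use N1 D_ge_1 in auto)
    have "\<bar>lin i \<omega>\<bar> = \<bar>mv n (H \<omega>) e i\<bar> / lam" using lam_pos by (simp add: lin_def)
    also have "\<dots> \<le> (\<kappa> / sqrt n * T N) / lam"
      using est(3)[OF i] lam_pos by (intro divide_right_mono) auto
    also have "\<dots> = \<kappa> / sqrt n * (T N / lam)" by simp
    also have "\<dots> \<le> \<kappa> / sqrt n * (12 * \<kappa>\<^sup>2 * (N / sqrt D))" using T1 \<kappa> by (intro mult_left_mono) auto
    also have "\<dots> = 12 * \<kappa> ^ 3 * (N / sqrt (real n * D))"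
      by (simp add: real_sqrt_mult power3_eq_cube power2_eq_square)
    also have "\<dots> \<le> err_const * (N / sqrt (real n * D))"
      unfolding err_const_def using k34 N1 D_ge_1 by (intro mult_right_mono) auto
    finally show ?thesis .
  qed
qed

text \<open>The linear term has mean zero, so it is subtracted for free and only the second-order
  error remains on the good event. Elsewhere the crude bound of order n meets a probability of at
  most n^(-2).\<close>

lemma expectation_bound:
  fixes x :: "'a \<Rightarrow> real Matrix.vec"
  assumes x: "\<And>\<omega>. \<omega> \<in> space M \<Longrightarrow> leading_eigenvector n \<delta> (adjacency_matrix n (E \<omega>)) (x \<omega>)"
    and i: "i < n" and meas: "(\<lambda>\<omega>. x \<omega> $ i) \<in> borel_measurable M"
    and P: "prob (space M - good N) \<le> exp (- N / 2)"
  shows "\<bar>expectation (\<lambda>\<omega>. x \<omega> $ i) - e i\<bar> \<le> (err_const + 3 * \<kappa>\<^sup>2) * (N\<^sup>2 / sqrt (m 2))"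
proof -
  define \<rho> where "\<rho> = N\<^sup>2 / D / sqrt n"
  have B: "adjacency_matrix n (E \<omega>) \<in> carrier_mat n n" for \<omega> by (simp add: adjacency_matrix_def)
  have x1: "\<bar>x \<omega> $ i\<bar> \<le> 1" if "\<omega> \<in> space M" for \<omega>
    using coord_le_sqrt_ip[OF i, of "($) (x \<omega>)"] leading_eigenvector_unit[OF x[OF that] B] by simp
  have intx: "integrable M (\<lambda>\<omega>. x \<omega> $ i)" using meas x1 by (rule bounded_integrable)
  have intl: "integrable M (lin i)" unfolding lin_def[abs_def] using integrable_mv_H[OF i] by simp
  have El: "expectation (lin i) = 0" unfolding lin_def[abs_def] using expectation_mv_H[OF i] by simp
  have lam1: "lam \<ge> 1 / \<kappa>"
  proof -
    have "1 / \<kappa> \<le> D / \<kappa>" using D_ge_1 \<kappa> by (intro divide_right_mono) auto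
    with lam_ge show ?thesis by linarith
  qed
  have bad: "\<bar>x \<omega> $ i - e i - lin i \<omega>\<bar> \<le> 3 * \<kappa>\<^sup>2 * real n" if "\<omega> \<in> space M" for \<omega>
  proof -
    have "\<bar>lin i \<omega>\<bar> = \<bar>mv n (H \<omega>) e i\<bar> / lam" using lam_pos by (simp add: lin_def)
    also have "\<dots> \<le> (real n * \<kappa>) / (1 / \<kappa>)"
      using abs_mv_H_le lam1 \<kappa> by (intro frac_le) auto
    also have "\<dots> = real n * \<kappa>\<^sup>2" by (simp add: power2_eq_square)
    finally have l: "\<bar>lin i \<omega>\<bar> \<le> real n * \<kappa>\<^sup>2" .
    have n1: "1 \<le> real n" using n by linarith
    have k2: "\<kappa> \<le> \<kappa>\<^sup>2" "1 \<le> \<kappa>\<^sup>2" using \<kappa> self_le_power[of \<kappa> 2] one_le_power[of \<kappa> 2] by auto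
    have "e i \<le> \<kappa> / sqrt n" by (rule e_le[OF i])
    also have "\<dots> \<le> \<kappa> / 1" using n \<kappa> by (intro divide_left_mono) auto
    finally have "\<bar>e i\<bar> \<le> \<kappa>\<^sup>2" using e_nonneg[of i] k2 by simp
    moreover have "\<kappa>\<^sup>2 * 1 \<le> \<kappa>\<^sup>2 * real n" using n1 by (intro mult_left_mono) auto
    ultimately show ?thesis using l x1[OF that] k2 by (simp add: mult.commute)
  qed
  have C0: "err_const \<ge> 0" using \<kappa> by (simp add: err_const_def)
  have \<rho>0: "\<rho> \<ge> 0" using D_ge_1 by (simp add: \<rho>_def)
  have "expectation (\<lambda>\<omega>. x \<omega> $ i) - e i = expectation (\<lambda>\<omega>. x \<omega> $ i - e i - lin i \<omega>)"
    using intx intl El by (simp add: prob_space)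
  also have "\<bar>\<dots>\<bar> \<le> expectation (\<lambda>\<omega>. \<bar>x \<omega> $ i - e i - lin i \<omega>\<bar>)" by (rule integral_abs_bound)
  also have "\<dots> \<le> expectation (\<lambda>\<omega>. err_const * \<rho> + 3 * \<kappa>\<^sup>2 * real n * indicator (space M - good N) \<omega>)"
  proof (rule integral_mono)
    show "integrable M (\<lambda>\<omega>. \<bar>x \<omega> $ i - e i - lin i \<omega>\<bar>)"
      using intx intl by (intro integrable_abs Bochner_Integration.integrable_diff) auto
    show "integrable M (\<lambda>\<omega>. err_const * \<rho> + 3 * \<kappa>\<^sup>2 * real n * indicator (space M - good N) \<omega>)"
      using good_events by (intro Bochner_Integration.integrable_add integrable_mult_right integrable_real_indicator)
        (auto simp: emeasure_eq_measure)
    fix \<omega> assume \<omega>: "\<omega> \<in> space M"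
    show "\<bar>x \<omega> $ i - e i - lin i \<omega>\<bar> \<le> err_const * \<rho> + 3 * \<kappa>\<^sup>2 * real n * indicator (space M - good N) \<omega>"
    proof (cases "\<omega> \<in> good N")
      case True
      then show ?thesis using summary_first_order[OF True x[OF \<omega>] i] by (simp add: \<rho>_def)
    next
      case False
      then show ?thesis using bad[OF \<omega>] \<omega> C0 \<rho>0 by (simp add: add_increasing)
    qed
  qed
  also have "\<dots> = err_const * \<rho> + 3 * \<kappa>\<^sup>2 * (real n * prob (space M - good N))"
    using good_events by (subst Bochner_Integration.integral_add)
      (auto simp: prob_space emeasure_eq_measure intro!: integrable_mult_right integrable_real_indicator)
  also have "\<dots> \<le> err_const * \<rho> + 3 * \<kappa>\<^sup>2 * \<rho>"
  proof (intro add_left_mono mult_left_mono)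
    have "real n * prob (space M - good N) \<le> real n * exp (- (2 * ln (real n)))"
    proof (intro mult_left_mono)
      have "exp (- N / 2) \<le> exp (- (2 * ln (real n)))" using N_ge by simp
      with P show "prob (space M - good N) \<le> exp (- (2 * ln (real n)))" by linarith
    qed auto
    also have "exp (- (2 * ln (real n))) = exp (- ln (real n)) * exp (- ln (real n))" by (simp flip: exp_add)
    also have "real n * (exp (- ln (real n)) * exp (- ln (real n))) = 1 / real n"
      using n by (simp add: exp_minus field_simps)
    also have "\<dots> \<le> \<rho>" unfolding \<rho>_def by (rule inverse_n_le)
    finally show "real n * prob (space M - good N) \<le> \<rho>" .
  qed auto
  also have "\<dots> = (err_const + 3 * \<kappa>\<^sup>2) * \<rho>" by (simp add: distrib_right)
  also have "\<dots> \<le> (err_const + 3 * \<kappa>\<^sup>2) * (N\<^sup>2 / sqrt (m 2))"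
  proof (intro mult_left_mono)
    \<comment> \<open>The error in (III) is measured against sqrt (m 2), which is at most D sqrt
      n.\<close>
    have "sqrt (m 2) \<le> sqrt (real n * D\<^sup>2)" by (intro real_sqrt_le_mono moment_le)
    also have "\<dots> = D * sqrt n" using D_ge_1 by (simp add: real_sqrt_mult)
    finally show "\<rho> \<le> N\<^sup>2 / sqrt (m 2)"
      unfolding \<rho>_def divide_divide_eq_left
      by (intro divide_left_mono) (use moment_pos[of 2] n D_ge_1 in \<open>auto intro!: mult_pos_pos\<close>)
  qed (use C0 in auto)
  finally show ?thesis .
qed

end

section \<open>The variance and the normal approximation at fixed n\<close>

lemma s1_sq_le: "i < n \<Longrightarrow> s1_sq n \<delta> i \<le> real (\<delta> i) * (m 3 / m 1)"
  and s1_sq_ge: "i < n \<Longrightarrow> (1 - q) * (real (\<delta> i) * (m 3 / m 1)) \<le> s1_sq n \<delta> i"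
proof -
  assume i: "i < n"
  have eq: "real (\<delta> i) * (m 3 / m 1) = (\<Sum>j<n. (real (\<delta> j))\<^sup>2 * edge_prob n \<delta> i j)"
    unfolding edge_prob_def deg_moment_def[of 3] sum_divide_distrib sum_distrib_left
    by (intro sum.cong refl) (simp add: power2_eq_square power3_eq_cube)
  show "s1_sq n \<delta> i \<le> real (\<delta> i) * (m 3 / m 1)"
    unfolding eq s1_sq_def using edge_prob_nonneg
    by (intro sum_mono mult_left_le) auto
  show "(1 - q) * (real (\<delta> i) * (m 3 / m 1)) \<le> s1_sq n \<delta> i"
    unfolding eq s1_sq_def sum_distrib_left
  proof (intro sum_mono)
    fix j assume "j \<in> {..<n}"
    then have "edge_prob n \<delta> i j \<le> q" using edge_prob_le i by simp
    then have "(real (\<delta> j))\<^sup>2 * edge_prob n \<delta> i j * (1 - q) \<le> (real (\<delta> j))\<^sup>2 * edge_prob n \<delta> i j * (1 - edge_prob n \<delta> i j)"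
      using edge_prob_nonneg by (intro mult_left_mono) auto
    then show "(1 - q) * ((real (\<delta> j))\<^sup>2 * edge_prob n \<delta> i j) \<le> (real (\<delta> j))\<^sup>2 * edge_prob n \<delta> i j * (1 - edge_prob n \<delta> i j)"
      by (simp only: mult.commute)
  qed
qed

lemma weighted_degree_ge: "i < n \<Longrightarrow> (D / \<kappa>) ^ 3 \<le> real (\<delta> i) * (m 3 / m 1)"
proof -
  assume i: "i < n"
  have Dk: "D / \<kappa> \<ge> 0" using D_ge_1 \<kappa> by simp
  have "D / \<kappa> * (D / \<kappa> * m 1) \<le> D / \<kappa> * m 2"
    using moment_Suc_ge[of 1] Dk by (intro mult_left_mono) (simp_all add: numeral_2_eq_2)
  also have "\<dots> \<le> m 3" using moment_Suc_ge[of 2] by (simp add: numeral_3_eq_3)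
  finally have "(D / \<kappa>)\<^sup>2 \<le> m 3 / m 1"
    using moment_pos[of 1] by (simp add: le_divide_eq power2_eq_square)
  then have "D / \<kappa> * (D / \<kappa>)\<^sup>2 \<le> real (\<delta> i) * (m 3 / m 1)"
    using deg_ge[OF i] Dk by (intro mult_mono) auto
  then show ?thesis by (simp add: power3_eq_cube power2_eq_square)
qed

lemma s1_sq_lower: "i < n \<Longrightarrow> q \<le> 1 / 2 \<Longrightarrow> D ^ 3 / (2 * \<kappa> ^ 3) \<le> s1_sq n \<delta> i"
proof -
  assume i: "i < n" and q: "q \<le> 1 / 2"
  have "D ^ 3 / (2 * \<kappa> ^ 3) = 1 / 2 * (D / \<kappa>) ^ 3" by (simp add: power_divide)
  also have "\<dots> \<le> (1 - q) * (real (\<delta> i) * (m 3 / m 1))"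
    using q weighted_degree_ge[OF i] D_ge_1 \<kappa> by (intro mult_mono) auto
  also have "\<dots> \<le> s1_sq n \<delta> i" by (rule s1_sq_ge[OF i])
  finally show ?thesis .
qed

text \<open>Three sources of error: replacing the eigenvector by its linear term on the good event,
  the bad event, and the normal approximation of the linear term. The normalization is at most of
  order sqrt (n D), which turns the expansion error N^2 / (D sqrt n) into sqrt (N^4 / D).\<close>

lemma char_normalized_bound:
  fixes x :: "'a \<Rightarrow> real Matrix.vec"
  assumes N: "ln (real n) \<ge> 4" "N \<ge> (ln (real n))\<^sup>2" "256 * 144 * \<kappa> ^ 3 * N\<^sup>2 \<le> D" "D \<le> sqrt n"
    and x: "\<And>\<omega>. \<omega> \<in> space M \<Longrightarrow> leading_eigenvector n \<delta> (adjacency_matrix n (E \<omega>)) (x \<omega>)"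
    and i: "i < n" and meas: "(\<lambda>\<omega>. x \<omega> $ i) \<in> borel_measurable M"
    and P: "prob (space M - good N) \<le> exp (- N / 2)" and q: "q \<le> 1 / 2"
  shows "cmod (char (distr M borel (\<lambda>\<omega>. m 2 powr (3 / 2) / m 1 * ((x \<omega> $ i - e i) / sqrt (s1_sq n \<delta> i)))) t
      - exp (- (t\<^sup>2) / 2))
    \<le> \<bar>t\<bar> * (err_const * sqrt (2 * \<kappa> ^ 3) * sqrt (N ^ 4 / D)) + 2 * exp (- N / 2)
      + \<bar>t\<bar> ^ 3 * sqrt (2 * \<kappa> ^ 3 * (N\<^sup>2 / D)) + t ^ 4 * (2 * \<kappa> ^ 3 * (N\<^sup>2 / D))"
proof -
  define s where "s = s1_sq n \<delta> i"
  define c where "c = m 2 powr (3 / 2) / m 1"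
  define \<epsilon> where "\<epsilon> = err_const * sqrt (2 * \<kappa> ^ 3) * sqrt (N ^ 4 / D)"
  define Y where "Y \<omega> = c * ((x \<omega> $ i - e i) / sqrt s)" for \<omega>
  define Z where "Z \<omega> = c * (lin i \<omega> / sqrt s)" for \<omega>
  have D0: "D > 0" "D \<ge> 0" using D_ge_1 by auto
  have \<kappa>0: "\<kappa> > 0" using \<kappa> by simp
  have s_ge: "D ^ 3 / (2 * \<kappa> ^ 3) \<le> s" unfolding s_def by (rule s1_sq_lower[OF i q])
  moreover have "D ^ 3 / (2 * \<kappa> ^ 3) > 0" using D0 \<kappa>0 by simp
  ultimately have s0: "s > 0" by linarith
  have Y: "Y \<in> borel_measurable M" unfolding Y_def using meas by measurable
  have Z: "Z \<in> borel_measurable M"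
    unfolding Z_def lin_def using mv_pow_H_measurable[OF i, of 1 e]
    by (intro borel_measurable_times borel_measurable_divide) auto
  have c0: "c \<ge> 0" unfolding c_def using moment_pos[of 1] by simp
  have c_le: "c / sqrt s \<le> sqrt n * sqrt (2 * \<kappa> ^ 3) * sqrt D"
  proof -
    have "m 2 powr (3 / 2) = m 2 * sqrt (m 2)"
      using moment_pos[of 2] powr_add[of "m 2" 1 "1 / 2"] by (simp add: powr_half_sqrt)
    then have "c = lam * sqrt (m 2)" by (simp add: c_def lam_def)
    also have "\<dots> \<le> D * sqrt (real n * D\<^sup>2)"
      using lam_le lam_pos moment_pos[of 2] moment_le[of 2] D0 by (intro mult_mono real_sqrt_le_mono) auto
    also have "\<dots> = sqrt n * D\<^sup>2" using D0 by (simp add: real_sqrt_mult power2_eq_square)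
    finally have "c / sqrt s \<le> sqrt n * D\<^sup>2 / sqrt (D ^ 3 / (2 * \<kappa> ^ 3))"
      using s_ge D0 \<kappa>0 by (intro frac_le real_sqrt_le_mono) auto
    also have "D\<^sup>2 = sqrt (D ^ 3) * sqrt D"
    proof -
      have "sqrt (D ^ 3) * sqrt D = sqrt ((D\<^sup>2)\<^sup>2)"
        by (simp only: real_sqrt_mult[symmetric]) (simp add: power2_eq_square power3_eq_cube mult_ac)
      then show ?thesis by (simp only: real_sqrt_abs abs_power2)
    qed
    also have "sqrt n * (sqrt (D ^ 3) * sqrt D) / sqrt (D ^ 3 / (2 * \<kappa> ^ 3)) = sqrt n * sqrt (2 * \<kappa> ^ 3) * sqrt D"
      using D0 by (simp add: real_sqrt_divide)
    finally show ?thesis .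
  qed
  have C0: "err_const \<ge> 0" using \<kappa>0 by (simp add: err_const_def)
  have close: "\<bar>Y \<omega> - Z \<omega>\<bar> \<le> \<epsilon>" if \<omega>: "\<omega> \<in> good N" for \<omega>
  proof -
    have "\<omega> \<in> space M" using \<omega> by (simp add: good_def)
    note fo = summary_first_order[OF N \<omega> x[OF this] i]
    have "Y \<omega> - Z \<omega> = c / sqrt s * (x \<omega> $ i - e i - lin i \<omega>)"
      by (simp add: Y_def Z_def right_diff_distrib diff_divide_distrib)
    then have "\<bar>Y \<omega> - Z \<omega>\<bar> = c / sqrt s * \<bar>x \<omega> $ i - e i - lin i \<omega>\<bar>"
      using c0 s0 by (simp add: abs_mult)
    also have "\<dots> \<le> (sqrt n * sqrt (2 * \<kappa> ^ 3) * sqrt D) * (err_const * (N\<^sup>2 / D / sqrt n))"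
      using c_le fo \<kappa>0 D0 by (intro mult_mono) auto
    also have "\<dots> = err_const * sqrt (2 * \<kappa> ^ 3) * (N\<^sup>2 * (sqrt D / D))"
      using n by simp
    also have "sqrt D / D = 1 / sqrt D" using D0 by (simp add: real_div_sqrt field_simps)
    also have "N\<^sup>2 * (1 / sqrt D) = sqrt (N ^ 4 / D)"
    proof -
      have "N ^ 4 = (N\<^sup>2)\<^sup>2" by simp
      then have "sqrt (N ^ 4 / D) = \<bar>N\<^sup>2\<bar> / sqrt D" by (simp only: real_sqrt_divide real_sqrt_abs)
      then show ?thesis by simp
    qed
    finally show ?thesis by (simp add: \<epsilon>_def)
  qed
  have "cmod (char (distr M borel Y) t - char (distr M borel Z) t) \<le> \<bar>t\<bar> * \<epsilon> + 2 * prob (space M - good N)"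
    using D0 \<kappa>0 C0 by (intro char_perturbation Y Z good_events close) (auto simp: \<epsilon>_def)
  then have 1: "cmod (char (distr M borel Y) t - char (distr M borel Z) t) \<le> \<bar>t\<bar> * \<epsilon> + 2 * exp (- N / 2)"
    using P by linarith
  have \<eta>: "(D / sqrt s)\<^sup>2 \<le> 2 * \<kappa> ^ 3 * (N\<^sup>2 / D)"
  proof -
    have "(D / sqrt s)\<^sup>2 = D\<^sup>2 / s" using s0 by (simp add: power_divide)
    also have "\<dots> \<le> D\<^sup>2 / (D ^ 3 / (2 * \<kappa> ^ 3))" using s_ge s0 D0 \<kappa>0 by (intro divide_left_mono) auto
    also have "\<dots> = 2 * \<kappa> ^ 3 * (1 / D)" using D0 by (simp add: power2_eq_square power3_eq_cube)
    also have "\<dots> \<le> 2 * \<kappa> ^ 3 * (N\<^sup>2 / D)"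
    proof (intro mult_left_mono divide_right_mono)
      have "1 * 1 \<le> N * N" using N_ge[OF N] by (intro mult_mono) auto
      then show "1 \<le> N\<^sup>2" by (simp add: power2_eq_square)
    qed (use \<kappa>0 D0 in auto)
    finally show ?thesis .
  qed
  have \<eta>1: "D / sqrt s \<le> sqrt (2 * \<kappa> ^ 3 * (N\<^sup>2 / D))"
    using \<eta> by (rule real_le_rsqrt)
  have Zeq: "Z = (\<lambda>\<omega>. m 2 powr (3 / 2) / m 1 * (mv n (H \<omega>) e i / lam / sqrt (s1_sq n \<delta> i)))"
    by (simp add: Z_def c_def lin_def s_def fun_eq_iff)
  have "cmod (char (distr M borel Z) t - exp (- (t\<^sup>2) / 2)) \<le> \<bar>t\<bar> ^ 3 * (D / sqrt s) + t ^ 4 * (D / sqrt s)\<^sup>2"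
    unfolding Zeq s_def using s0 by (intro char_linear_term i) (simp add: s_def)
  also have "\<dots> \<le> \<bar>t\<bar> ^ 3 * sqrt (2 * \<kappa> ^ 3 * (N\<^sup>2 / D)) + t ^ 4 * (2 * \<kappa> ^ 3 * (N\<^sup>2 / D))"
    using \<eta> \<eta>1 by (intro add_mono mult_left_mono) auto
  finally have 2: "cmod (char (distr M borel Z) t - exp (- (t\<^sup>2) / 2))
      \<le> \<bar>t\<bar> ^ 3 * sqrt (2 * \<kappa> ^ 3 * (N\<^sup>2 / D)) + t ^ 4 * (2 * \<kappa> ^ 3 * (N\<^sup>2 / D))" .
  have "cmod (char (distr M borel Y) t - exp (- (t\<^sup>2) / 2)) \<le>
      (\<bar>t\<bar> * \<epsilon> + 2 * exp (- N / 2)) + (\<bar>t\<bar> ^ 3 * sqrt (2 * \<kappa> ^ 3 * (N\<^sup>2 / D)) + t ^ 4 * (2 * \<kappa> ^ 3 * (N\<^sup>2 / D)))"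
    using norm_triangle_mono[OF 1 2] by simp
  then show ?thesis unfolding \<epsilon>_def Y_def[abs_def] c_def s_def by (simp only: add.assoc)
qed

end

section \<open>Sequences of Chung-Lu graphs\<close>

lemma linf_norm_vec_le_iff:
  assumes "dim_vec x = n" "n > 0"
  shows "linf_norm_vec x \<le> b \<longleftrightarrow> (\<forall>i<n. \<bar>x $ i\<bar> \<le> b)"
proof -
  have "(\<lambda>i. \<bar>x $ i\<bar>) ` {..<n} \<noteq> {}" using assms by auto
  then show ?thesis using assms by (auto simp: linf_norm_vec_def)
qed

text \<open>\<open>levy_continuity\<close> asks for a distribution at every index, while here this
  holds only eventually. The exceptional members are replaced by the limit law, which does not
  affect convergence.\<close>

lemma weak_conv_m_charI:
  assumes ev: "\<forall>\<^sub>F n in sequentially. real_distribution (\<mu> n)" and \<nu>: "real_distribution \<nu>"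
    and lim: "\<And>t. (\<lambda>n. char (\<mu> n) t) \<longlonglongrightarrow> char \<nu> t"
  shows "weak_conv_m \<mu> \<nu>"
proof -
  define \<mu>' where "\<mu>' n = (if real_distribution (\<mu> n) then \<mu> n else \<nu>)" for n
  have eq: "\<forall>\<^sub>F n in sequentially. \<mu>' n = \<mu> n" using ev by eventually_elim (simp add: \<mu>'_def)
  have "weak_conv_m \<mu>' \<nu>"
  proof (rule levy_continuity)
    show "real_distribution (\<mu>' n)" for n using \<nu> by (simp add: \<mu>'_def)
    show "(\<lambda>n. char (\<mu>' n) t) \<longlonglongrightarrow> char \<nu> t" for t
    proof (rule Lim_transform_eventually[OF lim])
      show "\<forall>\<^sub>F n in sequentially. char (\<mu> n) t = char (\<mu>' n) t" using eq by eventually_elim simp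
    qed
  qed (rule \<nu>)
  then have conv: "isCont (cdf \<nu>) x \<Longrightarrow> (\<lambda>n. cdf (\<mu>' n) x) \<longlonglongrightarrow> cdf \<nu> x" for x
    by (simp add: weak_conv_m_def weak_conv_def)
  have "(\<lambda>n. cdf (\<mu> n) x) \<longlonglongrightarrow> cdf \<nu> x" if "isCont (cdf \<nu>) x" for x
  proof (rule Lim_transform_eventually[OF conv[OF that]])
    show "\<forall>\<^sub>F n in sequentially. cdf (\<mu>' n) x = cdf (\<mu> n) x" using eq by eventually_elim simp
  qed
  then show ?thesis by (simp add: weak_conv_m_def weak_conv_def)
qed

text \<open>The factor exp (N / 2) stands for n^2, which leaves an asymptotic inequality in the
  single variable N.\<close>

lemma eventually_bad_prob_le:
  fixes \<kappa> :: real
  assumes "\<kappa> \<ge> 1"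
  shows "\<forall>\<^sub>F N in at_top. 6 * N\<^sup>2 * exp (N / 2) * exp (- 2 * N) + 2 * exp (- N\<^sup>2 / (8 * \<kappa> ^ 4)) \<le> exp (- N / 2)"
proof -
  define c where "c = 1 / (8 * \<kappa> ^ 4)"
  have "c > 0" using assms by (simp add: c_def)
  then have "\<forall>\<^sub>F N in at_top. 6 * N\<^sup>2 * exp (N / 2) * exp (- 2 * N) + 2 * exp (- N\<^sup>2 * c) \<le> exp (- N / 2)"
    by real_asymp
  then show ?thesis by (simp add: c_def)
qed

locale chung_lu_sequence =
  fixes M :: "nat \<Rightarrow> 'a measure" and d :: "nat \<Rightarrow> nat \<Rightarrow> nat" and E :: "nat \<Rightarrow> 'a \<Rightarrow> nat set set"
    and v :: "nat \<Rightarrow> 'a \<Rightarrow> real Matrix.vec" and \<xi> \<kappa> :: real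
  assumes d_pos: "\<And>n i. i < n \<Longrightarrow> d n i > 0"
    and xi: "\<xi> > 2"
    and D1_lower: "(\<lambda>n. ln (real n) powr (2 * \<xi>)) \<in> o(\<lambda>n. max_deg n (d n))"
    and D1_upper: "(\<lambda>n. max_deg n (d n)) \<in> o(\<lambda>n. real n powr (1/2))"
    and \<kappa>: "\<kappa> \<ge> 1" and ratio: "\<forall>\<^sub>F n in sequentially. max_deg n (d n) \<le> \<kappa> * min_deg n (d n)"
    and graph: "\<forall>\<^sub>F n in sequentially. chung_lu_graph (M n) n (d n) (E n)"
    and eigvec: "\<forall>\<^sub>F n in sequentially. leading_eigenvector_choice (M n) n (d n) (E n) (v n)"
begin

abbreviation D :: "nat \<Rightarrow> real" where "D n \<equiv> max_deg n (d n)"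

text \<open>Chosen so that the second-order quantity N^2 / D tends to 0 precisely by the lower bound
  in (D1).\<close>

definition N :: "nat \<Rightarrow> real" where "N n = ln (real n) powr \<xi>"

abbreviation good :: "nat \<Rightarrow> 'a set" where "good n \<equiv> chung_lu.good n (d n) \<kappa> (M n) (E n) (N n)"

abbreviation C :: real where "C \<equiv> chung_lu.err_const \<kappa>"

lemma N_sq: "(N n)\<^sup>2 = ln (real n) powr (2 * \<xi>)"
  by (simp add: N_def power2_eq_square powr_add[symmetric])

lemma N_pow4: "(N n) ^ 4 = ln (real n) powr (4 * \<xi>)"
  by (simp add: N_def power4_eq_xxxx powr_add[symmetric])

lemma N_at_top: "filterlim N at_top sequentially"
  unfolding N_def using xi by real_asymp

lemma ratio_lim: "(\<lambda>n. (N n)\<^sup>2 / D n) \<longlonglongrightarrow> 0"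
  using smalloD_tendsto[OF D1_lower] by (simp add: N_sq)

text \<open>Collects what holds for all large n, so that the lemmas below argue at one fixed
  n.\<close>

definition regular :: "nat \<Rightarrow> bool" where
  "regular n \<longleftrightarrow> chung_lu n (d n) \<kappa> (M n) (E n) \<and> leading_eigenvector_choice (M n) n (d n) (E n) (v n) \<and>
     ln (real n) \<ge> 4 \<and> N n \<ge> (ln (real n))\<^sup>2 \<and> 256 * 144 * \<kappa> ^ 3 * (N n)\<^sup>2 \<le> D n \<and> D n \<le> sqrt n \<and>
     measure (M n) (space (M n) - good n) \<le> exp (- N n / 2) \<and> \<kappa> / sqrt n \<le> 1 / 2"

lemma eventually_regular: "eventually regular sequentially"
proof -
  have 1: "\<forall>\<^sub>F n in sequentially. ln (real n) \<ge> 4" by real_asymp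
  have 2: "\<forall>\<^sub>F n in sequentially. \<bar>D n\<bar> \<le> 1 * \<bar>real n powr (1 / 2)\<bar>"
    using landau_o.smallD[OF D1_upper, of 1] by simp
  have 3: "\<forall>\<^sub>F n in sequentially. \<bar>ln (real n) powr (2 * \<xi>)\<bar> \<le> 1 / (256 * 144 * \<kappa> ^ 3) * \<bar>D n\<bar>"
    using landau_o.smallD[OF D1_lower, of "1 / (256 * 144 * \<kappa> ^ 3)"] \<kappa> by simp
  have 4: "\<forall>\<^sub>F n in sequentially. 2 * \<kappa> \<le> sqrt (real n)" using \<kappa> by real_asymp
  have 5: "\<forall>\<^sub>F n in sequentially. 6 * (N n)\<^sup>2 * exp (N n / 2) * exp (- 2 * N n) + 2 * exp (- (N n)\<^sup>2 / (8 * \<kappa> ^ 4)) \<le> exp (- N n / 2)"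
    using N_at_top eventually_bad_prob_le[OF \<kappa>] by (rule eventually_compose_filterlim[rotated])
  show ?thesis
    using 1 2 3 4 5 ratio graph eigvec
  proof eventually_elim
    case (elim n)
    have L: "ln (real n) \<ge> 4" by fact
    \<comment> \<open>The case n = 0 is excluded by the default value of \<open>ln\<close> at
      0.\<close>
    then have n: "n > 0" by (cases n) auto
    have D0: "D n \<ge> 0" by (simp add: max_deg_def)
    have Dn: "D n \<le> sqrt n" using elim(2) D0 by (simp add: powr_half_sqrt)
    have N2: "256 * 144 * \<kappa> ^ 3 * (N n)\<^sup>2 \<le> D n" using elim(3) D0 \<kappa> by (simp add: N_sq field_simps)
    have "\<kappa> * D n \<le> sqrt n * sqrt n" using elim(4) Dn D0 \<kappa> by (intro mult_mono) auto
    then interpret G: chung_lu n "d n" \<kappa> "M n" "E n"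
      using n d_pos \<kappa> elim(6,7) by unfold_locales auto
    \<comment> \<open>Here \<xi> > 2 yields N \<ge> (ln n)^2, hence N \<ge> 4 ln n and n^2 \<le> exp
      (N / 2): the union bounds over n^2 events become affordable.\<close>
    have "ln (real n) powr 2 \<le> N n" unfolding N_def using L xi by (intro powr_mono) auto
    then have NL: "(ln (real n))\<^sup>2 \<le> N n" using L by (simp add: powr_numeral)
    note N_ge = G.N_ge[OF L NL N2 Dn]
    have "measure (M n) (space (M n) - good n) \<le> 6 * (real n)\<^sup>2 * (N n)\<^sup>2 * exp (- 2 * N n) + 2 * exp (- (N n)\<^sup>2 / (8 * \<kappa> ^ 4))"
      using N_ge by (intro G.prob_not_good) auto
    also have "6 * (real n)\<^sup>2 * (N n)\<^sup>2 * exp (- 2 * N n) \<le> 6 * exp (N n / 2) * (N n)\<^sup>2 * exp (- 2 * N n)"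
    proof (intro mult_right_mono mult_left_mono)
      have "(real n)\<^sup>2 = exp (2 * ln (real n))" using n by (simp add: exp_double)
      also have "\<dots> \<le> exp (N n / 2)" using N_ge by simp
      finally show "(real n)\<^sup>2 \<le> exp (N n / 2)" .
    qed auto
    also have "6 * exp (N n / 2) * (N n)\<^sup>2 * exp (- 2 * N n) + 2 * exp (- (N n)\<^sup>2 / (8 * \<kappa> ^ 4)) \<le> exp (- N n / 2)"
      using elim(5) by (simp only: mult_ac)
    finally have "measure (M n) (space (M n) - good n) \<le> exp (- N n / 2)" by simp
    moreover have "\<kappa> / sqrt n \<le> 1 / 2" using elim(4) n by (simp add: field_simps)
    ultimately show ?case
      unfolding regular_def using L NL N2 Dn elim(8) G.chung_lu_axioms by simp
  qed
qed

lemma regularD: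
  assumes "regular n"
  shows "chung_lu n (d n) \<kappa> (M n) (E n)"
    and "ln (real n) \<ge> 4" "N n \<ge> (ln (real n))\<^sup>2" "256 * 144 * \<kappa> ^ 3 * (N n)\<^sup>2 \<le> D n" "D n \<le> sqrt n"
    and "measure (M n) (space (M n) - good n) \<le> exp (- N n / 2)" "\<kappa> / sqrt n \<le> 1 / 2"
    and "\<And>\<omega>. \<omega> \<in> space (M n) \<Longrightarrow> leading_eigenvector n (d n) (adjacency_matrix n (E n \<omega>)) (v n \<omega>)"
    and "\<And>i. i < n \<Longrightarrow> (\<lambda>\<omega>. v n \<omega> $ i) \<in> borel_measurable (M n)"
  using assms by (auto simp: regular_def leading_eigenvector_choice_def)

lemma regular_q_le:
  assumes n: "regular n"
  shows "balanced_degrees.q n (d n) \<le> \<kappa> / sqrt n"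
proof -
  interpret G: chung_lu n "d n" \<kappa> "M n" "E n" by (rule regularD(1)[OF n])
  have "G.q \<le> \<kappa> * (D n / real n)" by (rule G.q_le)
  also have "\<dots> \<le> \<kappa> * (sqrt n / real n)"
    using regularD(5)[OF n] \<kappa> by (intro mult_left_mono divide_right_mono) auto
  also have "\<dots> = \<kappa> / sqrt n" using G.n by (simp add: real_div_sqrt field_simps)
  finally show ?thesis .
qed

text \<open>The witnesses are \<xi> itself and 1 / 2, since the bad event has probability at most
  exp (- N / 2).\<close>

lemma whpI:
  assumes meas: "\<And>n. regular n \<Longrightarrow> {\<omega> \<in> space (M n). P n \<omega>} \<in> sets (M n)"
    and good: "\<And>n \<omega>. regular n \<Longrightarrow> \<omega> \<in> good n \<Longrightarrow> P n \<omega>"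
  shows "whp M P"
  unfolding whp_def
proof (rule exI[of _ \<xi>], rule exI[of _ "1 / 2"], intro conjI)
  show "\<forall>\<^sub>F n in sequentially. {\<omega> \<in> space (M n). P n \<omega>} \<in> sets (M n) \<and>
      measure (M n) {\<omega> \<in> space (M n). \<not> P n \<omega>} \<le> exp (- (1 / 2) * ln (real n) powr \<xi>)"
    using eventually_regular
  proof eventually_elim
    case (elim n)
    interpret G: chung_lu n "d n" \<kappa> "M n" "E n" by (rule regularD(1)[OF elim])
    have "measure (M n) {\<omega> \<in> space (M n). \<not> P n \<omega>} \<le> measure (M n) (space (M n) - good n)"
      using good[OF elim] G.good_events by (intro G.finite_measure_mono) auto
    also have "\<dots> \<le> exp (- N n / 2)" by (rule regularD(6)[OF elim])
    finally show ?case using meas[OF elim] by (simp add: N_def)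
  qed
qed (use xi in auto)

lemma overlap_whp: "whp M (\<lambda>n \<omega>. \<bar>v n \<omega> \<bullet> degree_vec n (d n) - 1\<bar> \<le> C * ((N n)\<^sup>2 / D n))"
proof (rule whpI)
  fix n assume n: "regular n"
  interpret G: chung_lu n "d n" \<kappa> "M n" "E n" by (rule regularD(1)[OF n])
  have "(\<lambda>\<omega>. v n \<omega> \<bullet> degree_vec n (d n)) \<in> borel_measurable (M n)"
    unfolding scalar_prod_def
    by (intro borel_measurable_sum borel_measurable_times borel_measurable_const regularD(9)[OF n])
      (simp add: degree_vec_def)
  then show "{\<omega> \<in> space (M n). \<bar>v n \<omega> \<bullet> degree_vec n (d n) - 1\<bar> \<le> C * ((N n)\<^sup>2 / D n)} \<in> sets (M n)"
    by measurable
  fix \<omega> assume \<omega>: "\<omega> \<in> good n"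
  then have "\<omega> \<in> space (M n)" by (simp add: G.good_def)
  then show "\<bar>v n \<omega> \<bullet> degree_vec n (d n) - 1\<bar> \<le> C * ((N n)\<^sup>2 / D n)"
    using G.summary_overlap[OF regularD(2-5)[OF n] \<omega> regularD(8)[OF n]] by simp
qed

lemma sup_norm_whp: "whp M (\<lambda>n \<omega>. linf_norm_vec (v n \<omega> - degree_vec n (d n))
    \<le> 2 * C * (ln (real n) powr \<xi> / sqrt (real n * D n)))"
proof (rule whpI)
  fix n assume n: "regular n"
  interpret G: chung_lu n "d n" \<kappa> "M n" "E n" by (rule regularD(1)[OF n])
  let ?b = "2 * C * (ln (real n) powr \<xi> / sqrt (real n * D n))"
  have iff: "linf_norm_vec (v n \<omega> - degree_vec n (d n)) \<le> ?b \<longleftrightarrow> (\<forall>i<n. \<bar>v n \<omega> $ i - G.e i\<bar> \<le> ?b)" for \<omega>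
    using G.n by (subst linf_norm_vec_le_iff[of _ n]) (auto simp: degree_vec_def G.e_def)
  \<comment> \<open>Measurability of the sup norm event: it is a finite intersection of coordinate
    events.\<close>
  have "{\<omega> \<in> space (M n). \<forall>i\<in>{..<n}. \<bar>v n \<omega> $ i - G.e i\<bar> \<le> ?b} \<in> sets (M n)"
  proof (rule sets.sets_Collect_finite_All')
    show "{\<omega> \<in> space (M n). \<bar>v n \<omega> $ i - G.e i\<bar> \<le> ?b} \<in> sets (M n)" if "i \<in> {..<n}" for i
    proof -
      have "(\<lambda>\<omega>. v n \<omega> $ i) \<in> borel_measurable (M n)" using regularD(9)[OF n] that by simp
      then show ?thesis by measurable
    qed
  qed (use G.n in auto)
  then show "{\<omega> \<in> space (M n). linf_norm_vec (v n \<omega> - degree_vec n (d n)) \<le> ?b} \<in> sets (M n)"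
    unfolding iff by (simp only: Ball_def lessThan_iff)
  fix \<omega> assume \<omega>: "\<omega> \<in> good n"
  then have \<omega>': "\<omega> \<in> space (M n)" by (simp add: G.good_def)
  note est = regularD(2-5)[OF n]
  note N_ge = G.N_ge[OF est]
  have C0: "C \<ge> 0" using \<kappa> by (simp add: G.err_const_def)
  \<comment> \<open>As N / sqrt D \<le> 1, the second-order error is dominated by the bound on the
    linear term, so the latter sets the rate in (II).\<close>
  have sq: "(N n)\<^sup>2 / D n / sqrt n \<le> N n / sqrt (real n * D n)"
  proof -
    have "(N n / sqrt (D n))\<^sup>2 \<le> 1\<^sup>2"
      using G.ratio_le_1[OF est] G.D_ge_1 by (simp add: power_divide)
    then have "N n / sqrt (D n) \<le> 1" by (rule power2_le_imp_le) simp
    then have "N n / sqrt (D n) * (N n / sqrt (real n * D n)) \<le> 1 * (N n / sqrt (real n * D n))"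
      using N_ge G.D_ge_1 by (intro mult_right_mono) auto
    then show ?thesis using G.D_ge_1 by (simp add: real_sqrt_mult power2_eq_square mult_ac)
  qed
  show "linf_norm_vec (v n \<omega> - degree_vec n (d n)) \<le> ?b"
    unfolding iff
  proof (intro allI impI)
    fix i assume i: "i < n"
    have "\<bar>v n \<omega> $ i - G.e i\<bar> \<le> \<bar>v n \<omega> $ i - G.e i - G.lin i \<omega>\<bar> + \<bar>G.lin i \<omega>\<bar>" by linarith
    also have "\<dots> \<le> C * ((N n)\<^sup>2 / D n / sqrt n) + C * (N n / sqrt (real n * D n))"
      by (intro add_mono G.summary_first_order[OF est \<omega> regularD(8)[OF n \<omega>'] i]
          G.summary_linear[OF est \<omega> regularD(8)[OF n \<omega>'] i])
    also have "\<dots> \<le> C * (N n / sqrt (real n * D n)) + C * (N n / sqrt (real n * D n))"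
      using C0 sq by (intro add_mono mult_left_mono) auto
    finally show "\<bar>v n \<omega> $ i - G.e i\<bar> \<le> ?b" by (simp add: N_def)
  qed
qed

lemma expectation_bigo:
  assumes i: "\<forall>\<^sub>F n in sequentially. i n < n"
  shows "(\<lambda>n. (\<integral>\<omega>. v n \<omega> $ i n \<partial>M n) - real (d n (i n)) / sqrt (deg_moment 2 n (d n)))
          \<in> O(\<lambda>n. ln (real n) powr (2 * \<xi>) / sqrt (deg_moment 2 n (d n)))"
proof (rule bigoI[where c = "C + 3 * \<kappa>\<^sup>2"])
  show "\<forall>\<^sub>F n in sequentially. norm ((\<integral>\<omega>. v n \<omega> $ i n \<partial>M n) - real (d n (i n)) / sqrt (deg_moment 2 n (d n)))
      \<le> (C + 3 * \<kappa>\<^sup>2) * norm (ln (real n) powr (2 * \<xi>) / sqrt (deg_moment 2 n (d n)))"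
    using eventually_regular i
  proof eventually_elim
    case (elim n)
    note n = elim(1)
    interpret G: chung_lu n "d n" \<kappa> "M n" "E n" by (rule regularD(1)[OF n])
    have "\<bar>G.expectation (\<lambda>\<omega>. v n \<omega> $ i n) - G.e (i n)\<bar> \<le> (C + 3 * \<kappa>\<^sup>2) * ((N n)\<^sup>2 / sqrt (deg_moment 2 n (d n)))"
      by (rule G.expectation_bound[OF regularD(2-5)[OF n] regularD(8)[OF n] elim(2) regularD(9)[OF n elim(2)] regularD(6)[OF n]])
    then show ?case using G.moment_pos[of 2] by (simp add: N_sq G.e_def)
  qed
qed

text \<open>Dropping the factors 1 - p_ij changes the sum by a factor between 1 - q and 1, and q is
  at most \<kappa> / sqrt n.\<close>

lemma s1_sq_asymp_equiv:
  assumes i: "\<forall>\<^sub>F n in sequentially. i n < n"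
  shows "(\<lambda>n. s1_sq n (d n) (i n)) \<sim>[sequentially]
    (\<lambda>n. real (d n (i n)) * (deg_moment 3 n (d n) / deg_moment 1 n (d n)))"
proof (rule asymp_equivI')
  let ?w = "\<lambda>n. real (d n (i n)) * (deg_moment 3 n (d n) / deg_moment 1 n (d n))"
  have bounds: "\<forall>\<^sub>F n in sequentially. 1 - \<kappa> / sqrt n \<le> s1_sq n (d n) (i n) / ?w n \<and> s1_sq n (d n) (i n) / ?w n \<le> 1"
    using eventually_regular i
  proof eventually_elim
    case (elim n)
    note n = elim(1)
    interpret G: chung_lu n "d n" \<kappa> "M n" "E n" by (rule regularD(1)[OF n])
    have w: "?w n > 0" using d_pos[OF elim(2)] G.moment_pos[of 1] G.moment_pos[of 3] by simp
    note q = regular_q_le[OF n]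
    have "(1 - \<kappa> / sqrt n) * ?w n \<le> (1 - G.q) * ?w n" using q w by (intro mult_right_mono) auto
    also have "\<dots> \<le> s1_sq n (d n) (i n)" by (rule G.s1_sq_ge[OF elim(2)])
    finally have "1 - \<kappa> / sqrt n \<le> s1_sq n (d n) (i n) / ?w n" using w by (subst pos_le_divide_eq)
    moreover have "s1_sq n (d n) (i n) / ?w n \<le> 1"
      using G.s1_sq_le[OF elim(2)] w by (subst pos_divide_le_eq) simp_all
    ultimately show ?case by blast
  qed
  show "(\<lambda>n. s1_sq n (d n) (i n) / ?w n) \<longlonglongrightarrow> 1"
  proof (rule tendsto_sandwich)
    show "(\<lambda>n. 1 - \<kappa> / sqrt (real n)) \<longlonglongrightarrow> 1" by real_asymp
    show "\<forall>\<^sub>F n in sequentially. 1 - \<kappa> / sqrt n \<le> s1_sq n (d n) (i n) / ?w n"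
      and "\<forall>\<^sub>F n in sequentially. s1_sq n (d n) (i n) / ?w n \<le> 1"
      using bounds unfolding eventually_conj_iff by blast+
  qed (rule tendsto_const)
qed

lemma normal_limit:
  assumes D4: "(\<lambda>n. ln (real n) powr (4 * \<xi>)) \<in> o(\<lambda>n. max_deg n (d n))"
    and i: "\<forall>\<^sub>F n in sequentially. i n < n"
  shows "weak_conv_m
    (\<lambda>n. distr (M n) borel (\<lambda>\<omega>. deg_moment 2 n (d n) powr (3/2) / deg_moment 1 n (d n) *
       ((v n \<omega> $ i n - real (d n (i n)) / sqrt (deg_moment 2 n (d n)))
         / sqrt (s1_sq n (d n) (i n)))))
    std_normal_distribution" (is "weak_conv_m ?\<mu> _")
proof (rule weak_conv_m_charI)
  show "\<forall>\<^sub>F n in sequentially. real_distribution (?\<mu> n)"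
    using eventually_regular i
  proof eventually_elim
    case (elim n)
    interpret G: chung_lu n "d n" \<kappa> "M n" "E n" by (rule regularD(1)[OF elim(1)])
    show ?case
      by (intro G.real_distribution_distr borel_measurable_times borel_measurable_divide
          borel_measurable_diff borel_measurable_const regularD(9)[OF elim])
  qed
  fix t :: real
  define b where "b n = \<bar>t\<bar> * (C * sqrt (2 * \<kappa> ^ 3) * sqrt ((N n) ^ 4 / D n)) + 2 * exp (- N n / 2)
      + \<bar>t\<bar> ^ 3 * sqrt (2 * \<kappa> ^ 3 * ((N n)\<^sup>2 / D n)) + t ^ 4 * (2 * \<kappa> ^ 3 * ((N n)\<^sup>2 / D n))" for n
  have "\<forall>\<^sub>F n in sequentially. cmod (char (?\<mu> n) t - exp (- (t\<^sup>2) / 2)) \<le> b n"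
    using eventually_regular i
  proof eventually_elim
    case (elim n)
    note n = elim(1)
    interpret G: chung_lu n "d n" \<kappa> "M n" "E n" by (rule regularD(1)[OF n])
    have q: "G.q \<le> 1 / 2" using regular_q_le[OF n] regularD(7)[OF n] by linarith
    show ?case
      using G.char_normalized_bound[OF regularD(2-5)[OF n] regularD(8)[OF n] elim(2) regularD(9)[OF n elim(2)] regularD(6)[OF n] q, of t]
      by (simp add: b_def G.e_def)
  qed
  moreover have "b \<longlonglongrightarrow> 0"
  proof -
    \<comment> \<open>The strengthened lower bound on the degrees enters here, for the error of
      replacing the eigenvector by its linear term.\<close>
    have r4: "(\<lambda>n. (N n) ^ 4 / D n) \<longlonglongrightarrow> 0" using smalloD_tendsto[OF D4] by (simp add: N_pow4)
    have "((\<lambda>x :: real. exp (- x / 2)) \<longlongrightarrow> 0) at_top" by real_asymp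
    then have "(\<lambda>n. exp (- N n / 2)) \<longlonglongrightarrow> 0" using N_at_top by (rule filterlim_compose)
    then have "b \<longlonglongrightarrow> \<bar>t\<bar> * (C * sqrt (2 * \<kappa> ^ 3) * sqrt 0) + 2 * 0 + \<bar>t\<bar> ^ 3 * sqrt (2 * \<kappa> ^ 3 * 0) + t ^ 4 * (2 * \<kappa> ^ 3 * 0)"
      unfolding b_def[abs_def] by (intro tendsto_intros r4 ratio_lim)
    then show ?thesis by simp
  qed
  ultimately have "(\<lambda>n. char (?\<mu> n) t - complex_of_real (exp (- (t\<^sup>2) / 2))) \<longlonglongrightarrow> 0"
    by (rule Lim_null_comparison)
  then show "(\<lambda>n. char (?\<mu> n) t) \<longlonglongrightarrow> char std_normal_distribution t"
    unfolding char_std_normal_distribution by (rule Lim_null[THEN iffD2])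
qed (rule real_dist_normal_dist)

end

theorem theorem1p6:
  fixes M :: "nat \<Rightarrow> 'a measure"
    and d :: "nat \<Rightarrow> nat \<Rightarrow> nat"
    and E :: "nat \<Rightarrow> 'a \<Rightarrow> nat set set"
    and v :: "nat \<Rightarrow> 'a \<Rightarrow> real Matrix.vec"
    and \<xi> :: real
  assumes d_pos: "\<And>n i. i < n \<Longrightarrow> d n i > 0"
    and xi: "\<xi> > 2"
    and D1_lower: "(\<lambda>n. ln (real n) powr (2 * \<xi>)) \<in> o(\<lambda>n. max_deg n (d n))"
    and D1_upper: "(\<lambda>n. max_deg n (d n)) \<in> o(\<lambda>n. real n powr (1/2))"
    and D2: "(\<lambda>n. min_deg n (d n)) \<in> \<Theta>(\<lambda>n. max_deg n (d n))"
    and graph: "\<forall>\<^sub>F n in sequentially. chung_lu_graph (M n) n (d n) (E n)"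
    and eigvec: "\<forall>\<^sub>F n in sequentially. leading_eigenvector_choice (M n) n (d n) (E n) (v n)"
  shows
    "(\<exists>\<epsilon>. \<epsilon> \<longlonglongrightarrow> 0 \<and>
        whp M (\<lambda>n \<omega>. \<bar>v n \<omega> \<bullet> degree_vec n (d n) - 1\<bar> \<le> \<epsilon> n)) \<and>
     (\<exists>C. whp M (\<lambda>n \<omega>. linf_norm_vec (v n \<omega> - degree_vec n (d n))
        \<le> C * (ln (real n) powr \<xi> / sqrt (real n * max_deg n (d n))))) \<and>
     (\<forall>i. (\<forall>\<^sub>F n in sequentially. i n < n) \<longrightarrow>
        (\<lambda>n. (\<integral>\<omega>. v n \<omega> $ i n \<partial>M n) - real (d n (i n)) / sqrt (deg_moment 2 n (d n)))
          \<in> O(\<lambda>n. ln (real n) powr (2 * \<xi>) / sqrt (deg_moment 2 n (d n)))) \<and>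
     ((\<lambda>n. ln (real n) powr (4 * \<xi>)) \<in> o(\<lambda>n. max_deg n (d n)) \<longrightarrow>
      (\<forall>i. (\<forall>\<^sub>F n in sequentially. i n < n) \<longrightarrow>
        weak_conv_m
          (\<lambda>n. distr (M n) borel (\<lambda>\<omega>. deg_moment 2 n (d n) powr (3/2) / deg_moment 1 n (d n) *
             ((v n \<omega> $ i n - real (d n (i n)) / sqrt (deg_moment 2 n (d n)))
               / sqrt (s1_sq n (d n) (i n)))))
          std_normal_distribution \<and>
        (\<lambda>n. s1_sq n (d n) (i n)) \<sim>[sequentially]
          (\<lambda>n. real (d n (i n)) * (deg_moment 3 n (d n) / deg_moment 1 n (d n)))))"
proof -
  have "(\<lambda>n. max_deg n (d n)) \<in> O(\<lambda>n. min_deg n (d n))"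
    using D2 by (simp add: bigtheta_sym bigthetaD1)
  then obtain c where c: "c > 0" "\<forall>\<^sub>F n in sequentially. norm (max_deg n (d n)) \<le> c * norm (min_deg n (d n))"
    by (elim landau_o.bigE)
  \<comment> \<open>The constant from (D2) may be below 1, while the powers of \<kappa> in the
    estimates are compared using \<kappa> \<ge> 1.\<close>
  define \<kappa> where "\<kappa> = max c 1"
  have ratio: "\<forall>\<^sub>F n in sequentially. max_deg n (d n) \<le> \<kappa> * min_deg n (d n)"
    using c(2)
  proof eventually_elim
    case (elim n)
    have "c * min_deg n (d n) \<le> \<kappa> * min_deg n (d n)"
      by (intro mult_right_mono) (auto simp: \<kappa>_def min_deg_def)
    with elim show ?case by (simp add: max_deg_def min_deg_def)
  qed
  interpret chung_lu_sequence M d E v \<xi> \<kappa>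
    using assms ratio by unfold_locales (auto simp: \<kappa>_def)
  have "(\<lambda>n. C * ((N n)\<^sup>2 / D n)) \<longlonglongrightarrow> 0"
    using tendsto_mult_left[OF ratio_lim, of C] by simp
  then have I: "\<exists>\<epsilon>. \<epsilon> \<longlonglongrightarrow> 0 \<and> whp M (\<lambda>n \<omega>. \<bar>v n \<omega> \<bullet> degree_vec n (d n) - 1\<bar> \<le> \<epsilon> n)"
    using overlap_whp by (intro exI[of _ "\<lambda>n. C * ((N n)\<^sup>2 / D n)"] conjI)
  show ?thesis
    by (intro conjI allI impI I exI[of _ "2 * C"] sup_norm_whp expectation_bigo normal_limit s1_sq_asymp_equiv)
qed

end
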